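(* Let $\mathcal{A}$ be a free arrangement in $\mathbb{C}^3$ with $\exp(\mathcal{A})=(1,a,b)$. If $\min(a,b)\leq 4$, then $\mathcal{A}$ is either inductively free or a dual Hesse arrangement, i.e., an arrangement with $|\mathcal{A}|=9$ whose set $L_2(\mathcal{A})$ of codimension $2$ intersections consists of $12$ triple lines.
   Context: A central arrangement $\mathcal{A}$ in $\mathbb{C}^3$ is a finite set of linear planes; for $H\in\mathcal{A}$ let $\alpha_H$ be a defining linear form. With $S=\mathbb{C}[x_1,x_2,x_3]$, let $D(\mathcal{A})=\{\theta\in\bigoplus_{i=1}^3 S\,\partial/\partial x_i \mid \theta(\alpha_H)\in S\alpha_H \text{ for all } H\in\mathcal{A}\}$. $\mathcal{A}$ is free with exponents $\exp(\mathcal{A})=(d_1,d_2,d_3)$ if $D(\mathcal{A})$ is a free $S$-module with a homogeneous basis $\theta_1,\theta_2,\theta_3$ with $\deg\theta_i=d_i$ (the degree of $\sum f_i\,\partial/\partial x_i$ is the common degree of the nonzero $f_i$). For nonempty free $\mathcal{A}$ one of the exponents is always $1$, and the order of exponents is irrelevant. $\mathcal{A}$ is inductively free if there is a filtration of subarrangements $\mathcal{A}_1\subset\mathcal{A}_2\subset\cdots\subset\mathcal{A}_\ell=\mathcal{A}$ with $|\mathcal{A}_i|=i$ and every $\mathcal{A}_i$ free. $L_2(\mathcal{A})$ is the set of codimension-$2$ intersections of planes of $\mathcal{A}$; such a line is triple if it lies in exactly $3$ planes of $\mathcal{A}$. *)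

theory Defs
  imports "HOL-Analysis.Analysis" "HOL-Library.Poly_Mapping"
begin

section \<open>The polynomial ring in three variables\<close>

text \<open>A polynomial maps exponent vectors to coefficients; the product of
  \<^theory>\<open>HOL-Library.Poly_Mapping\<close> is the convolution product, so this is
  the monoid algebra of \<open>\<nat>\<^sup>3\<close>, i.e. \<open>\<complex>[x\<^sub>1, x\<^sub>2, x\<^sub>3]\<close>.\<close>

type_synonym poly3 = "(3 \<Rightarrow>\<^sub>0 nat) \<Rightarrow>\<^sub>0 complex"

definition PVar :: "3 \<Rightarrow> poly3" where
  "PVar i = Poly_Mapping.single (Poly_Mapping.single i 1) 1"

definition PConst :: "complex \<Rightarrow> poly3" where
  "PConst c = Poly_Mapping.single 0 c"

definition mon_degree :: "(3 \<Rightarrow>\<^sub>0 nat) \<Rightarrow> nat" where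
  "mon_degree m = (\<Sum>i\<in>UNIV. Poly_Mapping.lookup m i)"

text \<open>The zero polynomial is homogeneous of every degree.\<close>

definition homogeneous :: "nat \<Rightarrow> poly3 \<Rightarrow> bool" where
  "homogeneous d p \<longleftrightarrow> (\<forall>m\<in>Poly_Mapping.keys p. mon_degree m = d)"

text \<open>If \<open>x\<^sub>i\<close> does not occur in the monomial \<open>m\<close>, the subtraction on exponents
  truncates, but the coefficient then vanishes.\<close>

definition partial_deriv :: "3 \<Rightarrow> poly3 \<Rightarrow> poly3" where
  "partial_deriv i p = (\<Sum>m\<in>Poly_Mapping.keys p.
     Poly_Mapping.single (m - Poly_Mapping.single i 1)
       (of_nat (Poly_Mapping.lookup m i) * Poly_Mapping.lookup p m))"

section \<open>Derivations\<close>

text \<open>The vector \<open>\<theta>\<close> stands for the derivation \<open>\<Sum>\<^sub>i \<theta>\<^sub>i \<partial>/\<partial>x\<^sub>i\<close>.\<close>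

type_synonym derivation = "poly3 ^ 3"

definition apply_deriv :: "derivation \<Rightarrow> poly3 \<Rightarrow> poly3" where
  "apply_deriv \<theta> p = (\<Sum>i\<in>UNIV. \<theta> $ i * partial_deriv i p)"

definition homogeneous_deriv :: "nat \<Rightarrow> derivation \<Rightarrow> bool" where
  "homogeneous_deriv d \<theta> \<longleftrightarrow> (\<forall>i. homogeneous d (\<theta> $ i))"

interpretation Der: module "(*s) :: poly3 \<Rightarrow> derivation \<Rightarrow> derivation"
  by unfold_locales (simp_all add: vec_eq_iff algebra_simps)

section \<open>Central arrangements in \<open>\<complex>\<^sup>3\<close>\<close>

definition linear_plane :: "(complex ^ 3) set \<Rightarrow> bool" where
  "linear_plane H \<longleftrightarrow> vec.subspace H \<and> vec.dim H = 2"

definition central_arrangement :: "(complex ^ 3) set set \<Rightarrow> bool" where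
  "central_arrangement \<A> \<longleftrightarrow> finite \<A> \<and> (\<forall>H\<in>\<A>. linear_plane H)"

definition linear_form :: "complex ^ 3 \<Rightarrow> poly3" where
  "linear_form c = (\<Sum>i\<in>UNIV. PConst (c $ i) * PVar i)"

definition defining_form :: "(complex ^ 3) set \<Rightarrow> poly3 \<Rightarrow> bool" where
  "defining_form H \<alpha> \<longleftrightarrow>
     (\<exists>c. \<alpha> = linear_form c \<and> H = {v. (\<Sum>i\<in>UNIV. c $ i * v $ i) = 0})"

text \<open>Defining forms of a plane exist and are unique up to a nonzero scalar, so it
  does not matter that all of them are considered here.\<close>

definition log_derivations :: "(complex ^ 3) set set \<Rightarrow> derivation set" where
  "log_derivations \<A> =
     {\<theta>. \<forall>H\<in>\<A>. \<forall>\<alpha>. defining_form H \<alpha> \<longrightarrow> \<alpha> dvd apply_deriv \<theta> \<alpha>}"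

text \<open>The exponents are given up to order: permuting the basis permutes
  \<open>d\<^sub>1, d\<^sub>2, d\<^sub>3\<close>.\<close>

definition free_with_exponents ::
    "(complex ^ 3) set set \<Rightarrow> nat \<Rightarrow> nat \<Rightarrow> nat \<Rightarrow> bool" where
  "free_with_exponents \<A> d\<^sub>1 d\<^sub>2 d\<^sub>3 \<longleftrightarrow>
     (\<exists>\<theta>\<^sub>1 \<theta>\<^sub>2 \<theta>\<^sub>3. distinct [\<theta>\<^sub>1, \<theta>\<^sub>2, \<theta>\<^sub>3]
        \<and> Der.independent {\<theta>\<^sub>1, \<theta>\<^sub>2, \<theta>\<^sub>3}
        \<and> Der.span {\<theta>\<^sub>1, \<theta>\<^sub>2, \<theta>\<^sub>3} = log_derivations \<A>
        \<and> homogeneous_deriv d\<^sub>1 \<theta>\<^sub>1 \<and> homogeneous_deriv d\<^sub>2 \<theta>\<^sub>2 \<and> homogeneous_deriv d\<^sub>3 \<theta>\<^sub>3)"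

definition free_arrangement :: "(complex ^ 3) set set \<Rightarrow> bool" where
  "free_arrangement \<A> \<longleftrightarrow> (\<exists>d\<^sub>1 d\<^sub>2 d\<^sub>3. free_with_exponents \<A> d\<^sub>1 d\<^sub>2 d\<^sub>3)"

definition inductively_free :: "(complex ^ 3) set set \<Rightarrow> bool" where
  "inductively_free \<A> \<longleftrightarrow>
     (\<exists>F :: nat \<Rightarrow> (complex ^ 3) set set.
        F (card \<A>) = \<A>
        \<and> (\<forall>i\<in>{1..card \<A>}. card (F i) = i \<and> free_arrangement (F i))
        \<and> (\<forall>i\<in>{1..<card \<A>}. F i \<subset> F (Suc i)))"

text \<open>In \<open>\<complex>\<^sup>3\<close>, codimension 2 means dimension 1.\<close>

definition L2 :: "(complex ^ 3) set set \<Rightarrow> (complex ^ 3) set set" where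
  "L2 \<A> = {X. (\<exists>\<B>\<subseteq>\<A>. X = \<Inter>\<B>) \<and> vec.dim X = 1}"

definition triple_line :: "(complex ^ 3) set set \<Rightarrow> (complex ^ 3) set \<Rightarrow> bool" where
  "triple_line \<A> X \<longleftrightarrow> card {H\<in>\<A>. X \<subseteq> H} = 3"

definition dual_Hesse :: "(complex ^ 3) set set \<Rightarrow> bool" where
  "dual_Hesse \<A> \<longleftrightarrow>
     card \<A> = 9 \<and> card (L2 \<A>) = 12 \<and> (\<forall>X\<in>L2 \<A>. triple_line \<A> X)"

end

theory Submission
  imports Defs
begin

text \<open>
  Let \<open>M = \<Sum>\<^sub>P (m\<^sub>P - 1)\<close>, where \<open>P\<close> runs over the intersection lines and \<open>m\<^sub>P\<close> is the number
  of planes through \<open>P\<close>, and let \<open>n\<^sub>H\<close> be the number of intersection lines on \<open>H\<close>. Saito's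
  criterion turns freeness into two logarithmic derivations \<open>\<phi>\<close>, \<open>\<psi>\<close> of degrees \<open>a\<close>, \<open>b\<close> which
  together with the Euler derivation have determinant \<open>Q\<close>. Restricting them to a plane \<open>H\<close> shows
  that either removing \<open>H\<close> lowers one of the exponents, and then \<open>n\<^sub>H\<close> is one more than the other
  exponent, or \<open>n\<^sub>H \<le> min a b\<close>.

  If \<open>\<theta>\<close> is logarithmic for all planes but \<open>H\<close>, then \<open>\<theta>(\<alpha>\<^sub>H)\<close> vanishes on \<open>P \<subseteq> H\<close> to order
  \<open>m\<^sub>P - 2\<close>; adding the planes one by one bounds the dimension of the space of logarithmic
  derivations of a large degree from below, and comparison with a homogeneous basis gives
  \<open>M \<ge> ab + a + b\<close>. When no plane can be removed, this and \<open>n\<^sub>H \<le> min a b \<le> 4\<close> for all \<open>H\<close>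
  leave, by the Cauchy-Schwarz inequality, only the dual Hesse lattice.
\<close>

text \<open>The number 4 matters in the terminal case, where there are at least two planes and n_H
  \<le> a \<le> b for every H. The variance inequality then reads 5a^2 - 3ab + b^2 - 4a - 8b \<ge>
  0, and counting incidences gives b + 1 \<le> a^2. For a = 4 these say (b - 4)(b - 16) \<ge> 0 and
  b \<le> 15, so b = 4; smaller a are excluded, while a = b = 5 passes both tests.

  The bound on n_H comes from the cross product of v and \<phi>(v): on H it vanishes along all n_H
  lines and has degree a + 1. If n_H = a + 1, a multiple of \<phi> can be subtracted from \<psi> to
  make it radial on H, hence divisible by \<open>form H\<close> modulo the Euler derivation, and
  this is already a deletion.

  Counting dimensions yields only an inequality for M. Equality holds in the terminal cases and
  survives putting a plane back, since M and ab + a + b both grow by n_H. It is used when a deletion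
  ends in a dual Hesse arrangement: it then fixes the exponents, and a different plane has to be
  removed.\<close>

section \<open>Polynomials as functions on the space\<close>

definition evp :: "poly3 \<Rightarrow> complex ^ 3 \<Rightarrow> complex" where
  "evp p v = (\<Sum>m\<in>Poly_Mapping.keys p. Poly_Mapping.lookup p m * (\<Prod>i\<in>UNIV. v $ i ^ Poly_Mapping.lookup m i))"

text \<open>Bilinear, without complex conjugation, so that \<open>bdot n\<close> is the function of
  the polynomial \<open>linear_form n\<close>.\<close>

definition bdot :: "complex ^ 3 \<Rightarrow> complex ^ 3 \<Rightarrow> complex" where
  "bdot n v = (\<Sum>i\<in>UNIV. n $ i * v $ i)"

lemma evp_superset:
  assumes "finite A" "Poly_Mapping.keys p \<subseteq> A"
  shows "evp p v = (\<Sum>m\<in>A. Poly_Mapping.lookup p m * (\<Prod>i\<in>UNIV. v $ i ^ Poly_Mapping.lookup m i))"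
  unfolding evp_def using assms
  by (intro sum.mono_neutral_left) (auto simp: in_keys_iff)

lemma evp_0 [simp]: "evp 0 v = 0"
  by (simp add: evp_def)

lemma evp_add [simp]: "evp (p + q) v = evp p v + evp q v"
proof -
  let ?A = "Poly_Mapping.keys p \<union> Poly_Mapping.keys q"
  have "Poly_Mapping.keys (p + q) \<subseteq> ?A"
    by (rule keys_add)
  then show ?thesis
    by (simp add: evp_superset[of ?A] lookup_add algebra_simps sum.distrib)
qed

lemma evp_uminus [simp]: "evp (- p) v = - evp p v"
  using evp_add[of p "- p" v] by (simp add: add_eq_0_iff)

lemma evp_diff [simp]: "evp (p - q) v = evp p v - evp q v"
  using evp_add[of p "- q" v] by simp

lemma evp_single [simp]:
  "evp (Poly_Mapping.single m c) v = c * (\<Prod>i\<in>UNIV. v $ i ^ Poly_Mapping.lookup m i)"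
  by (simp add: evp_superset[of "{m}"])

lemma evp_sum [simp]: "evp (sum f A) v = (\<Sum>x\<in>A. evp (f x) v)"
  by (induction A rule: infinite_finite_induct) auto

lemma poly_mapping_sum_single:
  "p = (\<Sum>m\<in>Poly_Mapping.keys p. Poly_Mapping.single m (Poly_Mapping.lookup p m))"
  by (rule poly_mapping_eqI)
    (auto simp: lookup_sum lookup_single when_def in_keys_iff)

lemma evp_mult [simp]: "evp (p * q) v = evp p v * evp q v"
proof -
  have "p * q = (\<Sum>m\<in>Poly_Mapping.keys p. Poly_Mapping.single m (Poly_Mapping.lookup p m)) *
    (\<Sum>m\<in>Poly_Mapping.keys q. Poly_Mapping.single m (Poly_Mapping.lookup q m))"
    using poly_mapping_sum_single[of p] poly_mapping_sum_single[of q] by simp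
  also have "\<dots> = (\<Sum>m\<in>Poly_Mapping.keys p. \<Sum>n\<in>Poly_Mapping.keys q.
      Poly_Mapping.single (m + n) (Poly_Mapping.lookup p m * Poly_Mapping.lookup q n))"
    by (simp add: sum_product mult_single)
  finally have "evp (p * q) v = (\<Sum>m\<in>Poly_Mapping.keys p. \<Sum>n\<in>Poly_Mapping.keys q.
      Poly_Mapping.lookup p m * Poly_Mapping.lookup q n *
      ((\<Prod>i\<in>UNIV. v $ i ^ Poly_Mapping.lookup m i) * (\<Prod>i\<in>UNIV. v $ i ^ Poly_Mapping.lookup n i)))"
    by (simp add: lookup_add power_add prod.distrib)
  also have "\<dots> = evp p v * evp q v"
    unfolding evp_def sum_product by (intro sum.cong refl) (simp add: mult_ac)
  finally show ?thesis .
qed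

lemma evp_PConst [simp]: "evp (PConst c) v = c"
  by (simp add: PConst_def)

lemma PConst_1: "PConst 1 = 1"
  by (simp add: PConst_def)

lemma PConst_0 [simp]: "PConst 0 = 0"
  by (simp add: PConst_def)

lemma evp_1 [simp]: "evp 1 v = 1"
  using evp_PConst[of 1 v] by (simp add: PConst_1)

lemma evp_PVar [simp]: "evp (PVar i) v = v $ i"
proof -
  have "(\<Prod>j\<in>UNIV. v $ j ^ Poly_Mapping.lookup (Poly_Mapping.single i 1) j) =
    (\<Prod>j\<in>UNIV. if j = i then v $ j else 1)"
    by (intro prod.cong) (auto simp: lookup_single when_def)
  then show ?thesis by (simp add: PVar_def)
qed

lemma evp_power [simp]: "evp (p ^ n) v = evp p v ^ n"
  by (induction n) auto

lemma evp_prod [simp]: "evp (prod f A) v = (\<Prod>x\<in>A. evp (f x) v)"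
  by (induction A rule: infinite_finite_induct) auto

lemma evp_linear_form [simp]: "evp (linear_form c) v = bdot c v"
  by (simp add: linear_form_def bdot_def)

text \<open>Injectivity of the exponents in the Kronecker substitution below; the leading digit may
  be of any size.\<close>

lemma base_expansion_unique:
  fixes a b c a' b' c' K :: nat
  assumes "a + K * (b + K * c) = a' + K * (b' + K * c')"
    and "a < K" "a' < K" "b < K" "b' < K"
  shows "a = a' \<and> b = b' \<and> c = c'"
proof -
  have *: "(x + K * y) mod K = x" "(x + K * y) div K = y" if "x < K" for x y :: nat
    using that by auto
  have "a = a'" "b + K * c = b' + K * c'"
    using *[of a "b + K * c"] *[of a' "b' + K * c'"] assms by metis+
  moreover from this(2) have "b = b'" "c = c'"
    using *[of b c] *[of b' c'] assms by metis+
  ultimately show ?thesis by blast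
qed

lemma prod_3: "prod f (UNIV :: 3 set) = f 1 * f 2 * f 3" for f :: "3 \<Rightarrow> complex"
  unfolding UNIV_3 by (simp add: ac_simps)

text \<open>Kronecker substitution \<open>x\<^sub>1 = t\<close>, \<open>x\<^sub>2 = t\<^sup>K\<close>, \<open>x\<^sub>3 = t\<^bsup>K\<^sup>2\<^esup>\<close> with \<open>K\<close> larger
  than all exponents separates the monomials.\<close>

lemma evp_eq_0_imp:
  assumes "\<And>v. evp p v = 0"
  shows "p = 0"
proof (rule poly_mapping_eqI)
  fix m0
  \<comment> \<open>Including \<open>m0\<close> makes K exceed its exponents too, so that its
    coefficient can be isolated even if it is zero.\<close>
  define X where "X = insert m0 (Poly_Mapping.keys p)"
  have fin: "finite X" by (simp add: X_def)
  define K where "K = Suc (\<Sum>m\<in>X. \<Sum>i\<in>UNIV. Poly_Mapping.lookup m i)"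
  have K: "Poly_Mapping.lookup m i < K" if "m \<in> X" for m i
  proof -
    have "Poly_Mapping.lookup m i \<le> (\<Sum>i\<in>UNIV. Poly_Mapping.lookup m i)"
      by (rule member_le_sum) auto
    also have "\<dots> \<le> (\<Sum>m\<in>X. \<Sum>i\<in>UNIV. Poly_Mapping.lookup m i)"
      using that fin by (intro member_le_sum) auto
    finally show ?thesis by (simp add: K_def)
  qed
  define e where "e m = Poly_Mapping.lookup m 1 + K * (Poly_Mapping.lookup m 2 + K * Poly_Mapping.lookup m 3)"
    for m :: "3 \<Rightarrow>\<^sub>0 nat"
  have inj: "m = m'" if "m \<in> X" "m' \<in> X" "e m = e m'" for m m'
  proof -
    have "Poly_Mapping.lookup m 1 = Poly_Mapping.lookup m' 1 \<and>
      Poly_Mapping.lookup m 2 = Poly_Mapping.lookup m' 2 \<and> Poly_Mapping.lookup m 3 = Poly_Mapping.lookup m' 3"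
      using that K by (intro base_expansion_unique[of _ K]) (auto simp: e_def)
    then show ?thesis
      by (intro poly_mapping_eqI) (metis exhaust_3)
  qed
  define r where "r = (\<Sum>m\<in>X. monom (Poly_Mapping.lookup p m) (e m))"
  have "poly r t = 0" for t
  proof -
    define v :: "complex ^ 3" where "v = vector [t, t ^ K, t ^ (K * K)]"
    have "(\<Prod>i\<in>UNIV. v $ i ^ Poly_Mapping.lookup m i) = t ^ e m" for m :: "3 \<Rightarrow>\<^sub>0 nat"
    proof -
      have "e m = Poly_Mapping.lookup m 1 + K * Poly_Mapping.lookup m 2 + K * K * Poly_Mapping.lookup m 3"
        by (simp add: e_def distrib_left)
      then show ?thesis
        by (simp only: prod_3 v_def vector_3 power_add power_mult)
    qed
    moreover have "evp p v = (\<Sum>m\<in>X. Poly_Mapping.lookup p m * (\<Prod>i\<in>UNIV. v $ i ^ Poly_Mapping.lookup m i))"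
      using fin by (intro evp_superset) (auto simp: X_def)
    ultimately show ?thesis
      using assms[of v] by (simp add: r_def poly_sum poly_monom)
  qed
  then have "r = 0"
    by (metis poly_all_0_iff_0)
  then have "0 = coeff r (e m0)" by simp
  also have "\<dots> = (\<Sum>m\<in>X. if m = m0 then Poly_Mapping.lookup p m else 0)"
    unfolding r_def coeff_sum
    by (intro sum.cong refl) (use inj in \<open>auto simp: X_def\<close>)
  also have "\<dots> = Poly_Mapping.lookup p m0"
    using fin by (simp add: X_def)
  finally show "Poly_Mapping.lookup p m0 = Poly_Mapping.lookup 0 m0" by simp
qed

lemma evp_eqI: "(\<And>v. evp p v = evp q v) \<Longrightarrow> p = q"
  using evp_eq_0_imp[of "p - q"] by simp

lemma poly3_cancel:
  fixes p q r :: poly3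
  assumes "p * q = p * r" "p \<noteq> 0"
  shows "q = r"
  using assms by simp

lemma PConst_eq_0_iff [simp]: "PConst c = 0 \<longleftrightarrow> c = 0"
  by (metis PConst_0 evp_PConst evp_0)

lemma lookup_PConst_mult:
  "Poly_Mapping.lookup (PConst c * p) m = c * Poly_Mapping.lookup p m"
  by (simp add: PConst_def flip: mult_map_scale_conv_mult)
    (simp add: Poly_Mapping.map.rep_eq when_def)

lemma single_eq_PConst_PVar:
  "Poly_Mapping.single m c = PConst c * (\<Prod>i\<in>UNIV. PVar i ^ Poly_Mapping.lookup m i)"
  by (rule evp_eqI) simp

subsection \<open>Homogeneous polynomials\<close>

text \<open>The substitution of 2x for x. Powers of 2 are distinct, so homogeneity of degree d
  becomes the single identity \<open>dilate p = PConst (2 ^ d) * p\<close>; as \<open>dilate\<close>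
  is multiplicative, this form passes to products and to factors.\<close>

definition dilate :: "poly3 \<Rightarrow> poly3" where
  "dilate p = (\<Sum>m\<in>Poly_Mapping.keys p. Poly_Mapping.single m (2 ^ mon_degree m * Poly_Mapping.lookup p m))"

lemma lookup_dilate: "Poly_Mapping.lookup (dilate p) m = 2 ^ mon_degree m * Poly_Mapping.lookup p m"
  by (auto simp: dilate_def lookup_sum lookup_single when_def in_keys_iff)

lemma prod_scale_monomial:
  "(\<Prod>i\<in>UNIV. (c *s v) $ i ^ Poly_Mapping.lookup m i) =
    c ^ mon_degree m * (\<Prod>i\<in>UNIV. v $ i ^ Poly_Mapping.lookup m i)"
  for v :: "complex ^ 3"
  by (simp add: power_mult_distrib prod.distrib mon_degree_def power_sum)

lemma evp_dilate: "evp (dilate p) v = evp p (2 *s v)"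
proof -
  have "evp (dilate p) v = (\<Sum>m\<in>Poly_Mapping.keys p. Poly_Mapping.lookup (dilate p) m * (\<Prod>i\<in>UNIV. v $ i ^ Poly_Mapping.lookup m i))"
    by (rule evp_superset) (auto simp: in_keys_iff lookup_dilate)
  then show ?thesis
    unfolding evp_def[of p "2 *s v"] prod_scale_monomial
    by (simp add: lookup_dilate mult_ac)
qed

lemma dilate_mult: "dilate (p * q) = dilate p * dilate q"
  by (rule evp_eqI) (simp add: evp_dilate)

lemma homogeneous_evp: "homogeneous d p \<Longrightarrow> evp p (c *s v) = c ^ d * evp p v"
  unfolding evp_def prod_scale_monomial sum_distrib_left homogeneous_def
  by (intro sum.cong) (auto simp: mult_ac)

lemma homogeneous_dilate: "homogeneous d p \<longleftrightarrow> dilate p = PConst (2 ^ d) * p"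
proof
  assume "homogeneous d p"
  then show "dilate p = PConst (2 ^ d) * p"
    by (intro evp_eqI) (simp add: evp_dilate homogeneous_evp)
next
  assume *: "dilate p = PConst (2 ^ d) * p"
  show "homogeneous d p"
    unfolding homogeneous_def
  proof
    fix m assume "m \<in> Poly_Mapping.keys p"
    then have "Poly_Mapping.lookup p m \<noteq> 0" by (simp add: in_keys_iff)
    then have "(2::complex) ^ mon_degree m = 2 ^ d"
      using arg_cong[OF *, of "\<lambda>q. Poly_Mapping.lookup q m"] by (simp add: lookup_PConst_mult lookup_dilate)
    then have "(2::nat) ^ mon_degree m = 2 ^ d"
      by (metis (mono_tags, lifting) of_nat_eq_iff of_nat_numeral of_nat_power)
    then show "mon_degree m = d" by simp
  qed
qed

lemma homogeneous_iff: "homogeneous d p \<longleftrightarrow> (\<forall>v. evp p (2 *s v) = 2 ^ d * evp p v)"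
  unfolding homogeneous_dilate
  by (metis evp_PConst evp_dilate evp_eqI evp_mult)

lemma homogeneous_0 [simp]: "homogeneous d 0"
  by (simp add: homogeneous_def)

lemma homogeneous_add: "homogeneous d p \<Longrightarrow> homogeneous d q \<Longrightarrow> homogeneous d (p + q)"
  by (simp add: homogeneous_iff algebra_simps)

lemma homogeneous_diff: "homogeneous d p \<Longrightarrow> homogeneous d q \<Longrightarrow> homogeneous d (p - q)"
  by (simp add: homogeneous_iff algebra_simps)

lemma homogeneous_mult: "homogeneous d p \<Longrightarrow> homogeneous e q \<Longrightarrow> homogeneous (d + e) (p * q)"
  by (simp add: homogeneous_iff power_add)

lemma homogeneous_PConst [simp]: "homogeneous 0 (PConst c)"
  by (simp add: homogeneous_iff)

lemma homogeneous_PVar [simp]: "homogeneous 1 (PVar i)"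
  by (simp add: homogeneous_iff)

lemma homogeneous_linear_form [simp]: "homogeneous (Suc 0) (linear_form c)"
  by (simp add: homogeneous_iff bdot_def sum_distrib_left mult_ac)

lemma homogeneous_PConst_mult: "homogeneous d p \<Longrightarrow> homogeneous d (PConst c * p)"
  by (simp add: homogeneous_iff)

lemma homogeneous_sum: "(\<And>x. x \<in> A \<Longrightarrow> homogeneous d (f x)) \<Longrightarrow> homogeneous d (sum f A)"
  by (induction A rule: infinite_finite_induct) (auto intro: homogeneous_add)

lemma homogeneous_prod_linear:
  "(\<And>x. x \<in> A \<Longrightarrow> homogeneous (Suc 0) (f x)) \<Longrightarrow> finite A \<Longrightarrow> homogeneous (card A) (prod f A)"
proof (induction A rule: infinite_finite_induct)
  case empty
  then show ?case using homogeneous_PConst[of 1] by (simp add: PConst_1)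
next
  case (insert x F)
  then show ?case using homogeneous_mult[of "Suc 0" "f x" "card F" "prod f F"] by simp
qed auto

lemma homogeneous_0_const: "homogeneous 0 p \<Longrightarrow> p = PConst (evp p 0)"
proof (rule evp_eqI)
  fix v assume "homogeneous 0 p"
  from homogeneous_evp[OF this, of 0 v] show "evp p v = evp (PConst (evp p 0)) v"
    by simp
qed

lemma homogeneous_unique: "homogeneous d p \<Longrightarrow> homogeneous e p \<Longrightarrow> p \<noteq> 0 \<Longrightarrow> d = e"
  unfolding homogeneous_def using keys_eq_empty by (metis ex_in_conv keys_eq_empty)

text \<open>Cancelling p from the dilation identity of p q leaves one for q. Comparing any nonzero
  coefficient of q then gives its degree, and in particular m \<le> n.\<close>

lemma homogeneous_factor:
  assumes "homogeneous n (p * q)" "homogeneous m p" "p \<noteq> 0" "q \<noteq> 0"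
  shows "m \<le> n \<and> homogeneous (n - m) q"
proof -
  have "p * (PConst (2 ^ m) * dilate q) = p * (PConst (2 ^ n) * q)"
    using assms(1,2) unfolding homogeneous_dilate dilate_mult by (simp add: mult_ac)
  then have eq: "PConst (2 ^ m) * dilate q = PConst (2 ^ n) * q"
    using poly3_cancel assms(3) by blast
  have *: "m + mon_degree k = n" if "k \<in> Poly_Mapping.keys q" for k
  proof -
    have "Poly_Mapping.lookup q k \<noteq> 0" using that by (simp add: in_keys_iff)
    then have "(2::complex) ^ (m + mon_degree k) = 2 ^ n"
      using arg_cong[OF eq, of "\<lambda>q. Poly_Mapping.lookup q k"] by (simp add: lookup_PConst_mult lookup_dilate power_add)
    then have "(2::nat) ^ (m + mon_degree k) = 2 ^ n"
      by (metis (mono_tags, lifting) of_nat_eq_iff of_nat_numeral of_nat_power)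
    then show ?thesis by simp
  qed
  obtain k where "k \<in> Poly_Mapping.keys q"
    using assms(4) keys_eq_empty by (metis ex_in_conv)
  with * have "m \<le> n" by force
  moreover have "homogeneous (n - m) q"
    unfolding homogeneous_def using * by force
  ultimately show ?thesis by simp
qed

subsection \<open>Restriction to lines\<close>

text \<open>Restriction to the affine line v + t w as a polynomial in t, which makes roots, their
  orders and the degree available.\<close>

definition line_poly :: "poly3 \<Rightarrow> complex ^ 3 \<Rightarrow> complex ^ 3 \<Rightarrow> complex poly" where
  "line_poly p v w = (\<Sum>m\<in>Poly_Mapping.keys p.
     smult (Poly_Mapping.lookup p m) (\<Prod>i\<in>UNIV. [:v $ i, w $ i:] ^ Poly_Mapping.lookup m i))"

lemma poly_line_poly [simp]: "poly (line_poly p v w) t = evp p (v + t *s w)"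
  by (simp add: line_poly_def evp_def poly_sum poly_prod)

lemma degree_line_poly: "homogeneous d p \<Longrightarrow> degree (line_poly p v w) \<le> d"
proof -
  assume hom: "homogeneous d p"
  have "degree (\<Prod>i\<in>UNIV. [:v $ i, w $ i:] ^ Poly_Mapping.lookup m i) \<le> mon_degree m" for m :: "3 \<Rightarrow>\<^sub>0 nat"
  proof -
    have "degree (\<Prod>i\<in>UNIV. [:v $ i, w $ i:] ^ Poly_Mapping.lookup m i) \<le>
      (\<Sum>i\<in>UNIV. degree ([:v $ i, w $ i:] ^ Poly_Mapping.lookup m i))"
      by (rule degree_prod_sum_le[unfolded o_def]) simp
    also have "\<dots> \<le> (\<Sum>i\<in>UNIV. Poly_Mapping.lookup m i)"
    proof (rule sum_mono)
      fix i
      have "degree ([:v $ i, w $ i:] ^ Poly_Mapping.lookup m i) \<le> degree [:v $ i, w $ i:] * Poly_Mapping.lookup m i"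
        by (rule degree_power_le)
      also have "\<dots> \<le> Poly_Mapping.lookup m i" by simp
      finally show "degree ([:v $ i, w $ i:] ^ Poly_Mapping.lookup m i) \<le> Poly_Mapping.lookup m i" .
    qed
    finally show ?thesis by (simp add: mon_degree_def)
  qed
  with hom show ?thesis
    unfolding line_poly_def homogeneous_def
    by (intro degree_sum_le) (auto intro: order.trans[OF degree_smult_le])
qed

text \<open>The ideal of a subspace is prime: on the line from w to v, which stays in S, the product
  of the two restrictions is zero and the first is nonzero at t = 0, so the second is zero, in
  particular at t = 1.\<close>

lemma evp_cancel_subspace:
  assumes S: "vec.subspace S" and pq: "\<And>v. v \<in> S \<Longrightarrow> evp p v * evp q v = 0"
    and w: "w \<in> S" "evp p w \<noteq> 0" and v: "v \<in> S"
  shows "evp q v = 0"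
proof -
  have "poly (line_poly p w (v - w) * line_poly q w (v - w)) t = 0" for t
    using pq[of "w + t *s (v - w)"] S w v
    by (simp add: vec.subspace_add vec.subspace_diff vec.subspace_scale)
  then have "line_poly p w (v - w) * line_poly q w (v - w) = 0"
    by (metis poly_all_0_iff_0)
  moreover have "poly (line_poly p w (v - w)) 0 \<noteq> 0"
    using w by simp
  ultimately have "line_poly q w (v - w) = 0"
    by (metis mult_eq_0_iff poly_0)
  then have "poly (line_poly q w (v - w)) 1 = 0" by simp
  then show ?thesis by simp
qed

subsection \<open>Planes and divisibility by linear forms\<close>

lemma bdot_add_right [simp]: "bdot n (v + w) = bdot n v + bdot n w"
  by (simp add: bdot_def algebra_simps sum.distrib)

lemma bdot_diff_right [simp]: "bdot n (v - w) = bdot n v - bdot n w"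
  by (simp add: bdot_def algebra_simps sum_subtractf)

lemma bdot_scale_right [simp]: "bdot n (c *s v) = c * bdot n v"
  by (simp add: bdot_def sum_distrib_left mult_ac)

lemma bdot_add_left [simp]: "bdot (n + m) v = bdot n v + bdot m v"
  by (simp add: bdot_def algebra_simps sum.distrib)

lemma bdot_diff_left [simp]: "bdot (n - m) v = bdot n v - bdot m v"
  by (simp add: bdot_def algebra_simps sum_subtractf)

lemma bdot_scale_left [simp]: "bdot (c *s n) v = c * bdot n v"
  by (simp add: bdot_def sum_distrib_left mult_ac)

lemma bdot_zero [simp]: "bdot n 0 = 0" "bdot 0 v = 0"
  by (simp_all add: bdot_def)

lemma bdot_axis [simp]: "bdot n (axis k c) = n $ k * c"
  by (simp add: bdot_def axis_def if_distrib cong: if_cong)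

definition plane :: "complex ^ 3 \<Rightarrow> (complex ^ 3) set" where
  "plane n = {v. bdot n v = 0}"

lemma mem_plane [simp]: "v \<in> plane n \<longleftrightarrow> bdot n v = 0"
  by (simp add: plane_def)

lemma subspace_plane: "vec.subspace (plane n)"
  by (rule vec.subspaceI) auto

lemma nonzero_component: "n \<noteq> 0 \<Longrightarrow> \<exists>k. n $ k \<noteq> (0 :: complex)" for n :: "complex ^ 3"
  by (auto simp: vec_eq_iff)

lemma linear_form_eq_0_iff [simp]: "linear_form n = 0 \<longleftrightarrow> n = 0"
proof
  assume "linear_form n = 0"
  then have "bdot n (axis k 1) = 0" for k
    by (metis evp_0 evp_linear_form)
  then show "n = 0" by (simp add: vec_eq_iff)
next
  show "n = 0 \<Longrightarrow> linear_form n = 0"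
    by (simp add: linear_form_def)
qed

lemma linear_form_diff: "linear_form (b - c *s a) = linear_form b - PConst c * linear_form a"
  by (rule evp_eqI) simp

text \<open>Division with remainder by a linear form. The remainder is p composed with the
  projection onto the plane along the k-th axis, so it depends only on the values of p on the plane.
  The polynomials that admit such a division are closed under sums and products and include
  constants and variables.\<close>

lemma projection_decomposition:
  fixes p :: poly3
  assumes "n $ k \<noteq> 0"
  shows "\<exists>q r. p = linear_form n * q + r \<and>
    (\<forall>v. evp r v = evp p (v - (bdot n v / n $ k) *s axis k 1))"
proof -
  define \<pi> where "\<pi> v = v - (bdot n v / n $ k) *s axis k 1" for v
  define P where "P p \<longleftrightarrow> (\<exists>q r. p = linear_form n * q + r \<and> (\<forall>v. evp r v = evp p (\<pi> v)))" for p
  have add: "P (p + q)" if pq: "P p" "P q" for p q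
  proof -
    obtain a r where p: "p = linear_form n * a + r" "\<forall>v. evp r v = evp p (\<pi> v)"
      using pq(1) unfolding P_def by blast
    obtain b s where q: "q = linear_form n * b + s" "\<forall>v. evp s v = evp q (\<pi> v)"
      using pq(2) unfolding P_def by blast
    have "p + q = linear_form n * (a + b) + (r + s)"
      unfolding p(1) q(1) by (simp only: distrib_left add_ac)
    moreover have "evp (r + s) v = evp (p + q) (\<pi> v)" for v
      by (simp only: evp_add p(2) q(2))
    ultimately show ?thesis unfolding P_def by blast
  qed
  have mult: "P (p * q)" if pq: "P p" "P q" for p q
  proof -
    obtain a r where p: "p = linear_form n * a + r" "\<forall>v. evp r v = evp p (\<pi> v)"
      using pq(1) unfolding P_def by blast
    obtain b s where q: "q = linear_form n * b + s" "\<forall>v. evp s v = evp q (\<pi> v)"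
      using pq(2) unfolding P_def by blast
    have "p * q = linear_form n * (linear_form n * a * b + a * s + r * b) + r * s"
      unfolding p(1) q(1) by (simp only: distrib_left distrib_right add_ac mult_ac)
    moreover have "evp (r * s) v = evp (p * q) (\<pi> v)" for v
      by (simp only: evp_mult p(2) q(2))
    ultimately show ?thesis unfolding P_def by blast
  qed
  have const: "P (PConst c)" for c
    unfolding P_def by (intro exI[of _ 0] exI[of _ "PConst c"]) simp
  have var: "P (PVar i)" for i
  proof (cases "i = k")
    case True
    have "PVar k = linear_form n * PConst (1 / n $ k) + (PVar k - linear_form n * PConst (1 / n $ k))"
      by simp
    moreover have "evp (PVar k - linear_form n * PConst (1 / n $ k)) v = evp (PVar k) (\<pi> v)" for v
      by (simp add: \<pi>_def)
    ultimately show ?thesis unfolding P_def True by blast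
  next
    case False
    then show ?thesis unfolding P_def
      by (intro exI[of _ 0] exI[of _ "PVar i"]) (simp add: \<pi>_def axis_def)
  qed
  have power: "P (PVar i ^ e)" for i e
    by (induction e) (use const[of 1] in \<open>auto simp: PConst_1 intro: mult var\<close>)
  have prod: "P (\<Prod>i\<in>A. PVar i ^ e i)" if "finite A" for A e
    using that by (induction A) (use const[of 1] in \<open>auto simp: PConst_1 intro: mult power\<close>)
  have single: "P (Poly_Mapping.single m c)" for m c
    unfolding single_eq_PConst_PVar by (intro mult const prod) simp
  have "P (\<Sum>m\<in>A. Poly_Mapping.single m (f m))" if "finite A" for A f
    using that by (induction A) (use const[of 0] in \<open>auto intro: add single\<close>)
  then have "P p"
    using poly_mapping_sum_single[of p] by (metis finite_keys)
  then show ?thesis unfolding P_def \<pi>_def .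
qed

text \<open>The remainder of the projection takes only values that p takes on the plane, so it is
  zero if p vanishes there.\<close>

lemma linear_form_dvd_iff:
  assumes "n \<noteq> 0"
  shows "linear_form n dvd p \<longleftrightarrow> (\<forall>v. bdot n v = 0 \<longrightarrow> evp p v = 0)"
proof
  assume "linear_form n dvd p"
  then show "\<forall>v. bdot n v = 0 \<longrightarrow> evp p v = 0"
    by (auto elim!: dvdE)
next
  assume *: "\<forall>v. bdot n v = 0 \<longrightarrow> evp p v = 0"
  obtain k where k: "n $ k \<noteq> 0" using nonzero_component[OF assms] by blast
  obtain q r where qr: "p = linear_form n * q + r"
    "\<And>v. evp r v = evp p (v - (bdot n v / n $ k) *s axis k 1)"
    using projection_decomposition[OF k] by blast
  have "r = 0"
    by (rule evp_eq_0_imp) (use * k in \<open>auto simp: qr(2)\<close>)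
  with qr show "linear_form n dvd p" by simp
qed

definition homogeneous_quot :: "nat \<Rightarrow> nat \<Rightarrow> poly3 \<Rightarrow> bool" where
  "homogeneous_quot d e g \<longleftrightarrow> g = 0 \<or> e \<le> d \<and> homogeneous (d - e) g"

lemma homogeneous_quotI:
  assumes "homogeneous d (p * g)" "homogeneous e p" "p \<noteq> 0"
  shows "homogeneous_quot d e g"
  using homogeneous_factor[OF assms(1,2,3)] by (auto simp: homogeneous_quot_def)

lemma homogeneous_quot_mult:
  "homogeneous_quot d e g \<Longrightarrow> homogeneous e p \<Longrightarrow> homogeneous d (p * g)"
  using homogeneous_mult[of e p "d - e" g] by (auto simp: homogeneous_quot_def)

lemma two_form_division:
  assumes a: "a \<noteq> 0" and ab: "\<And>c. b \<noteq> c *s a" and hom: "homogeneous d p"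
    and van: "\<And>v. bdot a v = 0 \<Longrightarrow> bdot b v = 0 \<Longrightarrow> evp p v = 0"
  shows "\<exists>q g. p = linear_form a * q + linear_form b * g \<and>
    homogeneous_quot d 1 q \<and> homogeneous_quot d 1 g"
proof -
  obtain k where k: "a $ k \<noteq> 0" using nonzero_component[OF a] by blast
  obtain q r where qr: "p = linear_form a * q + r"
    "\<And>v. evp r v = evp p (v - (bdot a v / a $ k) *s axis k 1)"
    using projection_decomposition[OF k] by blast
  define c where "c = b $ k / a $ k"
  define b' where "b' = b - c *s a"
  have b': "b' \<noteq> 0" "b' $ k = 0"
    using ab[of c] k by (auto simp: b'_def c_def)
  have "evp r v = 0" if "bdot b' v = 0" for v
  proof -
    define u where "u = v - (bdot a v / a $ k) *s axis k 1"
    have "bdot a u = 0" using k by (simp add: u_def)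
    moreover have "bdot b' u = 0" using that b' by (simp add: u_def)
    ultimately have "bdot b u = 0" by (simp add: b'_def)
    then show ?thesis using van[of u] \<open>bdot a u = 0\<close> by (simp add: qr(2) u_def)
  qed
  then have "linear_form b' dvd r"
    using linear_form_dvd_iff[OF b'(1)] by blast
  then obtain g where g: "r = linear_form b' * g"
    by (elim dvdE)
  have "homogeneous d r"
    unfolding homogeneous_iff
  proof
    fix v
    have "2 *s v - (bdot a (2 *s v) / a $ k) *s axis k 1 = 2 *s (v - (bdot a v / a $ k) *s axis k 1)"
      by (simp add: vec_eq_iff algebra_simps)
    then show "evp r (2 *s v) = 2 ^ d * evp r v"
      unfolding qr(2) by (simp only: homogeneous_evp[OF hom])
  qed
  then have hg: "homogeneous_quot d 1 g"
    using b'(1) unfolding g by (intro homogeneous_quotI[of d "linear_form b'"]) auto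
  define q' where "q' = q - PConst c * g"
  have p: "p = linear_form a * q' + linear_form b * g"
    unfolding qr(1) g q'_def b'_def linear_form_diff by (simp add: algebra_simps)
  have "homogeneous d (linear_form b * g)"
    using hg by (rule homogeneous_quot_mult) simp
  then have "homogeneous d (linear_form a * q')"
    using homogeneous_diff[OF hom, of "linear_form b * g"] unfolding p by simp
  then have "homogeneous_quot d 1 q'"
    using a by (intro homogeneous_quotI[of d "linear_form a"]) auto
  with p hg show ?thesis by blast
qed

text \<open>One form divides the other, and the quotient has degree 0.\<close>

lemma plane_subset_imp:
  assumes "n \<noteq> 0" "m \<noteq> 0" "plane n \<subseteq> plane m"
  shows "\<exists>c. c \<noteq> 0 \<and> m = c *s n"
proof -
  have "linear_form n dvd linear_form m"
    using assms by (auto simp: linear_form_dvd_iff)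
  then obtain q where q: "linear_form m = linear_form n * q" by (elim dvdE)
  with assms have "q \<noteq> 0" by auto
  moreover have "homogeneous_quot 1 1 q"
    using assms q homogeneous_linear_form[of m]
    by (intro homogeneous_quotI[of 1 "linear_form n"]) auto
  ultimately have "q = PConst (evp q 0)"
    by (intro homogeneous_0_const) (auto simp: homogeneous_quot_def)
  then obtain c where c: "q = PConst c" by blast
  have "bdot m v = bdot (c *s n) v" for v
    using arg_cong[OF q, of "\<lambda>p. evp p v"] by (simp add: c mult_ac)
  from this[of "axis _ 1"] have "m = c *s n" by (simp add: vec_eq_iff)
  with assms show ?thesis by auto
qed

lemma plane_subset_imp_eq:
  assumes "n \<noteq> 0" "m \<noteq> 0" "plane n \<subseteq> plane m"
  shows "plane n = plane m"
  using plane_subset_imp[OF assms] by (auto simp: plane_def)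

definition cross :: "'a::comm_ring_1 ^ 3 \<Rightarrow> 'a ^ 3 \<Rightarrow> 'a ^ 3" where
  "cross x y = vector [x $ 2 * y $ 3 - x $ 3 * y $ 2, x $ 3 * y $ 1 - x $ 1 * y $ 3, x $ 1 * y $ 2 - x $ 2 * y $ 1]"

lemma cross_components:
  "cross x y $ 1 = x $ 2 * y $ 3 - x $ 3 * y $ 2"
  "cross x y $ 2 = x $ 3 * y $ 1 - x $ 1 * y $ 3"
  "cross x y $ 3 = x $ 1 * y $ 2 - x $ 2 * y $ 1"
  by (simp_all add: cross_def vector_3)

lemma bdot_3: "bdot x y = x $ 1 * y $ 1 + x $ 2 * y $ 2 + x $ 3 * y $ 3"
  by (simp only: bdot_def sum_3)

lemma vec_eq_3: "x = y \<longleftrightarrow> x $ 1 = y $ 1 \<and> x $ 2 = y $ 2 \<and> x $ 3 = y $ 3" for x y :: "'a ^ 3"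
  by (simp only: vec_eq_iff forall_3)

lemma bdot_cross [simp]: "bdot (cross x y) x = 0" "bdot (cross x y) y = 0"
  by (simp_all add: bdot_3 cross_components algebra_simps)

lemma bdot_cross' [simp]: "bdot x (cross x y) = 0" "bdot y (cross x y) = 0"
  by (simp_all add: bdot_3 cross_components algebra_simps)

lemma cross_eq_0_imp:
  assumes "cross x y = 0" "y \<noteq> 0"
  shows "\<exists>c. x = c *s (y :: complex ^ 3)"
proof -
  obtain k where k: "y $ k \<noteq> 0" using nonzero_component[OF assms(2)] by blast
  have c: "x $ 2 * y $ 3 = x $ 3 * y $ 2" "x $ 3 * y $ 1 = x $ 1 * y $ 3" "x $ 1 * y $ 2 = x $ 2 * y $ 1"
    using assms(1) by (simp_all add: vec_eq_3[of "cross x y"] cross_components)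
  have "x $ i * y $ j = x $ j * y $ i" for i j
    using c exhaust_3[of i] exhaust_3[of j] by auto
  then have "x = (x $ k / y $ k) *s y"
    using k by (simp add: vec_eq_iff field_simps)
  then show ?thesis by blast
qed

text \<open>The cross product of a basis of H is a normal. The plane it defines contains H and
  misses some axis vector, so its dimension is at most 2 and it equals H.\<close>

lemma linear_planeD:
  assumes "linear_plane H"
  shows "\<exists>n. n \<noteq> 0 \<and> H = plane n"
proof -
  have sub: "vec.subspace H" and dim: "vec.dim H = 2"
    using assms by (auto simp: linear_plane_def)
  obtain B where B: "B \<subseteq> H" "vec.independent B" "H \<subseteq> vec.span B" "card B = 2"
    using vec.basis_exists[of H] dim by metis
  obtain x y where xy: "B = {x, y}" "x \<noteq> y" using B(4) by (auto simp: card_2_iff)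
  have "y \<noteq> 0" using B(2) xy vec.dependent_zero by blast
  have n0: "cross x y \<noteq> 0"
  proof
    assume "cross x y = 0"
    then obtain c where "x = c *s y" using cross_eq_0_imp \<open>y \<noteq> 0\<close> by blast
    then have "x \<in> vec.span (B - {x})"
      using vec.span_scale[OF vec.span_base[of y "B - {x}"], of c] xy by auto
    with B(2) xy show False unfolding vec.dependent_def by blast
  qed
  have "vec.span B \<subseteq> plane (cross x y)"
    using xy by (intro vec.span_minimal subspace_plane) auto
  with B have sub2: "H \<subseteq> plane (cross x y)" by blast
  obtain k where k: "cross x y $ k \<noteq> 0" using nonzero_component[OF n0] by blast
  have "vec.span (plane (cross x y)) = plane (cross x y)"
    using subspace_plane by simp
  moreover have "axis k 1 \<notin> plane (cross x y)" using k by simp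
  ultimately have "vec.span (plane (cross x y)) \<noteq> UNIV" by blast
  then have "vec.dim (plane (cross x y)) \<noteq> 3"
    using vec.dim_eq_full[of "plane (cross x y)"]
    by (simp add: vec.dimension_def card_cart_basis)
  moreover have "vec.dim (plane (cross x y)) \<le> 3"
    using vec.dim_subset_UNIV[of "plane (cross x y)"] by (simp add: vec.dimension_def card_cart_basis)
  ultimately have "vec.dim (plane (cross x y)) \<le> vec.dim H" using dim by simp
  then have "H = plane (cross x y)"
    using vec.subspace_dim_equal[OF sub subspace_plane sub2] by simp
  with n0 show ?thesis by blast
qed

definition nrm :: "(complex ^ 3) set \<Rightarrow> complex ^ 3" where
  "nrm H = (SOME n. n \<noteq> 0 \<and> H = plane n)"

abbreviation form :: "(complex ^ 3) set \<Rightarrow> poly3" where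
  "form H \<equiv> linear_form (nrm H)"

lemma nrm:
  assumes "linear_plane H"
  shows "nrm H \<noteq> 0" "v \<in> H \<longleftrightarrow> bdot (nrm H) v = 0"
proof -
  have *: "nrm H \<noteq> 0 \<and> H = plane (nrm H)"
    unfolding nrm_def by (rule someI_ex) (rule linear_planeD[OF assms])
  then show "nrm H \<noteq> 0" by simp
  from * have "v \<in> H \<longleftrightarrow> v \<in> plane (nrm H)" by simp
  then show "v \<in> H \<longleftrightarrow> bdot (nrm H) v = 0" by simp
qed

lemma linear_plane_eq: "linear_plane H \<Longrightarrow> H = plane (nrm H)"
  using nrm(2) by auto

lemma linear_plane_subset_eq:
  "linear_plane H \<Longrightarrow> linear_plane K \<Longrightarrow> H \<subseteq> K \<Longrightarrow> H = K"
  using plane_subset_imp_eq[of "nrm H" "nrm K"] nrm(1) linear_plane_eq by metis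

lemma nrm_not_multiple:
  "linear_plane H \<Longrightarrow> linear_plane K \<Longrightarrow> H \<noteq> K \<Longrightarrow> nrm H \<noteq> c *s nrm K"
proof
  assume *: "linear_plane H" "linear_plane K" "H \<noteq> K" "nrm H = c *s nrm K"
  then have "K \<subseteq> H" by (auto simp: nrm(2))
  with * linear_plane_subset_eq show False by blast
qed

subsection \<open>Logarithmic derivations\<close>

definition evv :: "derivation \<Rightarrow> complex ^ 3 \<Rightarrow> complex ^ 3" where
  "evv \<theta> v = (\<chi> i. evp (\<theta> $ i) v)"

lemma evv_component [simp]: "evv \<theta> v $ i = evp (\<theta> $ i) v"
  by (simp add: evv_def)

lemma evv_add [simp]: "evv (\<theta> + \<eta>) v = evv \<theta> v + evv \<eta> v"
  by (simp add: vec_eq_iff)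

lemma evv_diff [simp]: "evv (\<theta> - \<eta>) v = evv \<theta> v - evv \<eta> v"
  by (simp add: vec_eq_iff)

lemma evv_smult [simp]: "evv (p *s \<theta>) v = evp p v *s evv \<theta> v"
  by (simp add: vec_eq_iff)

lemma evv_0 [simp]: "evv 0 v = 0"
  by (simp add: vec_eq_iff)

lemma evv_eqI: "(\<And>v. evv \<theta> v = evv \<eta> v) \<Longrightarrow> \<theta> = \<eta>"
  unfolding vec_eq_iff by (auto intro!: evp_eqI)

lemma evv_homogeneous: "homogeneous_deriv d \<theta> \<Longrightarrow> evv \<theta> (c *s v) = c ^ d *s evv \<theta> v"
  by (simp add: homogeneous_deriv_def vec_eq_iff homogeneous_evp)

definition Eu :: derivation where
  "Eu = (\<chi> i. PVar i)"

lemma evv_Eu [simp]: "evv Eu v = v"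
  by (simp add: Eu_def vec_eq_iff)

lemma homogeneous_Eu [simp]: "homogeneous_deriv (Suc 0) Eu"
  using homogeneous_PVar by (simp add: homogeneous_deriv_def Eu_def)

text \<open>The derivation applied to the linear form with coefficients n, see
  \<open>apply_deriv_linear_form\<close>.\<close>

definition contract :: "complex ^ 3 \<Rightarrow> derivation \<Rightarrow> poly3" where
  "contract n \<theta> = (\<Sum>i\<in>UNIV. PConst (n $ i) * \<theta> $ i)"

lemma evp_contract [simp]: "evp (contract n \<theta>) v = bdot n (evv \<theta> v)"
  by (simp add: contract_def bdot_def)

lemma homogeneous_contract: "homogeneous_deriv d \<theta> \<Longrightarrow> homogeneous d (contract n \<theta>)"
  unfolding contract_def homogeneous_deriv_def
  by (intro homogeneous_sum homogeneous_PConst_mult) auto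

lemma partial_deriv_superset:
  assumes "finite A" "Poly_Mapping.keys p \<subseteq> A"
  shows "partial_deriv i p = (\<Sum>m\<in>A. Poly_Mapping.single (m - Poly_Mapping.single i 1)
       (of_nat (Poly_Mapping.lookup m i) * Poly_Mapping.lookup p m))"
  unfolding partial_deriv_def using assms
  by (intro sum.mono_neutral_left) (auto simp: in_keys_iff)

lemma partial_deriv_add: "partial_deriv i (p + q) = partial_deriv i p + partial_deriv i q"
proof -
  let ?A = "Poly_Mapping.keys p \<union> Poly_Mapping.keys q"
  have "Poly_Mapping.keys (p + q) \<subseteq> ?A"
    by (rule keys_add)
  then show ?thesis
    by (simp add: partial_deriv_superset[of ?A] lookup_add distrib_left single_add sum.distrib)
qed

lemma partial_deriv_sum: "partial_deriv i (sum f A) = (\<Sum>x\<in>A. partial_deriv i (f x))"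
  by (induction A rule: infinite_finite_induct) (simp_all add: partial_deriv_add, simp_all add: partial_deriv_def)

lemma partial_deriv_linear_form: "partial_deriv i (linear_form c) = PConst (c $ i)"
proof -
  have single: "PConst a * PVar j = Poly_Mapping.single (Poly_Mapping.single j 1) a" for a j
    by (simp add: PConst_def PVar_def mult_single)
  have "partial_deriv i (PConst a * PVar j) = (if j = i then PConst a else 0)" for a j
    unfolding single
    by (subst partial_deriv_superset[of "{Poly_Mapping.single j 1}"])
      (auto simp: PConst_def lookup_single when_def)
  then show ?thesis
    by (simp add: linear_form_def partial_deriv_sum)
qed

lemma apply_deriv_linear_form: "apply_deriv \<theta> (linear_form c) = contract c \<theta>"
  by (simp add: apply_deriv_def contract_def partial_deriv_linear_form mult.commute)

lemma central_arrangementD: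
  "central_arrangement \<A> \<Longrightarrow> finite \<A>"
  "central_arrangement \<A> \<Longrightarrow> H \<in> \<A> \<Longrightarrow> linear_plane H"
  by (auto simp: central_arrangement_def)

lemma central_arrangement_subset:
  "central_arrangement \<A> \<Longrightarrow> \<B> \<subseteq> \<A> \<Longrightarrow> central_arrangement \<B>"
  by (auto simp: central_arrangement_def intro: finite_subset)

text \<open>Divisibility by a defining form is vanishing on H, so a logarithmic derivation is a
  vector field tangent to every plane. All later arguments use this pointwise form.\<close>

lemma log_derivations_iff:
  assumes "central_arrangement \<A>"
  shows "\<theta> \<in> log_derivations \<A> \<longleftrightarrow> (\<forall>H\<in>\<A>. \<forall>v\<in>H. bdot (nrm H) (evv \<theta> v) = 0)"
proof -
  have "(\<forall>\<alpha>. defining_form H \<alpha> \<longrightarrow> \<alpha> dvd apply_deriv \<theta> \<alpha>) \<longleftrightarrow>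
      (\<forall>v\<in>H. bdot (nrm H) (evv \<theta> v) = 0)" if "H \<in> \<A>" for H
  proof -
    have H: "linear_plane H" using assms that by (rule central_arrangementD)
    have def_form: "defining_form H \<alpha> \<longleftrightarrow> (\<exists>c. c \<noteq> 0 \<and> \<alpha> = PConst c * form H)" for \<alpha>
    proof
      assume "defining_form H \<alpha>"
      then obtain n where n: "\<alpha> = linear_form n" "H = plane n"
        by (auto simp: defining_form_def plane_def bdot_def)
      have "n \<noteq> 0"
      proof
        assume "n = 0"
        with n have "plane (nrm H) = UNIV" using linear_plane_eq[OF H] by (auto simp: plane_def)
        then have "bdot (nrm H) (axis k 1) = 0" for k by (metis UNIV_I mem_plane)
        then show False using nrm(1)[OF H] by (simp add: vec_eq_iff)
      qed
      then obtain c where "c \<noteq> 0" "n = c *s nrm H"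
        using plane_subset_imp[of "nrm H" n] n linear_plane_eq[OF H] nrm(1)[OF H] by auto
      moreover from this have "linear_form n = PConst c * form H"
        by (intro evp_eqI) simp
      ultimately show "\<exists>c. c \<noteq> 0 \<and> \<alpha> = PConst c * form H" using n by blast
    next
      assume "\<exists>c. c \<noteq> 0 \<and> \<alpha> = PConst c * form H"
      then obtain c where c: "c \<noteq> 0" "\<alpha> = PConst c * form H" by blast
      then have "\<alpha> = linear_form (c *s nrm H)"
        by (intro evp_eqI) simp
      moreover have "H = plane (c *s nrm H)"
        using nrm(2)[OF H] c(1) by (intro set_eqI) simp
      ultimately show "defining_form H \<alpha>"
        unfolding defining_form_def plane_def bdot_def by blast
    qed
    have "form H dvd contract (nrm H) \<theta> \<longleftrightarrow> (\<forall>v\<in>H. bdot (nrm H) (evv \<theta> v) = 0)"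
      by (auto simp: linear_form_dvd_iff nrm[OF H])
    moreover have "PConst c * form H dvd apply_deriv \<theta> (PConst c * form H) \<longleftrightarrow>
      form H dvd contract (nrm H) \<theta>" if "c \<noteq> 0" for c
    proof -
      have "PConst c * form H = linear_form (c *s nrm H)"
        by (intro evp_eqI) simp
      then have "apply_deriv \<theta> (PConst c * form H) = contract (c *s nrm H) \<theta>"
        by (simp add: apply_deriv_linear_form)
      also have "\<dots> = PConst c * contract (nrm H) \<theta>"
        by (intro evp_eqI) simp
      finally show ?thesis using that by simp
    qed
    ultimately show ?thesis
      unfolding def_form by (metis zero_neq_one)
  qed
  then show ?thesis by (auto simp: log_derivations_def)
qed

lemma log_derivationsD:
  assumes "central_arrangement \<A>" "\<theta> \<in> log_derivations \<A>" "H \<in> \<A>" "v \<in> H"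
  shows "bdot (nrm H) (evv \<theta> v) = 0"
  using assms log_derivations_iff by blast

lemma log_derivations_submodule:
  assumes "central_arrangement \<A>"
  shows "Der.subspace (log_derivations \<A>)"
  by (rule Der.subspaceI) (auto simp: log_derivations_iff[OF assms])

lemma Eu_log_derivations: "central_arrangement \<A> \<Longrightarrow> Eu \<in> log_derivations \<A>"
  by (auto simp: log_derivations_iff nrm(2)[OF central_arrangementD(2)])

lemma log_derivations_antimono: "\<B> \<subseteq> \<A> \<Longrightarrow> log_derivations \<A> \<subseteq> log_derivations \<B>"
  by (auto simp: log_derivations_def)

definition Qp :: "(complex ^ 3) set set \<Rightarrow> poly3" where
  "Qp \<A> = (\<Prod>H\<in>\<A>. form H)"

lemma evp_Qp: "evp (Qp \<A>) v = (\<Prod>H\<in>\<A>. bdot (nrm H) v)"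
  by (simp add: Qp_def)

lemma evp_Qp_eq_0_iff:
  "central_arrangement \<A> \<Longrightarrow> evp (Qp \<A>) v = 0 \<longleftrightarrow> (\<exists>H\<in>\<A>. v \<in> H)"
  using nrm(2)[OF central_arrangementD(2)] by (auto simp: evp_Qp central_arrangementD)

lemma homogeneous_Qp: "central_arrangement \<A> \<Longrightarrow> homogeneous (card \<A>) (Qp \<A>)"
  unfolding Qp_def by (rule homogeneous_prod_linear) (auto simp: central_arrangement_def)

text \<open>A complex subspace is not a finite union of proper subspaces. In polynomial terms, a
  product of forms none of which is zero on S is not zero on S, by
  \<open>evp_cancel_subspace\<close>.\<close>

lemma exists_off_arrangement:
  assumes "vec.subspace S" "central_arrangement \<A>" "\<And>H. H \<in> \<A> \<Longrightarrow> \<not> S \<subseteq> H"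
  shows "\<exists>w\<in>S. evp (Qp \<A>) w \<noteq> 0"
proof -
  have "finite \<A>" using assms(2) by (rule central_arrangementD)
  then show ?thesis using assms(2,3)
  proof (induction \<A>)
    case empty
    then show ?case using vec.subspace_0[OF assms(1)] by (auto simp: Qp_def)
  next
    case (insert H \<A>)
    have "central_arrangement \<A>" using insert.prems(1) by (rule central_arrangement_subset) auto
    with insert obtain w where w: "w \<in> S" "evp (Qp \<A>) w \<noteq> 0" by auto
    obtain u where u: "u \<in> S" "u \<notin> H" using insert.prems(2)[of H] by auto
    have H: "linear_plane H" using insert.prems(1) by (auto simp: central_arrangement_def)
    then have "evp (form H) u \<noteq> 0" using u by (simp add: nrm(2))
    then have "\<not> (\<forall>v\<in>S. evp (Qp \<A>) v * evp (form H) v = 0)"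
      using evp_cancel_subspace[OF assms(1) _ w u(1), of "form H"] by blast
    then show ?case using insert.hyps by (auto simp: Qp_def mult.commute)
  qed
qed

lemma Qp_neq_0: "central_arrangement \<A> \<Longrightarrow> Qp \<A> \<noteq> 0"
  by (auto simp: Qp_def central_arrangement_def nrm(1))

lemma Qp_nonzero_on_plane:
  assumes "central_arrangement \<A>" "linear_plane H" "H \<notin> \<A>"
  shows "\<exists>w\<in>H. evp (Qp \<A>) w \<noteq> 0"
proof (rule exists_off_arrangement)
  show "vec.subspace H" using assms(2) by (simp add: linear_plane_def)
  show "\<not> H \<subseteq> K" if "K \<in> \<A>" for K
    using linear_plane_subset_eq[OF assms(2)] assms that by (metis central_arrangementD(2))
qed (fact assms)

text \<open>The forms are split off one at a time: on a new plane the product of the earlier forms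
  is not identically zero, so it can be cancelled there and the cofactor vanishes on that
  plane.\<close>

lemma Qp_dvd:
  assumes "central_arrangement \<A>" "\<And>H v. H \<in> \<A> \<Longrightarrow> v \<in> H \<Longrightarrow> evp p v = 0"
  shows "Qp \<A> dvd p"
proof -
  have "finite \<A>" using assms(1) by (rule central_arrangementD)
  then show ?thesis using assms
  proof (induction \<A>)
    case (insert H \<A>)
    have c: "central_arrangement \<A>" using insert.prems(1) by (rule central_arrangement_subset) auto
    have H: "linear_plane H" using insert.prems(1) by (auto simp: central_arrangement_def)
    obtain q where q: "p = Qp \<A> * q" using insert c by (auto elim!: dvdE)
    obtain w where w: "w \<in> H" "evp (Qp \<A>) w \<noteq> 0"
      using Qp_nonzero_on_plane[OF c H insert.hyps(2)] by blast
    have "evp q v = 0" if "v \<in> H" for v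
    proof (rule evp_cancel_subspace[OF _ _ w that])
      show "vec.subspace H" using H by (simp add: linear_plane_def)
      show "evp (Qp \<A>) v * evp q v = 0" if "v \<in> H" for v
        using insert.prems(2)[of H v] that by (simp add: q)
    qed
    then have "form H dvd q"
      by (simp add: linear_form_dvd_iff nrm[OF H])
    then have "form H * Qp \<A> dvd q * Qp \<A>" by (rule mult_dvd_mono) simp
    then show ?case using insert.hyps by (simp add: Qp_def q mult.commute)
  qed (simp add: Qp_def)
qed

subsection \<open>Saito's criterion\<close>

definition det3 :: "'a::comm_ring_1 ^ 3 \<Rightarrow> 'a ^ 3 \<Rightarrow> 'a ^ 3 \<Rightarrow> 'a" where
  "det3 a b c = a $ 1 * (b $ 2 * c $ 3 - b $ 3 * c $ 2) - a $ 2 * (b $ 1 * c $ 3 - b $ 3 * c $ 1)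
    + a $ 3 * (b $ 1 * c $ 2 - b $ 2 * c $ 1)"

lemma evp_det3: "evp (det3 a b c) v = det3 (evv a v) (evv b v) (evv c v)"
  by (simp add: det3_def)

lemma det3_combination:
  "det3 (x *s a + y *s b + z *s c) b c = x * det3 a b c"
  "det3 a (x *s a + y *s b + z *s c) c = y * det3 a b c"
  "det3 a b (x *s a + y *s b + z *s c) = z * det3 a b c"
  unfolding det3_def by (simp_all add: algebra_simps)

lemma det3_cramer:
  fixes a b c t :: "'a::comm_ring_1 ^ 3"
  shows "det3 a b c *s t = det3 t b c *s a + det3 a t c *s b + det3 a b t *s c"
  unfolding det3_def vec_eq_3 vector_add_component vector_smult_component
  by (simp add: algebra_simps)

lemma det3_eq:
  fixes a b c :: "'a::comm_ring_1 ^ 3"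
  shows "det3 a a c = 0" "det3 a b a = 0" "det3 a b b = 0"
  unfolding det3_def by (simp_all add: algebra_simps)

lemma det3_swap: "det3 a c b = - det3 a b (c :: 'a::comm_ring_1 ^ 3)"
  unfolding det3_def by (simp add: algebra_simps)

lemma det3_plane:
  assumes "n \<noteq> 0" "bdot n a = 0" "bdot n b = 0" "bdot n c = 0"
  shows "det3 a b c = 0"
proof -
  have "n $ 1 * det3 a b c = 0" "n $ 2 * det3 a b c = 0" "n $ 3 * det3 a b c = 0"
    using assms(2-4) unfolding det3_def bdot_3 by algebra+
  then show ?thesis using assms(1) by (auto simp: vec_eq_3)
qed

lemma homogeneous_det3:
  assumes "homogeneous_deriv d1 a" "homogeneous_deriv d2 b" "homogeneous_deriv d3 c"
  shows "homogeneous (d1 + d2 + d3) (det3 a b c)"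
proof -
  have *: "homogeneous (d1 + d2 + d3) (a $ i * (b $ j * c $ k - b $ l * c $ m))" for i j k l m
    unfolding add.assoc
    by (intro homogeneous_mult homogeneous_diff) (use assms in \<open>auto simp: homogeneous_deriv_def\<close>)
  show ?thesis unfolding det3_def
    by (intro homogeneous_add homogeneous_diff *)
qed

text \<open>At a point of H all three vectors lie in H and are therefore dependent.\<close>

lemma Qp_dvd_det3:
  assumes "central_arrangement \<A>" "a \<in> log_derivations \<A>" "b \<in> log_derivations \<A>" "c \<in> log_derivations \<A>"
  shows "Qp \<A> dvd det3 a b c"
proof (rule Qp_dvd[OF assms(1)])
  fix H v assume H: "H \<in> \<A>" "v \<in> H"
  then have "nrm H \<noteq> 0" using assms(1) nrm(1) central_arrangementD(2) by blast
  with H assms show "evp (det3 a b c) v = 0"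
    unfolding evp_det3 by (intro det3_plane[of "nrm H"]) (auto intro: log_derivationsD)
qed

text \<open>By Cramer's rule \<open>det3 a b c *s t\<close> is a combination whose coefficients are
  again determinants of logarithmic derivations, hence divisible by \<open>Qp \<A>\<close>;
  cancelling it leaves polynomial coefficients for t.\<close>

lemma saito_criterion:
  assumes cen: "central_arrangement \<A>"
    and a: "a \<in> log_derivations \<A>" and b: "b \<in> log_derivations \<A>" and c: "c \<in> log_derivations \<A>"
    and det: "det3 a b c = PConst k * Qp \<A>" and k: "k \<noteq> 0"
  shows "distinct [a, b, c]" "Der.independent {a, b, c}" "Der.span {a, b, c} = log_derivations \<A>"
proof -
  have nz: "det3 a b c \<noteq> 0" using det k Qp_neq_0[OF cen] by simp
  then show dist: "distinct [a, b, c]" using det3_eq[of a] det3_eq(3)[of a c] by auto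
  have sum3: "(\<Sum>v\<in>{a, b, c}. u v *s v) = u a *s a + u b *s b + u c *s c" for u
    using dist by (simp add: add.assoc)
  show "Der.independent {a, b, c}"
  proof
    assume "Der.dependent {a, b, c}"
    then obtain u where u: "\<exists>v\<in>{a, b, c}. u v \<noteq> 0" "(\<Sum>v\<in>{a, b, c}. u v *s v) = 0"
      unfolding Der.dependent_finite[of "{a, b, c}", simplified] by auto
    from u(2) have "u a *s a + u b *s b + u c *s c = 0" by (simp only: sum3)
    then have "u a * det3 a b c = det3 0 b c" "u b * det3 a b c = det3 a 0 c" "u c * det3 a b c = det3 a b 0"
      using det3_combination(1)[of "u a" a "u b" b "u c" c] det3_combination(2)[of a "u a" "u b" b "u c" c]
        det3_combination(3)[of a b "u a" "u b" "u c" c] by simp_all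
    then have "u a * det3 a b c = 0" "u b * det3 a b c = 0" "u c * det3 a b c = 0"
      by (simp_all add: det3_def)
    with nz u(1) show False by auto
  qed
  show "Der.span {a, b, c} = log_derivations \<A>"
  proof
    show "Der.span {a, b, c} \<subseteq> log_derivations \<A>"
      using a b c by (intro Der.span_minimal log_derivations_submodule cen) auto
    show "log_derivations \<A> \<subseteq> Der.span {a, b, c}"
    proof
      fix t assume t: "t \<in> log_derivations \<A>"
      obtain x where x: "det3 t b c = Qp \<A> * x" using Qp_dvd_det3[OF cen t b c] by (elim dvdE)
      obtain y where y: "det3 a t c = Qp \<A> * y" using Qp_dvd_det3[OF cen a t c] by (elim dvdE)
      obtain z where z: "det3 a b t = Qp \<A> * z" using Qp_dvd_det3[OF cen a b t] by (elim dvdE)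
      have "Qp \<A> * (PConst k * t $ i) = Qp \<A> * (x * a $ i + y * b $ i + z * c $ i)" for i
        using arg_cong[OF det3_cramer[of a b c t], of "\<lambda>v. v $ i"]
        by (simp add: det x y z algebra_simps)
      then have "PConst k * t $ i = x * a $ i + y * b $ i + z * c $ i" for i
        using poly3_cancel Qp_neq_0[OF cen] by blast
      then have "PConst k *s t = x *s a + y *s b + z *s c"
        by (simp add: vec_eq_iff)
      moreover have "t = PConst (1 / k) *s (PConst k *s t)"
        using k by (intro evv_eqI) simp
      ultimately have "t = PConst (1 / k) *s (x *s a + y *s b + z *s c)"
        by simp
      then show "t \<in> Der.span {a, b, c}"
        by (auto intro!: Der.span_scale Der.span_add intro: Der.span_base)
    qed
  qed
qed

subsection \<open>Restriction to a plane\<close>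

lemma cross_eq_0_component:
  assumes "cross x y = 0"
  shows "x $ i * y $ j = x $ j * y $ (i :: 3)"
proof -
  have "x $ 2 * y $ 3 = x $ 3 * y $ 2" "x $ 3 * y $ 1 = x $ 1 * y $ 3" "x $ 1 * y $ 2 = x $ 2 * y $ 1"
    using assms by (simp_all add: vec_eq_3[of "cross x y"] cross_components)
  then show ?thesis
    using exhaust_3[of i] exhaust_3[of j] by auto
qed

lemma cross_parallel_normal:
  assumes "n \<noteq> 0" "bdot n x = 0" "bdot n y = 0"
  shows "\<exists>c. cross x y = c *s n"
proof (rule cross_eq_0_imp)
  have "cross (cross x y) n = bdot n x *s y - bdot n y *s x"
    unfolding vec_eq_3 cross_components bdot_3 vector_minus_component vector_smult_component
    by (simp add: algebra_simps)
  then show "cross (cross x y) n = 0" using assms by simp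
qed (fact assms)

text \<open>If u and v were independent, both normals would be multiples of their cross product,
  hence of each other.\<close>

lemma two_planes_line:
  assumes "a \<noteq> 0" "\<And>c. b \<noteq> c *s a" "v \<noteq> 0"
    and "bdot a v = 0" "bdot b v = 0" "bdot a u = 0" "bdot b u = 0"
  shows "\<exists>t. u = t *s v"
proof (rule cross_eq_0_imp)
  show "cross u v = 0"
  proof (rule ccontr)
    assume ne: "cross u v \<noteq> 0"
    have *: "\<exists>c. x = c *s cross u v" if "bdot x u = 0" "bdot x v = 0" for x
    proof (rule cross_eq_0_imp[OF _ ne])
      have "cross x (cross u v) = bdot x v *s u - bdot x u *s v"
        unfolding vec_eq_3 cross_components bdot_3 vector_minus_component vector_smult_component
        by (simp add: algebra_simps)
      with that show "cross x (cross u v) = 0" by simp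
    qed
    obtain c where c: "a = c *s cross u v" using *[of a] assms by blast
    obtain d where d: "b = d *s cross u v" using *[of b] assms by blast
    have "c \<noteq> 0" using c assms(1) by auto
    then have "b = (d / c) *s a" by (simp add: c d vec_eq_iff)
    with assms(2) show False by blast
  qed
qed (fact assms)

text \<open>The form of m vanishes on the line where a and b do, so it lies in the ideal they
  generate; by degree the coefficients are constants.\<close>

lemma normal_combination:
  assumes "a \<noteq> 0" "\<And>c. b \<noteq> c *s a" "v \<noteq> 0"
    and "bdot a v = 0" "bdot b v = 0" "bdot m v = 0"
  shows "\<exists>s e. m = s *s b + e *s a"
proof -
  have "evp (linear_form m) u = 0" if u: "bdot a u = 0" "bdot b u = 0" for u
  proof -
    obtain t where "u = t *s v"
      using two_planes_line[OF assms(1,2,3,4,5) u] by blast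
    then show ?thesis using assms(6) by simp
  qed
  then obtain q g where *: "linear_form m = linear_form a * q + linear_form b * g"
    "homogeneous_quot (Suc 0) 1 q" "homogeneous_quot (Suc 0) 1 g"
    using two_form_division[OF assms(1,2) homogeneous_linear_form[of m]] by blast
  have const: "x = PConst (evp x 0)" if "homogeneous_quot (Suc 0) 1 x" for x
    using that by (intro homogeneous_0_const) (auto simp: homogeneous_quot_def)
  have "bdot m u = bdot (evp g 0 *s b + evp q 0 *s a) u" for u
    using arg_cong[OF *(1), of "\<lambda>p. evp p u"] arg_cong[OF const[OF *(2)], of "\<lambda>p. evp p u"]
      arg_cong[OF const[OF *(3)], of "\<lambda>p. evp p u"]
    by (simp add: mult_ac)
  from this[of "axis _ 1"] have "m = evp g 0 *s b + evp q 0 *s a" by (simp add: vec_eq_iff)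
  then show ?thesis by blast
qed

lemma linear_plane_subspace: "linear_plane H \<Longrightarrow> vec.subspace H"
  by (simp add: linear_plane_def)

lemma plane_inter_line:
  assumes "linear_plane H" "linear_plane K" "H \<noteq> K" "v \<in> H" "v \<in> K" "v \<noteq> 0"
  shows "H \<inter> K = range (\<lambda>t. t *s v)"
proof
  show "H \<inter> K \<subseteq> range (\<lambda>t. t *s v)"
    using two_planes_line[OF nrm(1)[OF assms(1)] nrm_not_multiple[OF assms(2,1) assms(3)[symmetric]] assms(6)]
      assms(4,5) unfolding subset_iff Int_iff image_iff nrm(2)[OF assms(1)] nrm(2)[OF assms(2)] by blast
  show "range (\<lambda>t. t *s v) \<subseteq> H \<inter> K"
    using assms by (auto intro: vec.subspace_scale linear_plane_subspace)
qed

lemma plane_inter_eqI: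
  assumes "linear_plane H" "linear_plane K" "linear_plane L" "H \<noteq> K" "H \<noteq> L"
    and "v \<in> H" "v \<in> K" "v \<in> L" "v \<noteq> 0"
  shows "H \<inter> K = H \<inter> L"
  using plane_inter_line[of H K v] plane_inter_line[of H L v] assms by simp

lemma plane_inter_nonzero:
  assumes "linear_plane H" "linear_plane K" "H \<noteq> K"
  shows "\<exists>v. v \<noteq> 0 \<and> v \<in> H \<and> v \<in> K"
proof (intro exI conjI)
  show "cross (nrm H) (nrm K) \<noteq> 0"
    using cross_eq_0_imp[of "nrm H" "nrm K"] nrm(1)[OF assms(2)] nrm_not_multiple[OF assms] by blast
qed (use assms in \<open>auto simp: nrm(2)\<close>)

text \<open>On H the planes of F cut out pairwise distinct lines, and a form that vanishes on
  distinct lines of H is divisible there by the product of their equations. The degree left for g,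
  unless g is zero, is what bounds the number of lines.\<close>

lemma division_by_lines:
  assumes H: "linear_plane H" and F: "central_arrangement F" "H \<notin> F" "inj_on (\<lambda>K. H \<inter> K) F"
    and hom: "homogeneous d p" and van: "\<And>K v. K \<in> F \<Longrightarrow> v \<in> H \<Longrightarrow> v \<in> K \<Longrightarrow> evp p v = 0"
  shows "\<exists>q g. p = form H * q + Qp F * g \<and> homogeneous_quot d (card F) g"
proof -
  have "finite F" using F(1) by (rule central_arrangementD)
  then show ?thesis using F van
  proof (induction F)
    case empty
    show ?case by (intro exI[of _ 0] exI[of _ p]) (simp add: Qp_def homogeneous_quot_def hom)
  next
    case (insert K F)
    have F: "central_arrangement F" "H \<notin> F"
      using insert.prems by (auto intro: central_arrangement_subset)
    obtain q g where *: "p = form H * q + Qp F * g" "homogeneous_quot d (card F) g"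
      using insert.IH[OF F] insert.prems by (auto simp: inj_on_insert)
    have K: "linear_plane K" "K \<noteq> H" using insert.prems by (auto simp: central_arrangement_def)
    have split: "Qp (insert K F) = form K * Qp F" using insert.hyps by (simp add: Qp_def)
    show ?case
    proof (cases "g = 0")
      case True
      then show ?thesis using *
        by (intro exI[of _ q] exI[of _ 0]) (simp add: homogeneous_quot_def)
    next
      case False
      then have le: "card F \<le> d" and hg: "homogeneous (d - card F) g"
        using * by (auto simp: homogeneous_quot_def)
      have van1: "evp g v = 0" if v: "v \<in> H" "v \<in> K" "v \<noteq> 0" for v
      proof -
        have "evp p v = 0" using insert.prems(4)[of K v] v by simp
        then have "evp (Qp F) v * evp g v = 0" using v nrm(2)[OF H, of v] by (simp add: *(1))
        moreover have "evp (Qp F) v \<noteq> 0"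
        proof
          assume "evp (Qp F) v = 0"
          then obtain L where L: "L \<in> F" "v \<in> L" using evp_Qp_eq_0_iff[OF F(1)] by blast
          then have "H \<inter> K = H \<inter> L"
            using v K F H by (intro plane_inter_eqI[of _ _ _ v]) (auto dest: central_arrangementD)
          then have "K = L" using insert.prems(3) L by (auto dest: inj_onD)
          with L insert.hyps show False by simp
        qed
        ultimately show ?thesis by simp
      qed
      obtain v where v: "v \<noteq> 0" "v \<in> H" "v \<in> K" using plane_inter_nonzero H K by blast
      \<comment> \<open>The origin lies in every plane, so it escapes the argument above;
        homogeneity transfers the zero at v to it, also when g is constant.\<close>
      have "evp g 0 = 0" using homogeneous_evp[OF hg, of 0 v] van1 v by simp
      with van1 have van2: "evp g v = 0" if "bdot (nrm H) v = 0" "bdot (nrm K) v = 0" for v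
        using that nrm(2)[OF H] nrm(2)[OF K(1)] by (cases "v = 0") auto
      obtain q' g' where **: "g = form H * q' + form K * g'" "homogeneous_quot (d - card F) 1 g'"
        using two_form_division[OF nrm(1)[OF H] nrm_not_multiple[OF K(1) H K(2)] hg van2] by blast
      have "p = form H * (q + Qp F * q') + Qp (insert K F) * g'"
        unfolding *(1) **(1) split by (simp add: algebra_simps)
      moreover have "homogeneous_quot d (card (insert K F)) g'"
        using **(2) le insert.hyps by (auto simp: homogeneous_quot_def)
      ultimately show ?thesis by blast
    qed
  qed
qed

text \<open>On H the field is g(v) v for some factor g. To see that g is a polynomial, a coordinate
  x_i independent of the form of H is used: the i-th component vanishes on H where x_i does, hence
  is g x_i modulo the form, and cancelling x_i on H gives the same g for the other
  components.\<close>

lemma parallel_to_Eu: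
  assumes H: "linear_plane H" and hom: "homogeneous_deriv a \<phi>"
    and par: "\<And>v. v \<in> H \<Longrightarrow> cross v (evv \<phi> v) = 0"
  obtains g \<eta> where "\<phi> = g *s Eu + form H *s \<eta>" "homogeneous (a - 1) g" "homogeneous_deriv (a - 1) \<eta>"
    "a \<ge> 1 \<or> \<phi> = 0"
proof -
  define n where "n = nrm H"
  have n: "n \<noteq> 0" "\<And>v. v \<in> H \<longleftrightarrow> bdot n v = 0" using nrm[OF H] by (auto simp: n_def)
  obtain k where k: "n $ k \<noteq> 0" using nonzero_component n(1) by blast
  \<comment> \<open>The normal is nonzero at k, so a coordinate other than k is not proportional to
    the form of H.\<close>
  define i :: 3 where "i = (if k = 1 then 2 else 1)"
  have i: "i \<noteq> k" by (auto simp: i_def)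
  define e :: "complex ^ 3" where "e = axis i 1"
  have e: "bdot e v = v $ i" for v
    by (simp add: e_def bdot_def axis_def if_distrib if_distribR cong: if_cong)
  have ne: "e \<noteq> c *s n" for c
  proof
    assume eq: "e = c *s n"
    from arg_cong[OF eq, of "\<lambda>x. x $ k"] have "c = 0" using k i by (simp add: e_def axis_def)
    with arg_cong[OF eq, of "\<lambda>x. x $ i"] show False by (simp add: e_def)
  qed
  have hom': "homogeneous a (\<phi> $ l)" for l using hom by (simp add: homogeneous_deriv_def)
  have par': "v $ l * evp (\<phi> $ m) v = v $ m * evp (\<phi> $ l) v" if "bdot n v = 0" for v l m
    using cross_eq_0_component[OF par[of v], of l m] that n(2) by simp
  have "\<not> plane n \<subseteq> plane e"
    using plane_subset_imp[of n e] n(1) ne by (auto simp: e_def axis_eq_0_iff)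
  then obtain u where u: "bdot n u = 0" "u $ i \<noteq> 0"
    by (metis e mem_plane subsetI)
  have nz: "evp (\<phi> $ i) v = 0" if v: "bdot n v = 0" "v $ i = 0" "v \<noteq> 0" for v
  proof -
    obtain l where "v $ l \<noteq> 0" using nonzero_component v(3) by blast
    then show ?thesis using par'[OF v(1), of l i] v(2) by simp
  qed
  have "evp (\<phi> $ i) v = 0" if v: "bdot n v = 0" "v $ i = 0" for v
  proof (cases "v = 0")
    case True
    define w where "w = cross e n"
    have "w \<noteq> 0"
      using cross_eq_0_imp[of e n] ne n(1) unfolding w_def by blast
    moreover have "bdot n w = 0" "w $ i = 0" using e[of w] by (simp_all add: w_def)
    ultimately have "evp (\<phi> $ i) w = 0" by (intro nz)
    then show ?thesis using homogeneous_evp[OF hom'[of i], of 0 w] True by simp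
  qed (use nz v in auto)
  then obtain q g where qg: "\<phi> $ i = linear_form n * q + linear_form e * g" "homogeneous_quot a 1 g"
    using two_form_division[OF n(1) ne hom'[of i]] by (metis e)
  have hxg: "homogeneous a (PVar l * g)" for l
    using qg(2) by (rule homogeneous_quot_mult) (rule homogeneous_PVar)
  have "linear_form n dvd \<phi> $ l - PVar l * g" for l
  proof -
    have "evp (\<phi> $ l - PVar l * g) v = 0" if v: "v \<in> plane n" for v
    proof (rule evp_cancel_subspace[OF subspace_plane[of n] _ _ _ v, of "PVar i" _ u])
      show "evp (PVar i) v * evp (\<phi> $ l - PVar l * g) v = 0" if "v \<in> plane n" for v
        using par'[of v i l] that qg(1) by (simp add: e algebra_simps)
    qed (use u in auto)
    then show ?thesis using n(1) by (simp add: linear_form_dvd_iff)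
  qed
  then obtain h where h: "\<And>l. \<phi> $ l - PVar l * g = linear_form n * h l"
    unfolding dvd_def by metis
  have hh: "homogeneous_quot a 1 (h l)" for l
    using homogeneous_diff[OF hom'[of l] hxg[of l]] n(1) unfolding h
    by (intro homogeneous_quotI[of a "linear_form n"]) auto
  have hq: "homogeneous (a - 1) x" "a \<ge> 1 \<or> x = 0" if "homogeneous_quot a 1 x" for x
    using that by (auto simp: homogeneous_quot_def)
  define \<eta> :: derivation where "\<eta> = (\<chi> l. h l)"
  have eq: "\<phi> = g *s Eu + form H *s \<eta>"
    using h by (simp add: vec_eq_iff \<eta>_def Eu_def n_def algebra_simps)
  show thesis
  proof (rule that[OF eq])
    show "homogeneous (a - 1) g" using hq qg by blast
    show "homogeneous_deriv (a - 1) \<eta>" using hq hh by (simp add: homogeneous_deriv_def \<eta>_def)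
    show "a \<ge> 1 \<or> \<phi> = 0"
      using eq hq(2)[OF qg(2)] hq(2)[OF hh] by (auto simp: vec_eq_iff \<eta>_def)
  qed
qed

subsection \<open>Deletion of a plane\<close>

text \<open>The restriction to H as a set of lines; its cardinality is n_H.\<close>

definition restr :: "(complex ^ 3) set set \<Rightarrow> (complex ^ 3) set \<Rightarrow> (complex ^ 3) set set" where
  "restr \<A> H = (\<lambda>K. H \<inter> K) ` (\<A> - {H})"

lemma plane_not_subset_line: "linear_plane H \<Longrightarrow> \<exists>u\<in>H. \<forall>c. u \<noteq> c *s w"
proof (rule ccontr)
  assume H: "linear_plane H" and "\<not> (\<exists>u\<in>H. \<forall>c. u \<noteq> c *s w)"
  then have "H \<subseteq> vec.span {w}" by (auto simp: vec.span_singleton)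
  then have "vec.dim H \<le> card {w}" by (rule vec.dim_le_card) simp
  then show False using H by (simp add: linear_plane_def)
qed

text \<open>The line u + t w is an affine chart of the projective line of H. Choosing w off all
  planes of the arrangement leaves no intersection line at infinity, so each plane meets the chart
  at exactly one t.\<close>

lemma plane_line_parameters:
  assumes "central_arrangement \<A>" "linear_plane H" "H \<notin> \<A>"
  obtains u w where "u \<in> H" "w \<in> H" "w \<noteq> 0" "\<And>c. u \<noteq> c *s w" "\<And>K. K \<in> \<A> \<Longrightarrow> w \<notin> K"
proof -
  have "\<exists>w\<in>H. w \<noteq> 0 \<and> (\<forall>K\<in>\<A>. w \<notin> K)"
  proof (cases "\<A> = {}")
    case True
    obtain w where "w \<in> H" "\<forall>c. w \<noteq> c *s (0 :: complex ^ 3)"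
      using plane_not_subset_line[OF assms(2)] by blast
    then have "w \<in> H" "w \<noteq> 0" by auto
    then show ?thesis using True by auto
  next
    case False
    obtain w where w: "w \<in> H" "\<forall>K\<in>\<A>. w \<notin> K"
      using Qp_nonzero_on_plane[OF assms] evp_Qp_eq_0_iff[OF assms(1)] by blast
    moreover have "w \<noteq> 0"
      using False w assms(1) vec.subspace_0 linear_plane_subspace central_arrangementD(2) by blast
    ultimately show ?thesis by blast
  qed
  then obtain w where w: "w \<in> H" "w \<noteq> 0" "\<forall>K\<in>\<A>. w \<notin> K" by blast
  moreover obtain u where "u \<in> H" "\<forall>c. u \<noteq> c *s w" using plane_not_subset_line[OF assms(2)] by blast
  ultimately show thesis using that by blast
qed

lemma plane_span:
  assumes "linear_plane H" "u \<in> H" "w \<in> H" "w \<noteq> 0" "\<And>c. u \<noteq> c *s w" "v \<in> H"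
  shows "\<exists>a b. v = a *s u + b *s w"
proof -
  have ind: "vec.independent {u, w}"
    using assms(4,5) by (simp add: vec.independent_insert vec.span_singleton) blast
  have "u \<noteq> w" using assms(5)[of 1] by auto
  then have "H \<subseteq> vec.span {u, w}"
    using assms ind by (intro vec.card_ge_dim_independent) (auto simp: linear_plane_def)
  with assms(6) have "v \<in> vec.span {u, w}" by blast
  then obtain a where "v - a *s u \<in> vec.span {w}"
    using vec.span_breakdown_eq[of v u "{w}"] by blast
  then obtain b where "v - a *s u = b *s w" by (auto simp: vec.span_singleton)
  then have "v = a *s u + b *s w" by (simp add: algebra_simps)
  then show ?thesis by blast
qed

text \<open>By homogeneity p vanishes at a u + b w for all nonzero a. The missing case a = 0 follows
  because a univariate polynomial with infinitely many zeros is zero.\<close>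

lemma line_poly_eq_0_imp:
  assumes "linear_plane H" "u \<in> H" "w \<in> H" "w \<noteq> 0" "\<And>c. u \<noteq> c *s w"
    and hom: "homogeneous d p" and 0: "line_poly p u w = 0" and "v \<in> H"
  shows "evp p v = 0"
proof -
  have on: "evp p (u + t *s w) = 0" for t
    using arg_cong[OF 0, of "\<lambda>q. poly q t"] by simp
  have ne: "evp p (a *s u + b *s w) = 0" if "a \<noteq> 0" for a b
  proof -
    have "a *s u + b *s w = a *s (u + (b / a) *s w)"
      using that by (simp add: vec_eq_iff field_simps)
    then show ?thesis by (simp only: homogeneous_evp[OF hom] on mult_zero_right)
  qed
  obtain a b where v: "v = a *s u + b *s w" using plane_span assms by metis
  have "poly (line_poly p (b *s w) u) s = 0" if "s \<in> - {0}" for s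
    using ne[of s b] that by (simp add: add.commute)
  moreover have "infinite (- {0 :: complex})"
    by (simp add: infinite_UNIV_char_0 Compl_eq_Diff_UNIV)
  ultimately have "infinite {s. poly (line_poly p (b *s w) u) s = 0}"
    by (metis (mono_tags, lifting) finite_subset mem_Collect_eq subsetI)
  then have "line_poly p (b *s w) u = 0"
    using poly_roots_finite by blast
  then have "poly (line_poly p (b *s w) u) 0 = 0" by simp
  then show ?thesis using ne[of a b] v by (cases "a = 0") auto
qed

text \<open>If \<open>\<alpha>\<^sub>1\<close> is the form of one plane of \<open>R\<close> and \<open>\<theta>(\<alpha>\<^sub>1) = f \<alpha>\<^sub>1\<close>, then
  \<open>\<theta>(\<alpha>\<^sub>H) - f \<alpha>\<^sub>H\<close> vanishes on all the other planes of \<open>R\<close>.\<close>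

lemma log_derivation_order:
  assumes cen: "central_arrangement \<A>" and H: "linear_plane H" "H \<notin> \<A>"
    and \<theta>: "\<theta> \<in> log_derivations \<A>"
    and uw: "u \<in> H" "w \<in> H" "\<And>c. u \<noteq> c *s w"
    and R: "R \<subseteq> \<A>" "\<And>K. K \<in> R \<Longrightarrow> u + t0 *s w \<in> K"
  shows "[:- t0, 1:] ^ (card R - 1) dvd line_poly (contract (nrm H) \<theta>) u w"
proof (cases "R = {}")
  case False
  then obtain K1 where K1: "K1 \<in> R" by blast
  define p where "p = u + t0 *s w"
  have pH: "p \<in> H" unfolding p_def
    using uw H linear_plane_subspace vec.subspace_add vec.subspace_scale by metis
  have p0: "p \<noteq> 0"
  proof
    assume "p = 0"
    then have "u = (- t0) *s w" by (simp add: p_def add_eq_0_iff2 vec_eq_iff)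
    with uw show False by blast
  qed
  have pl: "linear_plane K" if "K \<in> R" for K using R that cen central_arrangementD by blast
  have "form K1 dvd contract (nrm K1) \<theta>"
    using log_derivationsD[OF cen \<theta>, of K1] K1 R pl[OF K1] nrm[OF pl[OF K1]]
    by (auto simp: linear_form_dvd_iff)
  then obtain f where f: "contract (nrm K1) \<theta> = form K1 * f" by (elim dvdE)
  define P where "P = contract (nrm H) \<theta> - form H * f"
  have cenR: "central_arrangement (R - {K1})" using cen R by (auto intro: central_arrangement_subset)
  have "evp P v = 0" if K: "K \<in> R - {K1}" and v: "v \<in> K" for K v
  proof -
    have ne: "H \<noteq> K1" "K \<noteq> K1" "H \<noteq> K" using H K K1 R by auto
    have K': "linear_plane K" using pl K by blast
    \<comment> \<open>H, K1 and K share the point p, so their normals are dependent; e is nonzero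
      because K and K1 differ. On K this lets the tangency conditions of K and K1 determine the
      derivative of the form of H.\<close>
    obtain s e where se: "nrm K = s *s nrm K1 + e *s nrm H"
      using normal_combination[OF nrm(1)[OF H(1)] nrm_not_multiple[OF pl[OF K1] H(1) ne(1)[symmetric]] p0, of "nrm K"]
        pH R(2)[OF K1] R(2)[of K] K nrm(2)[OF H(1), of p] nrm(2)[OF pl[OF K1], of p] nrm(2)[OF K', of p]
      by (auto simp: p_def)
    have e: "e \<noteq> 0"
      using nrm_not_multiple[OF K' pl[OF K1] ne(2), of s] se by auto
    have "bdot (nrm K) (evv \<theta> v) = 0" using log_derivationsD[OF cen \<theta> _ v] K R by blast
    moreover have "bdot (nrm K1) (evv \<theta> v) = bdot (nrm K1) v * evp f v"
      using arg_cong[OF f, of "\<lambda>q. evp q v"] by simp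
    moreover have "s * bdot (nrm K1) v + e * bdot (nrm H) v = 0"
      using nrm(2)[OF K', of v] v by (simp add: se)
    ultimately have "s * (bdot (nrm K1) v * evp f v) + e * bdot (nrm H) (evv \<theta> v) = 0"
      "(s * bdot (nrm K1) v + e * bdot (nrm H) v) * evp f v = 0"
      by (simp_all add: se)
    then have "e * (bdot (nrm H) (evv \<theta> v) - bdot (nrm H) v * evp f v) = 0"
      by algebra
    then show ?thesis using e by (simp add: P_def)
  qed
  then have "Qp (R - {K1}) dvd P" by (rule Qp_dvd[OF cenR])
  then obtain G where G: "P = Qp (R - {K1}) * G" by (elim dvdE)
  define c where "c = (\<Prod>K\<in>R - {K1}. bdot (nrm K) w)"
  have "line_poly (contract (nrm H) \<theta>) u w = [:- t0, 1:] ^ (card R - 1) * smult c (line_poly G u w)"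
  proof (rule poly_eq_poly_eq_iff[THEN iffD1], rule ext)
    fix t
    have uwH: "bdot (nrm H) (u + t *s w) = 0"
      using uw nrm(2)[OF H(1)] by simp
    have lin: "bdot (nrm K) (u + t *s w) = (t - t0) * bdot (nrm K) w" if "K \<in> R" for K
    proof -
      have "bdot (nrm K) u + t0 * bdot (nrm K) w = 0"
        using R(2)[OF that] nrm(2)[OF pl[OF that]] by simp
      then show ?thesis by (simp add: algebra_simps eq_neg_iff_add_eq_0)
    qed
    have "evp (Qp (R - {K1})) (u + t *s w) = (\<Prod>K\<in>R - {K1}. (t - t0) * bdot (nrm K) w)"
      unfolding evp_Qp by (intro prod.cong refl lin) auto
    also have "\<dots> = (t - t0) ^ (card R - 1) * c"
      using K1 by (simp add: prod.distrib c_def)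
    finally have "evp P (u + t *s w) = (t - t0) ^ (card R - 1) * c * evp G (u + t *s w)"
      by (simp add: G)
    then show "poly (line_poly (contract (nrm H) \<theta>) u w) t =
        poly ([:- t0, 1:] ^ (card R - 1) * smult c (line_poly G u w)) t"
      using uwH by (simp add: P_def poly_power)
  qed
  then show ?thesis by (metis dvd_triv_left)
qed simp

lemma card_image_kernel_eq:
  assumes "\<And>x y. x \<in> A \<Longrightarrow> y \<in> A \<Longrightarrow> f x = f y \<longleftrightarrow> g x = g y"
  shows "card (f ` A) = card (g ` A)"
proof -
  have "bij_betw (\<lambda>z. g (inv_into A f z)) (f ` A) (g ` A)"
  proof (rule bij_betwI')
    fix z z' assume z: "z \<in> f ` A" "z' \<in> f ` A"
    then show "(g (inv_into A f z) = g (inv_into A f z')) = (z = z')"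
      using assms by (metis f_inv_into_f inv_into_into)
  next
    fix z assume "z \<in> f ` A"
    then show "g (inv_into A f z) \<in> g ` A" by (metis imageI inv_into_into)
  next
    fix z assume "z \<in> g ` A"
    then obtain x where "x \<in> A" "z = g x" by blast
    then show "\<exists>y\<in>f ` A. z = g (inv_into A f y)"
      using assms by (metis f_inv_into_f imageI inv_into_into)
  qed
  then show ?thesis by (rule bij_betw_same_card)
qed

lemma sum_order_le_degree:
  assumes "p \<noteq> 0" "finite X"
  shows "(\<Sum>t\<in>X. order t p) \<le> degree (p :: complex poly)"
proof -
  have fin: "finite {t. poly p t = 0}" using assms(1) by (rule poly_roots_finite)
  have "(\<Sum>t\<in>X. order t p) = (\<Sum>t\<in>X \<inter> {t. poly p t = 0}. order t p)"
    using assms by (intro sum.mono_neutral_right) (auto simp: order_root)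
  also have "\<dots> \<le> (\<Sum>t\<in>{t. poly p t = 0}. order t p)"
    using fin by (intro sum_mono2) auto
  also have "\<dots> = size (proots p)"
    using assms(1) by (simp add: size_multiset_overloaded_eq)
  also have "\<dots> \<le> degree p" by (rule size_proots_le)
  finally show ?thesis .
qed

text \<open>On the chart of H the derivative of \<open>form H\<close> is a nonzero polynomial of
  degree at most e. Where k planes of the arrangement meet H in a common line its order is at least
  k - 1, which sums to \<open>card \<A>\<close> minus the number of lines; the points of Z are
  further zeros. With Z empty this bounds n_H from below, with Z large it forces tangency to
  H.\<close>

lemma log_derivation_degree:
  assumes cen: "central_arrangement \<A>" and H: "linear_plane H" "H \<notin> \<A>"
    and \<theta>: "\<theta> \<in> log_derivations \<A>" "homogeneous_deriv e \<theta>"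
    and uw: "u \<in> H" "w \<in> H" "w \<noteq> 0" "\<And>c. u \<noteq> c *s w" "\<And>K. K \<in> \<A> \<Longrightarrow> w \<notin> K"
    and Z: "finite Z" "\<And>z. z \<in> Z \<Longrightarrow> bdot (nrm H) (evv \<theta> (u + z *s w)) = 0"
      "\<And>z K. z \<in> Z \<Longrightarrow> K \<in> \<A> \<Longrightarrow> u + z *s w \<notin> K"
    and ne: "line_poly (contract (nrm H) \<theta>) u w \<noteq> 0"
  shows "card Z + card \<A> \<le> e + card ((\<lambda>K. H \<inter> K) ` \<A>)"
proof -
  define f where "f = line_poly (contract (nrm H) \<theta>) u w"
  define \<tau> where "\<tau> K = - bdot (nrm K) u / bdot (nrm K) w" for K
  have fin: "finite \<A>" using cen by (rule central_arrangementD)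
  have pl: "linear_plane K" if "K \<in> \<A>" for K using cen that by (rule central_arrangementD)
  have mem: "u + t *s w \<in> K \<longleftrightarrow> \<tau> K = t" if "K \<in> \<A>" for t K
  proof -
    have "bdot (nrm K) w \<noteq> 0" using uw(5)[OF that] nrm(2)[OF pl[OF that]] by simp
    then show ?thesis using nrm(2)[OF pl[OF that]] by (simp add: \<tau>_def field_simps add_eq_0_iff)
        (metis mult.commute)
  qed
  have pH: "u + t *s w \<in> H" for t
    using uw H linear_plane_subspace vec.subspace_add vec.subspace_scale by metis
  have p0: "u + t *s w \<noteq> 0" for t
  proof
    assume "u + t *s w = 0"
    then have "u = (- t) *s w" by (simp add: add_eq_0_iff2 vec_eq_iff)
    with uw show False by blast
  qed
  have card: "card ((\<lambda>K. H \<inter> K) ` \<A>) = card (\<tau> ` \<A>)"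
  proof (rule card_image_kernel_eq)
    fix K L assume KL: "K \<in> \<A>" "L \<in> \<A>"
    show "H \<inter> K = H \<inter> L \<longleftrightarrow> \<tau> K = \<tau> L"
    proof
      assume "H \<inter> K = H \<inter> L"
      then have "u + \<tau> K *s w \<in> L" using pH mem[OF KL(1)] by blast
      then show "\<tau> K = \<tau> L" using mem KL by simp
    next
      assume "\<tau> K = \<tau> L"
      then show "H \<inter> K = H \<inter> L"
        using KL H mem pH p0 pl by (intro plane_inter_eqI[of _ _ _ "u + \<tau> K *s w"]) auto
    qed
  qed
  define R where "R t = {K \<in> \<A>. \<tau> K = t}" for t
  have ord: "card (R t) \<le> order t f + 1" for t
  proof -
    have "[:- t, 1:] ^ (card (R t) - 1) dvd f" unfolding f_def
      using mem by (intro log_derivation_order[OF cen H \<theta>(1) uw(1,2,4)]) (auto simp: R_def)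
    then have "card (R t) - 1 \<le> order t f" using ne by (auto simp: f_def order_divides)
    then show ?thesis by simp
  qed
  have "card \<A> = (\<Sum>t\<in>\<tau> ` \<A>. card (R t))"
    using sum.image_gen[OF fin, of "\<lambda>_. 1::nat" \<tau>] by (simp add: R_def)
  also have "\<dots> \<le> (\<Sum>t\<in>\<tau> ` \<A>. order t f + 1)" by (rule sum_mono) (rule ord)
  also have "\<dots> = (\<Sum>t\<in>\<tau> ` \<A>. order t f) + card (\<tau> ` \<A>)" by (simp only: sum.distrib) simp
  finally have 1: "card \<A> \<le> (\<Sum>t\<in>\<tau> ` \<A>. order t f) + card (\<tau> ` \<A>)" .
  have "card Z = (\<Sum>t\<in>Z. 1)" by simp
  also have "\<dots> \<le> (\<Sum>t\<in>Z. order t f)"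
  proof (rule sum_mono)
    fix z assume "z \<in> Z"
    then have "poly f z = 0" using Z(2) by (simp add: f_def)
    then have "order z f \<noteq> 0" using ne order_root[of f z] by (simp add: f_def)
    then show "1 \<le> order z f" by simp
  qed
  finally have 2: "card Z \<le> (\<Sum>t\<in>Z. order t f)" .
  have "Z \<inter> \<tau> ` \<A> = {}" using Z(3) mem by auto
  then have "(\<Sum>t\<in>Z. order t f) + (\<Sum>t\<in>\<tau> ` \<A>. order t f) = (\<Sum>t\<in>Z \<union> \<tau> ` \<A>. order t f)"
    using Z(1) fin by (simp add: sum.union_disjoint)
  also have "\<dots> \<le> degree f" using ne Z(1) fin by (intro sum_order_le_degree) (auto simp: f_def)
  also have "\<dots> \<le> e" unfolding f_def by (intro degree_line_poly homogeneous_contract \<theta>)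
  finally show ?thesis using 1 2 card by linarith
qed

section \<open>Saito pairs and the removal of a plane\<close>

text \<open>Saito's criterion with the Euler derivation as first basis element. A deletion only
  replaces one of the other two derivations, so the induction can work with these instead of with
  modules.\<close>

definition free_pair :: "(complex ^ 3) set set \<Rightarrow> nat \<Rightarrow> nat \<Rightarrow> bool" where
  "free_pair \<A> a b \<longleftrightarrow> (\<exists>\<phi> \<psi> k. \<phi> \<in> log_derivations \<A> \<and> \<psi> \<in> log_derivations \<A> \<and>
     homogeneous_deriv a \<phi> \<and> homogeneous_deriv b \<psi> \<and> k \<noteq> 0 \<and> det3 Eu \<phi> \<psi> = PConst k * Qp \<A>)"

lemma free_pair_commute: "free_pair \<A> a b \<Longrightarrow> free_pair \<A> b a"
proof -
  assume "free_pair \<A> a b"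
  then obtain \<phi> \<psi> k where *: "\<phi> \<in> log_derivations \<A>" "\<psi> \<in> log_derivations \<A>"
     "homogeneous_deriv a \<phi>" "homogeneous_deriv b \<psi>" "k \<noteq> 0" "det3 Eu \<phi> \<psi> = PConst k * Qp \<A>"
    unfolding free_pair_def by blast
  have "det3 Eu \<psi> \<phi> = PConst (- k) * Qp \<A>"
    unfolding det3_swap[of Eu \<psi> \<phi>] *(6) by (intro evp_eqI) simp
  with * show ?thesis unfolding free_pair_def by (metis neg_equal_0_iff_equal)
qed

lemma free_pair_free: "central_arrangement \<A> \<Longrightarrow> free_pair \<A> a b \<Longrightarrow> free_with_exponents \<A> 1 a b"
  unfolding free_pair_def free_with_exponents_def
  using saito_criterion Eu_log_derivations homogeneous_Eu by (metis One_nat_def)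

lemma free_pair_card:
  assumes "central_arrangement \<A>" "free_pair \<A> a b"
  shows "card \<A> = 1 + a + b"
proof -
  obtain \<phi> \<psi> k where *: "homogeneous_deriv a \<phi>" "homogeneous_deriv b \<psi>" "k \<noteq> 0" "det3 Eu \<phi> \<psi> = PConst k * Qp \<A>"
    using assms(2) unfolding free_pair_def by blast
  have "homogeneous (1 + a + b) (PConst k * Qp \<A>)"
    using homogeneous_det3[OF homogeneous_Eu *(1,2)] by (simp add: *(4))
  moreover have "homogeneous (card \<A>) (PConst k * Qp \<A>)"
    by (intro homogeneous_PConst_mult homogeneous_Qp assms)
  moreover have "PConst k * Qp \<A> \<noteq> 0"
    using * Qp_neq_0[OF assms(1)] by simp
  ultimately show ?thesis using homogeneous_unique by metis
qed

lemma evp_cross_Eu: "evp (cross Eu \<phi> $ k) v = cross v (evv \<phi> v) $ k"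
  using exhaust_3[of k] by (auto simp: cross_components Eu_def)

lemma homogeneous_cross_Eu:
  assumes "homogeneous_deriv d \<phi>"
  shows "homogeneous (Suc d) (cross Eu \<phi> $ k)"
proof -
  have *: "homogeneous (Suc d) (Eu $ i * \<phi> $ j)" for i j
    using homogeneous_mult[of 1 "PVar i" d "\<phi> $ j"] homogeneous_PVar[of i] assms
    by (simp add: Eu_def homogeneous_deriv_def)
  show ?thesis
    using exhaust_3[of k] homogeneous_diff[OF * *] by (auto simp: cross_components)
qed

lemma cross_multiple [simp]: "cross v (t *s v) = 0"
  by (simp add: vec_eq_3 cross_components)

lemma cross_zero_right [simp]: "cross v 0 = 0" "cross 0 v = 0"
  by (simp_all add: vec_eq_3 cross_components)

lemma cross_on_plane_eq_0:
  assumes "n \<noteq> 0" "n $ k \<noteq> 0" "bdot n x = 0" "bdot n y = 0" "cross x y $ k = 0"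
  shows "cross x y = 0"
  using cross_parallel_normal[OF assms(1,3,4)] assms(2,5) by auto

lemma det3_cross: "det3 a b c = - bdot b (cross a (c :: complex ^ 3))"
  by (simp add: det3_def bdot_3 cross_components algebra_simps)

lemma restr_representatives:
  assumes "central_arrangement \<A>" "H \<in> \<A>"
  obtains F where "F \<subseteq> \<A>" "H \<notin> F" "inj_on (\<lambda>K. H \<inter> K) F" "card F = card (restr \<A> H)" "central_arrangement F"
proof -
  obtain F where "F \<subseteq> \<A> - {H}" "inj_on (\<lambda>K. H \<inter> K) F" "restr \<A> H = (\<lambda>K. H \<inter> K) ` F"
    unfolding restr_def using subset_image_inj[of "(\<lambda>K. H \<inter> K) ` (\<A> - {H})" "\<lambda>K. H \<inter> K" "\<A> - {H}"] by auto
  with assms show thesis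
    by (intro that[of F]) (auto simp: card_image intro: central_arrangement_subset)
qed

text \<open>On the line of H and K the field is tangent to both planes, hence radial, so its cross
  product with v vanishes there.\<close>

lemma cross_Eu_division:
  assumes cen: "central_arrangement \<A>" and H: "H \<in> \<A>"
    and F: "F \<subseteq> \<A>" "H \<notin> F" "inj_on (\<lambda>K. H \<inter> K) F" "central_arrangement F"
    and \<phi>: "\<phi> \<in> log_derivations \<A>" "homogeneous_deriv a \<phi>"
  shows "\<exists>q g. cross Eu \<phi> $ k = form H * q + Qp F * g \<and> homogeneous_quot (Suc a) (card F) g"
proof (rule division_by_lines)
  show "linear_plane H" using cen H by (rule central_arrangementD)
  show "homogeneous (Suc a) (cross Eu \<phi> $ k)" using \<phi>(2) by (rule homogeneous_cross_Eu)
  show "evp (cross Eu \<phi> $ k) v = 0" if K: "K \<in> F" and v: "v \<in> H" "v \<in> K" for K v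
  proof (cases "v = 0")
    case False
    have pl: "linear_plane H" "linear_plane K" "K \<noteq> H" using cen F H K by (auto dest: central_arrangementD)
    have "K \<in> \<A>" using F K by blast
    obtain t where "evv \<phi> v = t *s v"
      using two_planes_line[OF nrm(1)[OF pl(1)] nrm_not_multiple[OF pl(2,1,3)] False, of "evv \<phi> v"]
        log_derivationsD[OF cen \<phi>(1) H v(1)] log_derivationsD[OF cen \<phi>(1) \<open>K \<in> \<A>\<close> v(2)]
        v nrm(2)[OF pl(1), of v] nrm(2)[OF pl(2), of v] by blast
    then show ?thesis by (simp add: evp_cross_Eu)
  qed (simp add: evp_cross_Eu)
qed (use F in auto)

text \<open>Some component of the cross product is nonzero on H; it has degree a + 1 and vanishes on
  all the intersection lines of H.\<close>

lemma card_restr_le: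
  assumes cen: "central_arrangement \<A>" and H: "H \<in> \<A>"
    and \<phi>: "\<phi> \<in> log_derivations \<A>" "homogeneous_deriv a \<phi>" and w: "w \<in> H" "cross w (evv \<phi> w) \<noteq> 0"
  shows "card (restr \<A> H) \<le> a + 1"
proof -
  obtain F where F: "F \<subseteq> \<A>" "H \<notin> F" "inj_on (\<lambda>K. H \<inter> K) F" "card F = card (restr \<A> H)" "central_arrangement F"
    using restr_representatives[OF cen H] .
  have pl: "linear_plane H" using cen H by (rule central_arrangementD)
  obtain k where k: "cross w (evv \<phi> w) $ k \<noteq> 0" using nonzero_component w(2) by blast
  obtain q g where *: "cross Eu \<phi> $ k = form H * q + Qp F * g" "homogeneous_quot (Suc a) (card F) g"
    using cross_Eu_division[OF cen H F(1,2,3,5) \<phi>] by blast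
  have "g \<noteq> 0"
    using arg_cong[OF *(1), of "\<lambda>p. evp p w"] k nrm(2)[OF pl, of w] w(1) by (auto simp: evp_cross_Eu)
  then show ?thesis using *(2) F(4) by (auto simp: homogeneous_quot_def)
qed

text \<open>On K the Euler part is tangent, so only the multiple of \<eta> by \<open>form H\<close>
  contributes to the condition; that factor is not identically zero on K and cancels.\<close>

lemma log_derivations_quotient:
  assumes cen: "central_arrangement \<A>" and H: "H \<in> \<A>" and \<phi>: "\<phi> \<in> log_derivations \<A>"
    and eq: "\<phi> = g *s Eu + form H *s \<eta>"
  shows "\<eta> \<in> log_derivations (\<A> - {H})"
proof -
  have cen': "central_arrangement (\<A> - {H})" using cen by (rule central_arrangement_subset) auto
  have plH: "linear_plane H" using cen H by (rule central_arrangementD)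
  show ?thesis unfolding log_derivations_iff[OF cen']
  proof (intro ballI)
    fix K v assume K: "K \<in> \<A> - {H}" and v: "v \<in> K"
    have pl: "linear_plane K" using cen K by (auto dest: central_arrangementD)
    obtain w where w: "w \<in> K" "evp (form H) w \<noteq> 0"
      using Qp_nonzero_on_plane[of "{H}" K] pl plH K
      by (auto simp: Qp_def central_arrangement_def)
    have "evp (contract (nrm K) \<eta>) v = 0"
    proof (rule evp_cancel_subspace[OF linear_plane_subspace[OF pl] _ w v])
      fix x assume x: "x \<in> K"
      then have "bdot (nrm K) (evv \<phi> x) = 0" using log_derivationsD[OF cen \<phi>] K by blast
      then show "evp (form H) x * evp (contract (nrm K) \<eta>) x = 0"
        using x nrm(2)[OF pl, of x] by (simp add: eq)
    qed
    then show "bdot (nrm K) (evv \<eta> v) = 0" by simp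
  qed
qed

lemma Qp_remove:
  assumes "central_arrangement \<A>" "H \<in> \<A>"
  shows "Qp \<A> = form H * Qp (\<A> - {H})"
  unfolding Qp_def using assms by (simp add: prod.remove central_arrangementD)

lemma det3_quotient:
  assumes cen: "central_arrangement \<A>" and H: "H \<in> \<A>"
    and det: "det3 Eu (g *s Eu + form H *s \<eta>) \<psi> = PConst k * Qp \<A>"
  shows "det3 Eu \<eta> \<psi> = PConst k * Qp (\<A> - {H})"
proof (rule poly3_cancel)
  show "form H \<noteq> 0" using nrm(1) cen H central_arrangementD by auto
  have "form H * det3 Eu \<eta> \<psi> = det3 Eu (g *s Eu + form H *s \<eta>) \<psi>"
    using det3_combination(2)[of Eu g "form H" \<eta> 0 \<psi>] by simp
  also have "\<dots> = form H * (PConst k * Qp (\<A> - {H}))"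
    unfolding det Qp_remove[OF cen H] by (simp only: mult_ac)
  finally show "form H * det3 Eu \<eta> \<psi> = form H * (PConst k * Qp (\<A> - {H}))" .
qed

text \<open>Dividing \<phi> by \<open>form H\<close> modulo the Euler derivation also divides the
  determinant by it, which gives a Saito pair without H. The upper bound on n_H comes from \<psi>,
  the lower one from the fact that \<eta> is not tangent to H: otherwise the new determinant would
  vanish on H.\<close>

lemma deletion_parallel:
  assumes cen: "central_arrangement \<A>" and H: "H \<in> \<A>"
    and \<phi>: "\<phi> \<in> log_derivations \<A>" "homogeneous_deriv a \<phi>"
    and \<psi>: "\<psi> \<in> log_derivations \<A>" "homogeneous_deriv b \<psi>"
    and k: "k \<noteq> 0" and det: "det3 Eu \<phi> \<psi> = PConst k * Qp \<A>"
    and par: "\<And>v. v \<in> H \<Longrightarrow> cross v (evv \<phi> v) = 0"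
  shows "a \<ge> 1 \<and> free_pair (\<A> - {H}) (a - 1) b \<and> card (restr \<A> H) = b + 1"
proof -
  have cen': "central_arrangement (\<A> - {H})" using cen by (rule central_arrangement_subset) auto
  have pl: "linear_plane H" using cen H by (rule central_arrangementD)
  obtain g \<eta> where \<eta>: "\<phi> = g *s Eu + form H *s \<eta>" "homogeneous (a - 1) g" "homogeneous_deriv (a - 1) \<eta>"
    "a \<ge> 1 \<or> \<phi> = 0"
    using parallel_to_Eu[OF pl \<phi>(2) par] .
  have "\<phi> \<noteq> 0"
  proof
    assume "\<phi> = 0"
    then have "PConst k * Qp \<A> = 0" using det by (simp add: det3_def)
    then show False using k Qp_neq_0[OF cen] by simp
  qed
  with \<eta> have a: "a \<ge> 1" by blast
  have \<eta>': "\<eta> \<in> log_derivations (\<A> - {H})" using log_derivations_quotient[OF cen H \<phi>(1) \<eta>(1)] .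
  have \<psi>': "\<psi> \<in> log_derivations (\<A> - {H})" using \<psi>(1) log_derivations_antimono[of "\<A> - {H}" \<A>] by blast
  have det': "det3 Eu \<eta> \<psi> = PConst k * Qp (\<A> - {H})"
    using det3_quotient[OF cen H] det \<eta>(1) by blast
  have fp: "free_pair (\<A> - {H}) (a - 1) b"
    unfolding free_pair_def using \<eta>' \<psi>' \<eta>(3) \<psi>(2) k det' by blast
  obtain w where w: "w \<in> H" "evp (Qp (\<A> - {H})) w \<noteq> 0"
    using Qp_nonzero_on_plane[OF cen' pl] by blast
  have dw: "det3 w (evv \<eta> w) (evv \<psi> w) \<noteq> 0"
    using arg_cong[OF det', of "\<lambda>p. evp p w"] w k by (simp add: evp_det3)
  have "cross w (evv \<psi> w) \<noteq> 0"
    using dw by (auto simp: det3_cross)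
  then have le: "card (restr \<A> H) \<le> b + 1"
    by (rule card_restr_le[OF cen H \<psi> w(1)])
  obtain u w' where uw: "u \<in> H" "w' \<in> H" "w' \<noteq> 0" "\<And>c. u \<noteq> c *s w'" "\<And>K. K \<in> \<A> - {H} \<Longrightarrow> w' \<notin> K"
    using plane_line_parameters[OF cen' pl] by blast
  have "line_poly (contract (nrm H) \<eta>) u w' \<noteq> 0"
  proof
    assume 0: "line_poly (contract (nrm H) \<eta>) u w' = 0"
    have "evp (contract (nrm H) \<eta>) w = 0"
      using line_poly_eq_0_imp[OF pl uw(1-4) homogeneous_contract[OF \<eta>(3)] 0 w(1)] .
    then have "det3 w (evv \<eta> w) (evv \<psi> w) = 0"
      using log_derivationsD[OF cen \<psi>(1) H w(1)] nrm[OF pl] w(1)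
      by (intro det3_plane[of "nrm H"]) auto
    with dw show False by simp
  qed
  \<comment> \<open>Without prescribed zeros the degree estimate reads a + b - n_H \<le> a -
    1.\<close>
  then have "card ({} :: complex set) + card (\<A> - {H}) \<le> (a - 1) + card ((\<lambda>K. H \<inter> K) ` (\<A> - {H}))"
    by (intro log_derivation_degree[OF cen' pl _ \<eta>' \<eta>(3) uw]) auto
  moreover have "card (\<A> - {H}) = a + b"
    using free_pair_card[OF cen' fp] a by simp
  ultimately have "b + 1 \<le> card (restr \<A> H)" using a by (simp add: restr_def)
  with le a fp show ?thesis by simp
qed

text \<open>With n_H = a + 1 the cofactor for \<phi> on H has degree 0, so it is a nonzero constant.
  The cross product for \<psi> is then a polynomial multiple q of that for \<phi> on H, and \<psi> -
  q \<phi> is radial there and can be divided by \<open>form H\<close>.\<close>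

lemma deletion_transversal:
  assumes cen: "central_arrangement \<A>" and H: "H \<in> \<A>"
    and \<phi>: "\<phi> \<in> log_derivations \<A>" "homogeneous_deriv a \<phi>"
    and \<psi>: "\<psi> \<in> log_derivations \<A>" "homogeneous_deriv b \<psi>"
    and k: "k \<noteq> 0" and det: "det3 Eu \<phi> \<psi> = PConst k * Qp \<A>"
    and w: "w \<in> H" "cross w (evv \<phi> w) \<noteq> 0" and card: "card (restr \<A> H) = a + 1"
  shows "b \<ge> 1 \<and> free_pair (\<A> - {H}) a (b - 1)"
proof -
  have pl: "linear_plane H" using cen H by (rule central_arrangementD)
  obtain F where F: "F \<subseteq> \<A>" "H \<notin> F" "inj_on (\<lambda>K. H \<inter> K) F" "card F = card (restr \<A> H)" "central_arrangement F"
    using restr_representatives[OF cen H] .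
  \<comment> \<open>On H the cross product of v with a tangent vector is a multiple of the normal,
    so one component where the normal is nonzero determines it.\<close>
  obtain l where l: "nrm H $ l \<noteq> 0" using nonzero_component nrm(1)[OF pl] by blast
  obtain q1 g1 where 1: "cross Eu \<phi> $ l = form H * q1 + Qp F * g1" "homogeneous_quot (Suc a) (card F) g1"
    using cross_Eu_division[OF cen H F(1,2,3,5) \<phi>] by blast
  obtain q2 g2 where 2: "cross Eu \<psi> $ l = form H * q2 + Qp F * g2" "homogeneous_quot (Suc b) (card F) g2"
    using cross_Eu_division[OF cen H F(1,2,3,5) \<psi>] by blast
  have "homogeneous 0 g1" using 1(2) F(4) card by (auto simp: homogeneous_quot_def)
  then obtain c where c: "g1 = PConst c" using homogeneous_0_const by blast
  have on1: "cross v (evv \<phi> v) $ l = evp (Qp F) v * c" if "v \<in> H" for v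
    using arg_cong[OF 1(1), of "\<lambda>p. evp p v"] that nrm(2)[OF pl, of v] by (simp add: evp_cross_Eu c)
  have on2: "cross v (evv \<psi> v) $ l = evp (Qp F) v * evp g2 v" if "v \<in> H" for v
    using arg_cong[OF 2(1), of "\<lambda>p. evp p v"] that nrm(2)[OF pl, of v] by (simp add: evp_cross_Eu)
  have "c \<noteq> 0"
  proof
    assume "c = 0"
    then have "cross w (evv \<phi> w) = 0"
      using on1[OF w(1)] l nrm[OF pl] w(1) log_derivationsD[OF cen \<phi>(1) H w(1)]
      by (intro cross_on_plane_eq_0[of "nrm H" l]) auto
    with w show False by simp
  qed
  define q where "q = PConst (1 / c) * g2"
  define \<zeta> where "\<zeta> = \<psi> - q *s \<phi>"
  have "q *s \<phi> \<in> log_derivations \<A>"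
    using Der.subspace_scale log_derivations_submodule[OF cen] \<phi>(1) by blast
  then have \<zeta>: "\<zeta> \<in> log_derivations \<A>"
    unfolding \<zeta>_def using Der.subspace_diff log_derivations_submodule[OF cen] \<psi>(1) by blast
  have "homogeneous b (q * \<phi> $ i)" for i
  proof (cases "g2 = 0")
    case False
    then have "a \<le> b" "homogeneous (b - a) q"
      using 2(2) F(4) card by (auto simp: homogeneous_quot_def q_def intro: homogeneous_PConst_mult)
    then show ?thesis
      using homogeneous_mult[of "b - a" q a "\<phi> $ i"] \<phi>(2) by (simp add: homogeneous_deriv_def)
  qed (simp add: q_def)
  then have \<zeta>h: "homogeneous_deriv b \<zeta>"
    using \<psi>(2) by (auto simp: homogeneous_deriv_def \<zeta>_def intro: homogeneous_diff)
  have par: "cross v (evv \<zeta> v) = 0" if v: "v \<in> H" for v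
  proof (rule cross_on_plane_eq_0[of "nrm H" l])
    have "cross v (evv \<zeta> v) $ l = cross v (evv \<psi> v) $ l - evp q v * cross v (evv \<phi> v) $ l"
      using exhaust_3[of l] by (auto simp: cross_components \<zeta>_def algebra_simps)
    also have "\<dots> = 0"
      using \<open>c \<noteq> 0\<close> by (simp add: on1[OF v] on2[OF v] q_def)
    finally show "cross v (evv \<zeta> v) $ l = 0" .
  qed (use l nrm[OF pl] v log_derivationsD[OF cen \<zeta> H v] in auto)
  obtain g \<eta> where \<eta>: "\<zeta> = g *s Eu + form H *s \<eta>" "homogeneous (b - 1) g" "homogeneous_deriv (b - 1) \<eta>"
    "b \<ge> 1 \<or> \<zeta> = 0"
    using parallel_to_Eu[OF pl \<zeta>h par] .
  have "det3 Eu \<phi> \<zeta> = det3 Eu \<phi> \<psi>"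
    using det3_combination(3)[of Eu \<phi> 0 "- q" 1 \<psi>] by (simp add: \<zeta>_def)
  then have det\<zeta>: "det3 Eu \<zeta> \<phi> = PConst (- k) * Qp \<A>"
    unfolding det3_swap[of Eu \<zeta> \<phi>] det by (intro evp_eqI) (simp add: det)
  have "\<zeta> \<noteq> 0"
  proof
    assume "\<zeta> = 0"
    then have "PConst (- k) * Qp \<A> = 0" using det\<zeta> by (simp add: det3_def)
    then show False using k Qp_neq_0[OF cen] by simp
  qed
  with \<eta> have b: "b \<ge> 1" by blast
  have det': "det3 Eu \<eta> \<phi> = PConst (- k) * Qp (\<A> - {H})"
    using det3_quotient[OF cen H] det\<zeta> \<eta>(1) by blast
  have "\<eta> \<in> log_derivations (\<A> - {H})" using log_derivations_quotient[OF cen H \<zeta> \<eta>(1)] .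
  moreover have "\<phi> \<in> log_derivations (\<A> - {H})" using \<phi>(1) log_derivations_antimono[of "\<A> - {H}" \<A>] by blast
  ultimately have "free_pair (\<A> - {H}) (b - 1) a"
    unfolding free_pair_def using \<eta>(3) \<phi>(2) k det' by (metis neg_equal_0_iff_equal)
  with b show ?thesis using free_pair_commute by blast
qed

text \<open>A derivation that is radial on H gives a deletion directly. If neither is, n_H is at
  most a + 1 and at most b + 1, and attaining either value gives a deletion after a
  correction.\<close>

theorem deletion:
  assumes cen: "central_arrangement \<A>" and H: "H \<in> \<A>" and fp: "free_pair \<A> a b"
  shows "(a \<ge> 1 \<and> free_pair (\<A> - {H}) (a - 1) b \<and> card (restr \<A> H) = b + 1) \<or>
    (b \<ge> 1 \<and> free_pair (\<A> - {H}) a (b - 1) \<and> card (restr \<A> H) = a + 1) \<or>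
    card (restr \<A> H) \<le> min a b"
proof -
  obtain \<phi> \<psi> k where \<phi>: "\<phi> \<in> log_derivations \<A>" "homogeneous_deriv a \<phi>"
    and \<psi>: "\<psi> \<in> log_derivations \<A>" "homogeneous_deriv b \<psi>"
    and k: "k \<noteq> 0" and det: "det3 Eu \<phi> \<psi> = PConst k * Qp \<A>"
    using fp unfolding free_pair_def by blast
  have k': "- k \<noteq> 0" and det': "det3 Eu \<psi> \<phi> = PConst (- k) * Qp \<A>"
    unfolding det3_swap[of Eu \<psi> \<phi>] det using k by (auto intro: evp_eqI)
  consider "\<And>v. v \<in> H \<Longrightarrow> cross v (evv \<phi> v) = 0" | "\<And>v. v \<in> H \<Longrightarrow> cross v (evv \<psi> v) = 0"
    | v w where "v \<in> H" "cross v (evv \<phi> v) \<noteq> 0" "w \<in> H" "cross w (evv \<psi> w) \<noteq> 0" by blast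
  then show ?thesis
  proof cases
    case 1
    then show ?thesis using deletion_parallel[OF cen H \<phi> \<psi> k det] by blast
  next
    case 2
    then show ?thesis using deletion_parallel[OF cen H \<psi> \<phi> k' det'] free_pair_commute by blast
  next
    case 3
    have le: "card (restr \<A> H) \<le> a + 1" "card (restr \<A> H) \<le> b + 1"
      using card_restr_le[OF cen H \<phi> 3(1,2)] card_restr_le[OF cen H \<psi> 3(3,4)] .
    consider "card (restr \<A> H) = a + 1" | "card (restr \<A> H) = b + 1" | "card (restr \<A> H) \<le> min a b"
      using le by linarith
    then show ?thesis
    proof cases
      case 1
      then show ?thesis using deletion_transversal[OF cen H \<phi> \<psi> k det 3(1,2)] by blast
    next
      case 2
      then show ?thesis using deletion_transversal[OF cen H \<psi> \<phi> k' det' 3(3,4)] free_pair_commute by blast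
    qed blast
  qed
qed

subsection \<open>Counting intersection lines\<close>

definition pts :: "(complex ^ 3) set set \<Rightarrow> (complex ^ 3) set set" where
  "pts \<A> = (\<Union>H\<in>\<A>. restr \<A> H)"

definition mult_at :: "(complex ^ 3) set set \<Rightarrow> (complex ^ 3) set \<Rightarrow> nat" where
  "mult_at \<A> P = card {H \<in> \<A>. P \<subseteq> H}"

text \<open>The sum of the Moebius function over the intersection lines, which is the linear
  coefficient of the characteristic polynomial; for (t - 1)(t - a)(t - b) that coefficient is ab + a
  + b.\<close>

definition mobius_sum :: "(complex ^ 3) set set \<Rightarrow> nat" where
  "mobius_sum \<A> = (\<Sum>P\<in>pts \<A>. mult_at \<A> P - 1)"

lemma finite_restr: "finite \<A> \<Longrightarrow> finite (restr \<A> H)"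
  by (simp add: restr_def)

lemma finite_pts: "finite \<A> \<Longrightarrow> finite (pts \<A>)"
  by (simp add: pts_def finite_restr)

lemma pts_iff: "P \<in> pts \<A> \<longleftrightarrow> (\<exists>H\<in>\<A>. \<exists>K\<in>\<A>. H \<noteq> K \<and> P = H \<inter> K)"
  by (auto simp: pts_def restr_def)

lemma pts_insert: "pts (insert H \<A>) = pts \<A> \<union> restr (insert H \<A>) H"
proof
  show "pts (insert H \<A>) \<subseteq> pts \<A> \<union> restr (insert H \<A>) H"
  proof
    fix P assume "P \<in> pts (insert H \<A>)"
    then obtain K L where KL: "K \<in> insert H \<A>" "L \<in> insert H \<A>" "K \<noteq> L" "P = K \<inter> L"
      unfolding pts_iff by blast
    have in_restr: "H \<inter> M \<in> restr (insert H \<A>) H" if "M \<in> insert H \<A>" "M \<noteq> H" for M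
      using that unfolding restr_def by blast
    consider "K = H" | "L = H" | "K \<in> \<A>" "L \<in> \<A>" using KL by blast
    then show "P \<in> pts \<A> \<union> restr (insert H \<A>) H"
    proof cases
      case 1
      then show ?thesis using in_restr[of L] KL by simp
    next
      case 2
      then show ?thesis using in_restr[of K] KL by (simp add: Int_commute)
    next
      case 3
      then have "P \<in> pts \<A>" unfolding pts_iff using KL by blast
      then show ?thesis by blast
    qed
  qed
  show "pts \<A> \<union> restr (insert H \<A>) H \<subseteq> pts (insert H \<A>)"
    unfolding restr_def subset_iff Un_iff pts_iff image_iff by blast
qed

lemma plane_inter_subset_eq:
  assumes "linear_plane H" "linear_plane K" "linear_plane L" "H \<noteq> K" "H \<noteq> L" "H \<inter> K \<subseteq> L"
  shows "H \<inter> K = H \<inter> L"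
proof -
  obtain v where "v \<noteq> 0" "v \<in> H" "v \<in> K" using plane_inter_nonzero assms by blast
  then show ?thesis using assms by (intro plane_inter_eqI[of H K L v]) auto
qed

lemma restr_eq_pts:
  assumes "central_arrangement \<A>" "H \<in> \<A>"
  shows "restr \<A> H = {P \<in> pts \<A>. P \<subseteq> H}"
proof
  show "restr \<A> H \<subseteq> {P \<in> pts \<A>. P \<subseteq> H}" using assms by (auto simp: pts_iff restr_def)
  show "{P \<in> pts \<A>. P \<subseteq> H} \<subseteq> restr \<A> H"
  proof
    fix P assume "P \<in> {P \<in> pts \<A>. P \<subseteq> H}"
    then obtain K L where KL: "K \<in> \<A>" "L \<in> \<A>" "K \<noteq> L" "P = K \<inter> L" "K \<inter> L \<subseteq> H"
      by (auto simp: pts_iff)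
    have in_restr: "H \<inter> M \<in> restr \<A> H" if "M \<in> \<A>" "M \<noteq> H" for M
      using that unfolding restr_def by blast
    show "P \<in> restr \<A> H"
    proof (cases "K = H")
      case True
      then show ?thesis using in_restr[of L] KL by simp
    next
      case False
      then have "K \<inter> L = K \<inter> H"
        using KL assms by (intro plane_inter_subset_eq) (auto dest: central_arrangementD)
      then show ?thesis using in_restr[of K] KL False by (simp add: Int_commute)
    qed
  qed
qed

text \<open>Every line on H contributes exactly one more. An old line gains a plane; a new line lay
  in a single old plane, so its term 1 - 1 becomes 1.\<close>

lemma mobius_sum_insert:
  assumes cen: "central_arrangement (insert H \<A>)" and H: "H \<notin> \<A>"
  shows "mobius_sum (insert H \<A>) = mobius_sum \<A> + card (restr (insert H \<A>) H)"
proof -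
  let ?B = "insert H \<A>"
  have fin: "finite ?B" using cen by (rule central_arrangementD)
  have pl: "linear_plane K" if "K \<in> ?B" for K using cen that by (rule central_arrangementD)
  have old: "mobius_sum \<A> = (\<Sum>P\<in>pts ?B. mult_at \<A> P - 1)"
    unfolding mobius_sum_def
  proof (rule sum.mono_neutral_left)
    show "finite (pts ?B)" using fin by (rule finite_pts)
    show "pts \<A> \<subseteq> pts ?B" by (auto simp: pts_insert)
    show "\<forall>P\<in>pts ?B - pts \<A>. mult_at \<A> P - 1 = 0"
    proof
      fix P assume P: "P \<in> pts ?B - pts \<A>"
      then obtain K where K: "K \<in> \<A>" "K \<noteq> H" "P = H \<inter> K" by (auto simp: pts_insert restr_def)
      have "{L \<in> \<A>. P \<subseteq> L} \<subseteq> {K}"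
      proof
        fix L assume "L \<in> {L \<in> \<A>. P \<subseteq> L}"
        then have L: "L \<in> \<A>" "H \<inter> K \<subseteq> L" using K by auto
        show "L \<in> {K}"
        proof (rule ccontr)
          assume "L \<notin> {K}"
          then have "K \<inter> H = K \<inter> L"
            using L K pl by (intro plane_inter_subset_eq) (simp_all add: Int_commute)
          then have "P = K \<inter> L" using K(3) by (simp only: Int_commute)
          moreover have "K \<noteq> L" using \<open>L \<notin> {K}\<close> by blast
          ultimately have "P \<in> pts \<A>" unfolding pts_iff using K(1) L(1) by blast
          with P show False by blast
        qed
      qed
      then have "mult_at \<A> P \<le> 1" unfolding mult_at_def by (metis card_mono finite.emptyI finite.insertI is_singletonI is_singleton_altdef)
      then show "mult_at \<A> P - 1 = 0" by simp
    qed
  qed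
  have "mobius_sum ?B = (\<Sum>P\<in>pts ?B. (mult_at \<A> P - 1) + (if P \<subseteq> H then 1 else 0))"
    unfolding mobius_sum_def
  proof (rule sum.cong)
    fix P assume P: "P \<in> pts ?B"
    have fa: "finite {L \<in> \<A>. P \<subseteq> L}" using fin by simp
    show "mult_at ?B P - 1 = (mult_at \<A> P - 1) + (if P \<subseteq> H then 1 else 0)"
    proof (cases "P \<subseteq> H")
      case True
      then have "P \<in> restr ?B H" using restr_eq_pts[OF cen] P by simp
      then obtain K where "K \<in> \<A>" "P \<subseteq> K" by (auto simp: restr_def)
      then have "mult_at \<A> P \<ge> 1" unfolding mult_at_def using fa by (auto simp: Suc_le_eq card_gt_0_iff)
      moreover have "{L \<in> ?B. P \<subseteq> L} = insert H {L \<in> \<A>. P \<subseteq> L}" using True by auto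
      then have "mult_at ?B P = Suc (mult_at \<A> P)" unfolding mult_at_def using fa H by simp
      ultimately show ?thesis using True by simp
    next
      case False
      then have "{L \<in> ?B. P \<subseteq> L} = {L \<in> \<A>. P \<subseteq> L}" by auto
      then show ?thesis using False by (simp add: mult_at_def)
    qed
  qed simp
  also have "\<dots> = mobius_sum \<A> + card {P \<in> pts ?B. P \<subseteq> H}"
    using finite_pts[OF fin] by (simp add: sum.distrib old sum.If_cases Int_def)
  finally show ?thesis using restr_eq_pts[OF cen] by simp
qed

subsection \<open>Dimensions of spaces of logarithmic derivations\<close>

lemma PConst_add: "PConst (c + d) = PConst c + PConst d"
  by (simp add: PConst_def single_add)

lemma PConst_mult: "PConst (c * d) = PConst c * PConst d"
  by (simp add: PConst_def mult_single)

interpretation Cder: vector_space "\<lambda>c (\<theta> :: derivation). PConst c *s \<theta>"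
  by unfold_locales (simp_all add: vec_eq_iff algebra_simps PConst_add PConst_mult PConst_1)

text \<open>Each functional costs at most one dimension. As the space of all derivations is
  infinite-dimensional, dimensions are measured by the sizes of finite independent sets.\<close>

lemma independent_kernel:
  assumes "finite I" "finite B" "Cder.independent B"
    and add: "\<And>i x y. \<psi> i (x + y) = \<psi> i x + (\<psi> i y :: complex)"
    and scale: "\<And>i c x. \<psi> i (PConst c *s x) = c * \<psi> i x"
  shows "\<exists>C. finite C \<and> Cder.independent C \<and> C \<subseteq> Cder.span B \<and> (\<forall>i\<in>I. \<forall>x\<in>C. \<psi> i x = 0) \<and>
    card B \<le> card C + card I"
  using assms(1)
proof (induction I)
  case empty
  show ?case using assms(2,3) Cder.span_superset by (intro exI[of _ B]) auto
next
  case (insert i I)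
  then obtain C where C: "finite C" "Cder.independent C" "C \<subseteq> Cder.span B" "\<forall>i\<in>I. \<forall>x\<in>C. \<psi> i x = 0"
    "card B \<le> card C + card I" by blast
  show ?case
  proof (cases "\<forall>x\<in>C. \<psi> i x = 0")
    case True
    then show ?thesis using C insert.hyps by (intro exI[of _ C]) auto
  next
    case False
    then obtain z where z: "z \<in> C" "\<psi> i z \<noteq> 0" by blast
    \<comment> \<open>The projection along z onto the kernel of the i-th functional.\<close>
    define f where "f x = x - PConst (\<psi> i x / \<psi> i z) *s z" for x
    have diff: "\<psi> j (x - PConst c *s y) = \<psi> j x - c * \<psi> j y" for j x y c
    proof -
      have "\<psi> j x = \<psi> j (x - PConst c *s y) + \<psi> j (PConst c *s y)"
        by (simp flip: add)
      then show ?thesis by (simp add: scale)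
    qed
    obtain D where D: "D \<subseteq> f ` C" "Cder.independent D" "f ` C \<subseteq> Cder.span D"
      using Cder.maximal_independent_subset[of "f ` C"] by blast
    have finD: "finite D" using D(1) C(1) finite_surj by blast
    have "C \<subseteq> Cder.span (insert z D)"
    proof
      fix x assume "x \<in> C"
      then have "f x \<in> Cder.span (insert z D)"
        using D(3) Cder.span_mono[of D "insert z D"] by blast
      moreover have "PConst (\<psi> i x / \<psi> i z) *s z \<in> Cder.span (insert z D)"
        by (intro Cder.span_scale Cder.span_base) simp
      ultimately have "f x + PConst (\<psi> i x / \<psi> i z) *s z \<in> Cder.span (insert z D)"
        by (rule Cder.span_add)
      then show "x \<in> Cder.span (insert z D)" by (simp add: f_def)
    qed
    then have "card C \<le> card (insert z D)"
      using Cder.independent_span_bound[of "insert z D" C] C(2) finD by simp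
    also have "\<dots> \<le> Suc (card D)" using finD by (simp add: card_insert_if)
    finally have "card B \<le> card D + card (insert i I)" using C(5) insert.hyps by simp
    moreover have "D \<subseteq> Cder.span B"
      using D(1) C(3) z(1) by (auto simp: f_def intro!: Cder.span_diff Cder.span_scale)
    moreover have "\<forall>j\<in>insert i I. \<forall>x\<in>D. \<psi> j x = 0"
    proof (intro ballI)
      fix j x assume j: "j \<in> insert i I" and "x \<in> D"
      then obtain y where y: "y \<in> C" "x = f y" using D(1) by blast
      show "\<psi> j x = 0"
        using j y(1) C(4) z by (cases "j = i") (auto simp: y(2) f_def diff)
    qed
    ultimately show ?thesis using finD D(2) by blast
  qed
qed

definition log_derivations_deg :: "(complex ^ 3) set set \<Rightarrow> nat \<Rightarrow> derivation set" where
  "log_derivations_deg \<A> d = {\<theta> \<in> log_derivations \<A>. homogeneous_deriv d \<theta>}"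

lemma log_derivations_deg_subspace:
  assumes "central_arrangement \<A>"
  shows "Cder.subspace (log_derivations_deg \<A> d)"
  using log_derivations_submodule[OF assms]
  by (intro Cder.subspaceI)
    (auto simp: log_derivations_deg_def homogeneous_deriv_def Der.subspace_0 Der.subspace_add
      Der.subspace_scale intro: homogeneous_add homogeneous_PConst_mult)

definition monomials :: "nat \<Rightarrow> (3 \<Rightarrow>\<^sub>0 nat) set" where
  "monomials d = {m. mon_degree m = d}"

lemma mon_degree_3: "mon_degree m = Poly_Mapping.lookup m 1 + Poly_Mapping.lookup m 2 + Poly_Mapping.lookup m 3"
  by (simp only: mon_degree_def sum_3)

lemma card_monomials: "finite (monomials d)" "2 * card (monomials d) = (d + 2) * (d + 1)"
proof -
  define g where "g = (\<lambda>m :: 3 \<Rightarrow>\<^sub>0 nat. (Poly_Mapping.lookup m 1, Poly_Mapping.lookup m 2))"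
  define S where "S = (SIGMA i:{..d}. {..d - i})"
  have bij: "bij_betw g (monomials d) S"
  proof (rule bij_betw_imageI)
    show "inj_on g (monomials d)"
    proof (rule inj_onI)
      fix m m' assume "m \<in> monomials d" "m' \<in> monomials d" "g m = g m'"
      then have "Poly_Mapping.lookup m 1 = Poly_Mapping.lookup m' 1"
        "Poly_Mapping.lookup m 2 = Poly_Mapping.lookup m' 2" "Poly_Mapping.lookup m 3 = Poly_Mapping.lookup m' 3"
        by (auto simp: g_def monomials_def mon_degree_3)
      then show "m = m'" by (intro poly_mapping_eqI) (metis exhaust_3)
    qed
    show "g ` monomials d = S"
    proof
      show "g ` monomials d \<subseteq> S" by (auto simp: g_def S_def monomials_def mon_degree_3)
      show "S \<subseteq> g ` monomials d"
      proof
        fix x assume "x \<in> S"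
        then obtain i j where x: "x = (i, j)" "i + j \<le> d" by (auto simp: S_def)
        define m :: "3 \<Rightarrow>\<^sub>0 nat" where "m = Poly_Mapping.single 1 i + Poly_Mapping.single 2 j + Poly_Mapping.single 3 (d - i - j)"
        have "Poly_Mapping.lookup m 1 = i" "Poly_Mapping.lookup m 2 = j" "Poly_Mapping.lookup m 3 = d - i - j"
          by (simp_all add: m_def lookup_add lookup_single)
        then have "m \<in> monomials d" "g m = x" using x by (auto simp: monomials_def mon_degree_3 g_def)
        then show "x \<in> g ` monomials d" by blast
      qed
    qed
  qed
  have finS: "finite S" by (simp add: S_def)
  then show "finite (monomials d)" using bij bij_betw_finite by blast
  have "card (monomials d) = card S" using bij by (rule bij_betw_same_card)
  also have "\<dots> = (\<Sum>i\<le>d. d - i + 1)" by (simp add: S_def)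
  also have "\<dots> = (\<Sum>i\<le>d. i + 1)" 
    by (rule sum.reindex_bij_witness[of _ "\<lambda>i. d - i" "\<lambda>i. d - i"]) auto
  finally have c: "card (monomials d) = (\<Sum>i\<le>d. i + 1)" .
  have "2 * (\<Sum>i\<le>d. i + 1) = (d + 2) * (d + 1)" by (induction d) (auto simp: algebra_simps)
  then show "2 * card (monomials d) = (d + 2) * (d + 1)" by (simp only: c)
qed

lemma independent_monomial_derivations:
  "\<exists>B. finite B \<and> Cder.independent B \<and> B \<subseteq> log_derivations_deg {} d \<and> card B = 3 * card (monomials d)"
proof -
  define h :: "3 \<times> (3 \<Rightarrow>\<^sub>0 nat) \<Rightarrow> derivation" where "h = (\<lambda>(i, m). axis i (Poly_Mapping.single m 1))"
  define X where "X = (UNIV :: 3 set) \<times> monomials d"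
  have finX: "finite X" unfolding X_def by (intro finite_cartesian_product card_monomials(1)) simp
  have lk: "Poly_Mapping.lookup (h x $ i) m = (if x = (i, m) then 1 else 0)" for x i m
    by (cases x) (auto simp: h_def axis_def lookup_single when_def)
  have inj: "inj_on h X"
  proof (rule inj_onI)
    fix x y assume "h x = h y"
    then have "Poly_Mapping.lookup (h x $ fst y) (snd y) = Poly_Mapping.lookup (h y $ fst y) (snd y)" by simp
    then show "x = y" by (simp add: lk split: if_splits)
  qed
  have "Cder.independent (h ` X)"
  proof (rule Cder.independent_if_scalars_zero)
    fix f x assume 0: "(\<Sum>x\<in>h ` X. PConst (f x) *s x) = 0" and "x \<in> h ` X"
    then obtain y where y: "y \<in> X" "x = h y" by blast
    obtain i m where im: "y = (i, m)" by (cases y)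
    have "0 = Poly_Mapping.lookup ((\<Sum>x\<in>h ` X. PConst (f x) *s x) $ i) m" using 0 by simp
    also have "\<dots> = (\<Sum>z\<in>X. f (h z) * Poly_Mapping.lookup (h z $ i) m)"
      by (simp add: sum.reindex[OF inj] sum_component lookup_sum lookup_PConst_mult)
    also have "\<dots> = (\<Sum>z\<in>X. if z = y then f (h z) else 0)"
      by (intro sum.cong) (auto simp: lk im)
    also have "\<dots> = f x" using y finX by simp
    finally show "f x = 0" by simp
  qed (use finX in simp)
  moreover have "h ` X \<subseteq> log_derivations_deg {} d"
    by (auto simp: log_derivations_deg_def log_derivations_def homogeneous_deriv_def homogeneous_def
        X_def monomials_def h_def axis_def split: if_splits)
  moreover have "card (h ` X) = 3 * card (monomials d)"
    by (simp only: card_image[OF inj]) (simp add: X_def card_cartesian_product)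
  ultimately show ?thesis using finX by blast
qed

text \<open>Putting H on top of k planes costs at most d + 1 + n_H - k dimensions. The sum of the
  n_H is the Moebius sum, by \<open>mobius_sum_insert\<close>; negative terms are moved across the
  inequality because of natural subtraction.\<close>

lemma log_derivations_deg_lower_bound:
  assumes "central_arrangement \<A>" "card \<A> \<le> d"
  shows "\<exists>B. finite B \<and> Cder.independent B \<and> B \<subseteq> log_derivations_deg \<A> d \<and>
    3 * card (monomials d) + (\<Sum>k<card \<A>. k) \<le> card B + card \<A> * (d + 1) + mobius_sum \<A>"
proof -
  have "finite \<A>" using assms(1) by (rule central_arrangementD)
  then show ?thesis using assms
  proof (induction \<A>)
    case empty
    obtain B where "finite B" "Cder.independent B" "B \<subseteq> log_derivations_deg {} d" "card B = 3 * card (monomials d)"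
      using independent_monomial_derivations by blast
    then show ?case by (intro exI[of _ B]) simp
  next
    case (insert H \<A>)
    have cen: "central_arrangement \<A>" using insert.prems(1) by (rule central_arrangement_subset) auto
    have pl: "linear_plane H" using insert.prems(1) by (auto dest: central_arrangementD)
    have le: "card \<A> < d" using insert.prems insert.hyps by simp
    obtain B where B: "finite B" "Cder.independent B" "B \<subseteq> log_derivations_deg \<A> d"
      "3 * card (monomials d) + (\<Sum>k<card \<A>. k) \<le> card B + card \<A> * (d + 1) + mobius_sum \<A>"
      using insert.IH[OF cen] le by auto
    define h where "h = card (restr (insert H \<A>) H)"
    have h: "h = card ((\<lambda>K. H \<inter> K) ` \<A>)" using insert.hyps by (simp add: h_def restr_def)
    obtain u w where uw: "u \<in> H" "w \<in> H" "w \<noteq> 0" "\<And>c. u \<noteq> c *s w" "\<And>K. K \<in> \<A> \<Longrightarrow> w \<notin> K"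
      using plane_line_parameters[OF cen pl insert.hyps(2)] by blast
    have "finite {t. u + t *s w \<in> K}" if K: "K \<in> \<A>" for K
    proof -
      have plK: "linear_plane K" using cen K by (rule central_arrangementD)
      have bw: "bdot (nrm K) w \<noteq> 0" using uw(5)[OF K] nrm(2)[OF plK] by simp
      have "{t. u + t *s w \<in> K} \<subseteq> {- bdot (nrm K) u / bdot (nrm K) w}"
      proof (intro subsetI)
        fix t assume "t \<in> {t. u + t *s w \<in> K}"
        then have "bdot (nrm K) u + t * bdot (nrm K) w = 0" using nrm(2)[OF plK] by simp
        then have "t * bdot (nrm K) w = - bdot (nrm K) u" by (simp add: eq_neg_iff_add_eq_0 add.commute)
        then show "t \<in> {- bdot (nrm K) u / bdot (nrm K) w}"
          using bw by (metis nonzero_mult_div_cancel_right singletonI)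
      qed
      then show ?thesis by (rule finite_subset) simp
    qed
    then have "finite (\<Union>K\<in>\<A>. {t. u + t *s w \<in> K})" using insert.hyps by blast
    then have "infinite (- (\<Union>K\<in>\<A>. {t. u + t *s w \<in> K}))"
      by (metis Compl_eq_Diff_UNIV Diff_infinite_finite infinite_UNIV_char_0)
    \<comment> \<open>One point more than \<open>log_derivation_degree\<close> allows for a nonzero
      restriction, so vanishing on Z forces tangency to H.\<close>
    then obtain Z where Z: "finite Z" "card Z = d + h + 1 - card \<A>" "Z \<subseteq> - (\<Union>K\<in>\<A>. {t. u + t *s w \<in> K})"
      using infinite_arbitrarily_large by blast
    obtain C where C: "finite C" "Cder.independent C" "C \<subseteq> Cder.span B"
      "\<forall>z\<in>Z. \<forall>\<theta>\<in>C. bdot (nrm H) (evv \<theta> (u + z *s w)) = 0" "card B \<le> card C + card Z"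
      using independent_kernel[OF Z(1) B(1,2), of "\<lambda>z \<theta>. bdot (nrm H) (evv \<theta> (u + z *s w))"] by auto
    have "Cder.span B \<subseteq> log_derivations_deg \<A> d"
      using B(3) log_derivations_deg_subspace[OF cen] by (rule Cder.span_minimal)
    then have CA: "C \<subseteq> log_derivations_deg \<A> d" using C(3) by blast
    have "C \<subseteq> log_derivations_deg (insert H \<A>) d"
    proof
      fix \<theta> assume \<theta>: "\<theta> \<in> C"
      then have \<theta>A: "\<theta> \<in> log_derivations \<A>" "homogeneous_deriv d \<theta>"
        using CA by (auto simp: log_derivations_deg_def)
      have "line_poly (contract (nrm H) \<theta>) u w = 0"
      proof (rule ccontr)
        assume ne: "line_poly (contract (nrm H) \<theta>) u w \<noteq> 0"
        have "card Z + card \<A> \<le> d + card ((\<lambda>K. H \<inter> K) ` \<A>)"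
          using Z(3) C(4) \<theta> by (intro log_derivation_degree[OF cen pl insert.hyps(2) \<theta>A uw Z(1) _ _ ne]) auto
        then show False using Z(2) le by (simp add: h)
      qed
      then have "evp (contract (nrm H) \<theta>) v = 0" if "v \<in> H" for v
        using line_poly_eq_0_imp[OF pl uw(1-4) homogeneous_contract[OF \<theta>A(2)]] that by blast
      then have "\<theta> \<in> log_derivations (insert H \<A>)"
        using \<theta>A(1) by (auto simp: log_derivations_iff[OF insert.prems(1)] log_derivations_iff[OF cen])
      with \<theta>A(2) show "\<theta> \<in> log_derivations_deg (insert H \<A>) d" by (simp add: log_derivations_deg_def)
    qed
    moreover have "mobius_sum (insert H \<A>) = mobius_sum \<A> + h"
      using mobius_sum_insert[OF insert.prems(1) insert.hyps(2)] by (simp add: h_def)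
    then have "3 * card (monomials d) + (\<Sum>k<card (insert H \<A>). k)
      \<le> card C + card (insert H \<A>) * (d + 1) + mobius_sum (insert H \<A>)"
      using B(4) C(5) Z(2) le insert.hyps by simp
    ultimately show ?case using C(1,2) by blast
  qed
qed

section \<open>Comparison with a homogeneous basis\<close>

lemma span_three:
  assumes "\<theta> \<in> Der.span {a, b, c}"
  shows "\<exists>x y z. \<theta> = x *s a + y *s b + z *s c"
proof -
  obtain x where "\<theta> - x *s a \<in> Der.span {b, c}"
    using assms Der.span_breakdown_eq[of \<theta> a "{b, c}"] by blast
  then obtain y where "\<theta> - x *s a - y *s b \<in> Der.span {c}"
    using Der.span_breakdown_eq[of "\<theta> - x *s a" b "{c}"] by blast
  then obtain z where "\<theta> - x *s a - y *s b - z *s c \<in> Der.span {}"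
    using Der.span_breakdown_eq[of "\<theta> - x *s a - y *s b" c "{}"] by blast
  then have "\<theta> = x *s a + y *s b + z *s c" by (simp add: algebra_simps)
  then show ?thesis by blast
qed

lemma det3_subspace:
  "Der.subspace {t. det3 t p q = 0}" "Der.subspace {t. det3 p t q = 0}" "Der.subspace {t. det3 p q t = 0}"
proof -
  have *: "det3 (s + t) p q = det3 s p q + det3 t p q" "det3 p (s + t) q = det3 p s q + det3 p t q"
    "det3 p q (s + t) = det3 p q s + det3 p q t" "det3 (x *s t) p q = x * det3 t p q"
    "det3 p (x *s t) q = x * det3 p t q" "det3 p q (x *s t) = x * det3 p q t"
    "det3 0 p q = 0" "det3 p 0 q = 0" "det3 p q 0 = 0" for s t :: derivation and x
    unfolding det3_def by (simp_all add: algebra_simps)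
  show "Der.subspace {t. det3 t p q = 0}" "Der.subspace {t. det3 p t q = 0}" "Der.subspace {t. det3 p q t = 0}"
    by (intro Der.subspaceI; simp add: *)+
qed

lemma det3_span_eq_0:
  assumes "det3 a b c = 0" and t: "t1 \<in> Der.span {a, b, c}" "t2 \<in> Der.span {a, b, c}" "t3 \<in> Der.span {a, b, c}"
  shows "det3 t1 t2 t3 = 0"
proof -
  have perm: "det3 a c b = - det3 a b c" "det3 b a c = - det3 a b c" "det3 b c a = det3 a b c"
    "det3 c a b = det3 a b c" "det3 c b a = - det3 a b c"
    unfolding det3_def by (simp_all add: algebra_simps)
  have 0: "det3 p q r = 0" if "p \<in> {a, b, c}" "q \<in> {a, b, c}" "r \<in> {a, b, c}" for p q r
    using that perm assms(1) by (auto simp: det3_eq)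
  have 1: "det3 s q r = 0" if "s \<in> Der.span {a, b, c}" "q \<in> {a, b, c}" "r \<in> {a, b, c}" for s q r
    using Der.span_minimal[OF _ det3_subspace(1), of "{a, b, c}" q r] 0 that by blast
  have 2: "det3 s s' r = 0" if "s \<in> Der.span {a, b, c}" "s' \<in> Der.span {a, b, c}" "r \<in> {a, b, c}" for s s' r
    using Der.span_minimal[OF _ det3_subspace(2), of "{a, b, c}" s r] 1 that by blast
  show ?thesis
    using Der.span_minimal[OF _ det3_subspace(3), of "{a, b, c}" t1 t2] 2 t by blast
qed

text \<open>The multiples of the coordinate derivations by \<open>Qp \<A>\<close> are logarithmic,
  and their determinant is the nonzero cube of \<open>Qp \<A>\<close>.\<close>

lemma basis_det3_neq_0:
  assumes cen: "central_arrangement \<A>" and span: "Der.span {a, b, c} = log_derivations \<A>"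
  shows "det3 a b c \<noteq> 0"
proof
  assume 0: "det3 a b c = 0"
  have "Qp \<A> *s axis i 1 \<in> Der.span {a, b, c}" for i
  proof -
    have "bdot (nrm H) (evv (Qp \<A> *s axis i 1) v) = 0" if "H \<in> \<A>" "v \<in> H" for H v
      using evp_Qp_eq_0_iff[OF cen, of v] that by auto
    then show ?thesis unfolding span by (auto simp: log_derivations_iff[OF cen])
  qed
  then have "det3 (Qp \<A> *s axis 1 1) (Qp \<A> *s axis 2 1) (Qp \<A> *s axis 3 1) = 0"
    by (intro det3_span_eq_0[OF 0])
  then have "Qp \<A> * (Qp \<A> * Qp \<A>) = 0" by (simp add: det3_def axis_def)
  then show False using Qp_neq_0[OF cen] by simp
qed

text \<open>By Cramer's rule D p1 is the determinant with \<theta> in place of \<theta>1, which is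
  homogeneous; dividing by the homogeneous D fixes the degree of p1.\<close>

lemma basis_coefficients:
  assumes cen: "central_arrangement \<A>" and span: "Der.span {\<theta>1, \<theta>2, \<theta>3} = log_derivations \<A>"
    and hom: "homogeneous_deriv d1 \<theta>1" "homogeneous_deriv d2 \<theta>2" "homogeneous_deriv d3 \<theta>3"
    and \<theta>: "\<theta> \<in> log_derivations \<A>" "homogeneous_deriv d \<theta>"
  shows "\<exists>p1 p2 p3. \<theta> = p1 *s \<theta>1 + p2 *s \<theta>2 + p3 *s \<theta>3 \<and>
    homogeneous_quot d d1 p1 \<and> homogeneous_quot d d2 p2 \<and> homogeneous_quot d d3 p3"
proof -
  obtain p1 p2 p3 where eq: "\<theta> = p1 *s \<theta>1 + p2 *s \<theta>2 + p3 *s \<theta>3"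
    using span_three \<theta>(1) unfolding span[symmetric] by blast
  define D where "D = det3 \<theta>1 \<theta>2 \<theta>3"
  have D: "D \<noteq> 0" unfolding D_def using basis_det3_neq_0[OF cen span] .
  have hD: "homogeneous (d1 + d2 + d3) D" unfolding D_def by (rule homogeneous_det3[OF hom])
  have "D * p1 = det3 \<theta> \<theta>2 \<theta>3" "D * p2 = det3 \<theta>1 \<theta> \<theta>3" "D * p3 = det3 \<theta>1 \<theta>2 \<theta>"
    unfolding eq det3_combination D_def by (simp_all add: mult.commute)
  then have h: "homogeneous (d + d2 + d3) (D * p1)" "homogeneous (d1 + d + d3) (D * p2)"
    "homogeneous (d1 + d2 + d) (D * p3)"
    using homogeneous_det3 hom \<theta>(2) by metis+
  have "homogeneous_quot d d1 p1" "homogeneous_quot d d2 p2" "homogeneous_quot d d3 p3"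
    using homogeneous_factor[OF h(1) hD D] homogeneous_factor[OF h(2) hD D] homogeneous_factor[OF h(3) hD D]
    by (auto simp: homogeneous_quot_def)
  with eq show ?thesis by blast
qed

lemma homogeneous_smult_span:
  assumes "homogeneous_quot d e p" "e \<le> d"
  shows "p *s \<theta> \<in> Cder.span ((\<lambda>m. Poly_Mapping.single m 1 *s \<theta>) ` monomials (d - e))"
proof -
  have "p *s \<theta> = (\<Sum>m\<in>Poly_Mapping.keys p. Poly_Mapping.single m (Poly_Mapping.lookup p m)) *s \<theta>"
    using poly_mapping_sum_single[of p] by simp
  also have "\<dots> = (\<Sum>m\<in>Poly_Mapping.keys p. Poly_Mapping.single m (Poly_Mapping.lookup p m) *s \<theta>)"
    by (simp add: Der.scale_sum_left)
  also have "\<dots> = (\<Sum>m\<in>Poly_Mapping.keys p. PConst (Poly_Mapping.lookup p m) *s (Poly_Mapping.single m 1 *s \<theta>))"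
    by (intro sum.cong refl) (simp add: PConst_def mult_single)
  also have "\<dots> \<in> Cder.span ((\<lambda>m. Poly_Mapping.single m 1 *s \<theta>) ` monomials (d - e))"
  proof (intro Cder.span_sum Cder.span_scale Cder.span_base imageI)
    fix m assume "m \<in> Poly_Mapping.keys p"
    then show "m \<in> monomials (d - e)"
      using assms by (auto simp: homogeneous_quot_def homogeneous_def monomials_def)
  qed
  finally show ?thesis .
qed

lemma log_derivations_deg_upper_bound:
  assumes cen: "central_arrangement \<A>" and span: "Der.span {\<theta>1, \<theta>2, \<theta>3} = log_derivations \<A>"
    and hom: "homogeneous_deriv d1 \<theta>1" "homogeneous_deriv d2 \<theta>2" "homogeneous_deriv d3 \<theta>3"
    and d: "d1 \<le> d" "d2 \<le> d" "d3 \<le> d"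
    and B: "Cder.independent B" "B \<subseteq> log_derivations_deg \<A> d"
  shows "card B \<le> card (monomials (d - d1)) + card (monomials (d - d2)) + card (monomials (d - d3))"
proof -
  define T where "T e \<theta> = (\<lambda>m. Poly_Mapping.single m 1 *s \<theta>) ` monomials (d - e)" for e and \<theta> :: derivation
  have fin: "finite (T e \<theta>)" for e \<theta> by (simp add: T_def card_monomials)
  have cardT: "card (T e \<theta>) \<le> card (monomials (d - e))" for e \<theta>
    unfolding T_def by (rule card_image_le) (rule card_monomials)
  let ?T = "T d1 \<theta>1 \<union> T d2 \<theta>2 \<union> T d3 \<theta>3"
  have "B \<subseteq> Cder.span ?T"
  proof
    fix \<theta> assume "\<theta> \<in> B"
    then have "\<theta> \<in> log_derivations \<A>" "homogeneous_deriv d \<theta>"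
      using B(2) by (auto simp: log_derivations_deg_def)
    then obtain p1 p2 p3 where eq: "\<theta> = p1 *s \<theta>1 + p2 *s \<theta>2 + p3 *s \<theta>3"
      and p: "homogeneous_quot d d1 p1" "homogeneous_quot d d2 p2" "homogeneous_quot d d3 p3"
      using basis_coefficients[OF cen span hom] by blast
    have mono: "Cder.span (T d1 \<theta>1) \<subseteq> Cder.span ?T" "Cder.span (T d2 \<theta>2) \<subseteq> Cder.span ?T"
      "Cder.span (T d3 \<theta>3) \<subseteq> Cder.span ?T" by (intro Cder.span_mono; blast)+
    have "p1 *s \<theta>1 \<in> Cder.span ?T" "p2 *s \<theta>2 \<in> Cder.span ?T" "p3 *s \<theta>3 \<in> Cder.span ?T"
      using mono homogeneous_smult_span[OF p(1) d(1), of \<theta>1] homogeneous_smult_span[OF p(2) d(2), of \<theta>2]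
        homogeneous_smult_span[OF p(3) d(3), of \<theta>3]
      unfolding T_def by blast+
    then show "\<theta> \<in> Cder.span ?T" unfolding eq by (intro Cder.span_add)
  qed
  then have "card B \<le> card ?T"
    using Cder.independent_span_bound[of ?T B] B(1) fin by simp
  also have "\<dots> \<le> card (T d1 \<theta>1) + card (T d2 \<theta>2) + card (T d3 \<theta>3)"
    by (meson add_le_mono1 card_Un_le order_trans)
  also have "\<dots> \<le> card (monomials (d - d1)) + card (monomials (d - d2)) + card (monomials (d - d3))"
    by (intro add_mono cardT)
  finally show ?thesis .
qed

text \<open>Twice the comparison of the two dimension bounds. The quadratic terms in d cancel; the
  remaining slope forces the sum of the degrees to be \<open>card \<A>\<close> once d is large, and
  the constant term then bounds the Moebius sum.\<close>

lemma hilbert_inequality: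
  assumes cen: "central_arrangement \<A>" and span: "Der.span {\<theta>1, \<theta>2, \<theta>3} = log_derivations \<A>"
    and hom: "homogeneous_deriv d1 \<theta>1" "homogeneous_deriv d2 \<theta>2" "homogeneous_deriv d3 \<theta>3"
    and d: "d1 \<le> d" "d2 \<le> d" "d3 \<le> d" "card \<A> \<le> d"
  shows "2 * int d * (int (d1 + d2 + d3) - int (card \<A>)) \<le>
    2 * int (mobius_sum \<A>) + (int d1)\<^sup>2 + (int d2)\<^sup>2 + (int d3)\<^sup>2 - 3 * int (d1 + d2 + d3)
      + 3 * int (card \<A>) - (int (card \<A>))\<^sup>2"
proof -
  obtain B where B: "Cder.independent B" "B \<subseteq> log_derivations_deg \<A> d"
    "3 * card (monomials d) + (\<Sum>k<card \<A>. k) \<le> card B + card \<A> * (d + 1) + mobius_sum \<A>"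
    using log_derivations_deg_lower_bound[OF cen d(4)] by blast
  have up: "card B \<le> card (monomials (d - d1)) + card (monomials (d - d2)) + card (monomials (d - d3))"
    by (rule log_derivations_deg_upper_bound[OF cen span hom d(1-3) B(1,2)])
  have c: "2 * int (card (monomials (d - e))) = (int d - int e + 2) * (int d - int e + 1)" if ed: "e \<le> d" for e
  proof -
    obtain k where k: "d = e + k" using le_Suc_ex[OF ed] by blast
    have "int (2 * card (monomials k)) = int ((k + 2) * (k + 1))" by (simp only: card_monomials(2))
    then have "2 * int (card (monomials k)) = (int k + 2) * (int k + 1)"
      by (simp only: of_nat_mult of_nat_add of_nat_numeral of_nat_1)
    moreover have "d - e = k" "int d - int e = int k" using k by simp_all
    ultimately show ?thesis by (simp only:)
  qed
  have c0: "2 * int (card (monomials d)) = (int d + 2) * (int d + 1)"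
    using c[of 0] by simp
  have s: "2 * int (\<Sum>k<n. k) = int n * (int n - 1)" for n
    by (induction n) (auto simp: algebra_simps)
  have "3 * (2 * int (card (monomials d))) + 2 * int (\<Sum>k<card \<A>. k) \<le>
      2 * int (card (monomials (d - d1))) + 2 * int (card (monomials (d - d2))) +
      2 * int (card (monomials (d - d3))) + 2 * (int (card \<A>) * (int d + 1)) + 2 * int (mobius_sum \<A>)"
  proof -
    have "int (3 * card (monomials d) + (\<Sum>k<card \<A>. k)) \<le>
      int (card (monomials (d - d1)) + card (monomials (d - d2)) + card (monomials (d - d3)) +
        card \<A> * (d + 1) + mobius_sum \<A>)"
      using B(3) up by (intro of_nat_mono) linarith
    then show ?thesis by (simp add: algebra_simps)
  qed
  then show ?thesis
    unfolding c[OF d(1)] c[OF d(2)] c[OF d(3)] c0 s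
    by (simp add: algebra_simps power2_eq_square)
qed

text \<open>Terao's factorization theorem, of which only this half follows from counting dimensions.\<close>

lemma free_exponents_bounds:
  assumes cen: "central_arrangement \<A>" and free: "free_with_exponents \<A> 1 a b"
  shows "free_pair \<A> a b \<and> a * b + a + b \<le> mobius_sum \<A>"
proof -
  obtain \<theta>1 \<theta>2 \<theta>3 where span: "Der.span {\<theta>1, \<theta>2, \<theta>3} = log_derivations \<A>"
    and hom: "homogeneous_deriv 1 \<theta>1" "homogeneous_deriv a \<theta>2" "homogeneous_deriv b \<theta>3"
    using free unfolding free_with_exponents_def by blast
  have log: "\<theta>1 \<in> log_derivations \<A>" "\<theta>2 \<in> log_derivations \<A>" "\<theta>3 \<in> log_derivations \<A>"
    unfolding span[symmetric] by (simp_all add: Der.span_base)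
  define D where "D = det3 \<theta>1 \<theta>2 \<theta>3"
  have D0: "D \<noteq> 0" unfolding D_def using basis_det3_neq_0[OF cen span] .
  have hD: "homogeneous (1 + a + b) D" unfolding D_def by (rule homogeneous_det3[OF hom])
  obtain q where q: "D = Qp \<A> * q"
    using Qp_dvd_det3[OF cen log] unfolding D_def by (elim dvdE)
  have "q \<noteq> 0" using D0 q by auto
  then have N1: "card \<A> \<le> 1 + a + b" and hq: "homogeneous (1 + a + b - card \<A>) q"
    using homogeneous_factor[OF _ homogeneous_Qp[OF cen] Qp_neq_0[OF cen]] hD unfolding q by blast+
  define C where "C = 2 * int (mobius_sum \<A>) + (int 1)\<^sup>2 + (int a)\<^sup>2 + (int b)\<^sup>2 - 3 * int (1 + a + b)
      + 3 * int (card \<A>) - (int (card \<A>))\<^sup>2"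
  have ineq: "2 * int d * (int (1 + a + b) - int (card \<A>)) \<le> C"
    if "1 \<le> d" "a \<le> d" "b \<le> d" "card \<A> \<le> d" for d
    unfolding C_def by (rule hilbert_inequality[OF cen span hom that])
  \<comment> \<open>The converse half of Saito's criterion: if \<open>Qp \<A>\<close> had smaller
    degree than D, the left side of \<open>ineq\<close> would grow with d beyond the fixed
    C.\<close>
  have N: "card \<A> = 1 + a + b"
  proof (rule ccontr)
    assume "card \<A> \<noteq> 1 + a + b"
    then have ge: "1 \<le> int (1 + a + b) - int (card \<A>)" using N1 by linarith
    define d where "d = 1 + a + b + card \<A> + nat \<bar>C\<bar>"
    have "2 * int d * 1 \<le> 2 * int d * (int (1 + a + b) - int (card \<A>))"
      using ge by (intro mult_left_mono) auto
    also have "\<dots> \<le> C" by (rule ineq) (auto simp: d_def)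
    finally show False by (simp add: d_def)
  qed
  have "0 \<le> C" using ineq[of "1 + a + b"] N by simp
  then have "2 * int (a * b + a + b) \<le> 2 * int (mobius_sum \<A>)"
    unfolding C_def N by (simp add: power2_eq_square algebra_simps)
  then have M: "a * b + a + b \<le> mobius_sum \<A>"
    by (simp only: mult_le_cancel_left_pos zero_less_numeral of_nat_le_iff)
  obtain k where k: "q = PConst k"
    using homogeneous_0_const[of q] hq N by auto
  with \<open>q \<noteq> 0\<close> have k0: "k \<noteq> 0" by auto
  have D: "D = PConst k * Qp \<A>" using q k by simp
  have scale: "PConst c * D = PConst (c * k) * Qp \<A>" for c unfolding D by (intro evp_eqI) simp
  obtain p1 p2 p3 where E: "Eu = p1 *s \<theta>1 + p2 *s \<theta>2 + p3 *s \<theta>3"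
    and p: "homogeneous_quot (Suc 0) 1 p1" "homogeneous_quot (Suc 0) a p2" "homogeneous_quot (Suc 0) b p3"
    using basis_coefficients[OF cen span hom Eu_log_derivations[OF cen] homogeneous_Eu] by blast
  have const: "\<exists>c. c \<noteq> 0 \<and> x = PConst c" if "homogeneous_quot (Suc 0) 1 x" "x \<noteq> 0" for x
  proof -
    have "homogeneous 0 x" using that by (simp add: homogeneous_quot_def)
    from homogeneous_0_const[OF this] that(2) show ?thesis by (metis PConst_eq_0_iff)
  qed
  have "free_pair \<A> a b"
  proof -
    \<comment> \<open>The Euler derivation has degree 1, so a basis element of degree 1 with nonzero
      coefficient has a constant coefficient and can be exchanged for it.\<close>
    consider "p1 \<noteq> 0" | "p2 \<noteq> 0" "a = 1" | "p3 \<noteq> 0" "b = 1" | "p1 = 0" "p2 = 0 \<or> a = 0" "p3 = 0 \<or> b = 0"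
      using p(2,3) by (auto simp: homogeneous_quot_def le_Suc_eq)
    then show ?thesis
    proof cases
      case 1
      then obtain c where c: "c \<noteq> 0" "p1 = PConst c" using const p(1) by blast
      have "det3 Eu \<theta>2 \<theta>3 = PConst (c * k) * Qp \<A>"
        unfolding E det3_combination using scale[of c] by (simp add: c(2) D_def)
      then show ?thesis unfolding free_pair_def
        using log hom c(1) k0 by (metis mult_eq_0_iff)
    next
      case 2
      then obtain c where c: "c \<noteq> 0" "p2 = PConst c" using const p(2) by blast
      have "det3 Eu \<theta>1 \<theta>3 = - det3 \<theta>1 Eu \<theta>3" unfolding det3_def by (simp add: algebra_simps)
      also have "\<dots> = - (PConst c * D)" unfolding E det3_combination by (simp add: c(2) D_def)
      also have "\<dots> = PConst (- (c * k)) * Qp \<A>" unfolding scale by (intro evp_eqI) simp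
      finally show ?thesis unfolding free_pair_def
        using log hom c(1) k0 2 by (metis mult_eq_0_iff neg_equal_0_iff_equal)
    next
      case 3
      then obtain c where c: "c \<noteq> 0" "p3 = PConst c" using const p(3) by blast
      have "det3 Eu \<theta>2 \<theta>1 = - det3 \<theta>1 \<theta>2 Eu" unfolding det3_def by (simp add: algebra_simps)
      also have "\<dots> = - (PConst c * D)" unfolding E det3_combination by (simp add: c(2) D_def)
      also have "\<dots> = PConst (- (c * k)) * Qp \<A>" unfolding scale by (intro evp_eqI) simp
      finally show ?thesis unfolding free_pair_def
        using log hom c(1) k0 3 by (metis mult_eq_0_iff neg_equal_0_iff_equal)
    next
      case 4
      \<comment> \<open>Here only basis fields of degree 0 would occur, and their values are
        constant vectors; two of them cannot span every v.\<close>
      have const_field: "evv \<theta> v = evv \<theta> 0" if "homogeneous_deriv 0 \<theta>" for \<theta> v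
        using evv_homogeneous[OF that, of 0 v] by simp
      have "v \<in> vec.span {evv \<theta>2 0, evv \<theta>3 0}" for v
      proof -
        have "v = evp p2 v *s evv \<theta>2 v + evp p3 v *s evv \<theta>3 v"
          using arg_cong[OF E, of "\<lambda>\<theta>. evv \<theta> v"] 4(1) by simp
        also have "\<dots> = evp p2 v *s evv \<theta>2 0 + evp p3 v *s evv \<theta>3 0"
          using 4(2,3) hom const_field[of \<theta>2 v] const_field[of \<theta>3 v] by auto
        also have "\<dots> \<in> vec.span {evv \<theta>2 0, evv \<theta>3 0}"
          by (intro vec.span_add vec.span_scale vec.span_base) auto
        finally show ?thesis .
      qed
      then have "vec.dim (UNIV :: (complex ^ 3) set) \<le> card {evv \<theta>2 0, evv \<theta>3 0}"
        by (intro vec.dim_le_card) auto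
      also have "\<dots> \<le> 2" by (simp add: card_insert_if)
      finally show ?thesis by (simp add: vec.dim_UNIV card_cart_basis)
    qed
  qed
  with M show ?thesis by blast
qed

subsection \<open>Incidence counts\<close>

lemma mult_at_ge_2:
  assumes "finite \<A>" "P \<in> pts \<A>"
  shows "2 \<le> mult_at \<A> P"
proof -
  obtain H K where "H \<in> \<A>" "K \<in> \<A>" "H \<noteq> K" "P = H \<inter> K" using assms(2) unfolding pts_iff by blast
  then have "{H, K} \<subseteq> {L \<in> \<A>. P \<subseteq> L}" "card {H, K} = 2" by auto
  then show ?thesis unfolding mult_at_def using card_mono[of "{L \<in> \<A>. P \<subseteq> L}" "{H, K}"] assms(1) by simp
qed

lemma sum_restr_swap:
  assumes cen: "central_arrangement \<A>"
  shows "(\<Sum>H\<in>\<A>. \<Sum>P\<in>restr \<A> H. f P) = (\<Sum>P\<in>pts \<A>. mult_at \<A> P * (f P :: nat))"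
proof -
  have fin: "finite \<A>" using cen by (rule central_arrangementD)
  have "(\<Sum>H\<in>\<A>. \<Sum>P\<in>restr \<A> H. f P) = (\<Sum>H\<in>\<A>. \<Sum>P\<in>pts \<A>. if P \<subseteq> H then f P else 0)"
    by (rule sum.cong[OF refl]) (simp only: restr_eq_pts[OF cen] sum.inter_filter[OF finite_pts[OF fin]])
  also have "\<dots> = (\<Sum>P\<in>pts \<A>. \<Sum>H\<in>\<A>. if P \<subseteq> H then f P else 0)"
    by (rule sum.swap)
  also have "\<dots> = (\<Sum>P\<in>pts \<A>. mult_at \<A> P * f P)"
    using fin by (intro sum.cong refl) (simp add: mult_at_def sum.If_cases Int_def)
  finally show ?thesis .
qed

text \<open>Each other plane meets H in exactly one of its lines, and m_P - 1 of them meet it in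
  P.\<close>

lemma sum_restr:
  assumes cen: "central_arrangement \<A>" and H: "H \<in> \<A>"
  shows "(\<Sum>P\<in>restr \<A> H. mult_at \<A> P - 1) = card \<A> - 1"
proof -
  have fin: "finite \<A>" using cen by (rule central_arrangementD)
  have fib: "card {K \<in> \<A> - {H}. H \<inter> K = P} = mult_at \<A> P - 1" if P: "P \<in> restr \<A> H" for P
  proof -
    obtain L where L: "L \<in> \<A>" "L \<noteq> H" "P = H \<inter> L" using P unfolding restr_def by blast
    have "K \<in> \<A> - {H} \<and> H \<inter> K = P \<longleftrightarrow> K \<in> {K \<in> \<A>. P \<subseteq> K} - {H}" for K
    proof
      assume "K \<in> {K \<in> \<A>. P \<subseteq> K} - {H}"
      then have K: "K \<in> \<A>" "K \<noteq> H" "H \<inter> L \<subseteq> K" using L by auto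
      then have "H \<inter> L = H \<inter> K"
        using L H cen by (intro plane_inter_subset_eq) (auto dest: central_arrangementD)
      then show "K \<in> \<A> - {H} \<and> H \<inter> K = P" using K L by simp
    qed auto
    then have "{K \<in> \<A> - {H}. H \<inter> K = P} = {K \<in> \<A>. P \<subseteq> K} - {H}" by blast
    moreover have "H \<in> {K \<in> \<A>. P \<subseteq> K}" using H L by simp
    ultimately show ?thesis by (simp add: mult_at_def card_Diff_singleton)
  qed
  have "card (\<A> - {H}) = (\<Sum>P\<in>restr \<A> H. card {K \<in> \<A> - {H}. H \<inter> K = P})"
    using sum.image_gen[of "\<A> - {H}" "\<lambda>_. 1::nat" "\<lambda>K. H \<inter> K"] fin by (simp add: restr_def)
  also have "\<dots> = (\<Sum>P\<in>restr \<A> H. mult_at \<A> P - 1)" by (rule sum.cong[OF refl], rule fib)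
  finally show ?thesis using H by simp
qed

lemma mult_at_insert:
  assumes "finite \<A>" "H \<notin> \<A>"
  shows "mult_at (insert H \<A>) P = mult_at \<A> P + (if P \<subseteq> H then 1 else 0)"
proof (cases "P \<subseteq> H")
  case True
  then have "{L \<in> insert H \<A>. P \<subseteq> L} = insert H {L \<in> \<A>. P \<subseteq> L}" by auto
  then show ?thesis using assms True by (simp add: mult_at_def)
next
  case False
  then have "{L \<in> insert H \<A>. P \<subseteq> L} = {L \<in> \<A>. P \<subseteq> L}" by auto
  then show ?thesis using False by (simp add: mult_at_def)
qed

text \<open>With \<open>x\<^sub>P\<close> one less than the number of planes through \<open>P\<close>, the counts give
  \<open>\<Sum> x\<^sub>P\<close>, \<open>\<Sum> x\<^sub>P\<^sup>2\<close> and a bound for the number of lines, and the conclusion follows from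
  \<open>\<Sum> (x\<^sub>P - 2)\<^sup>2 \<ge> 0\<close>.\<close>

lemma no_deletion_imp_dual_Hesse_lattice:
  assumes cen: "central_arrangement \<A>" and N: "card \<A> = 1 + a + b" "card \<A> \<ge> 2"
    and M: "a * b + a + b \<le> mobius_sum \<A>" and ab: "a \<le> b" "a \<le> 4"
    and restr: "\<And>H. H \<in> \<A> \<Longrightarrow> card (restr \<A> H) \<le> a"
  shows "a = 4 \<and> b = 4 \<and> mobius_sum \<A> = 24 \<and> card (pts \<A>) = 12 \<and> (\<forall>P\<in>pts \<A>. mult_at \<A> P = 3)"
proof -
  have fin: "finite \<A>" using cen by (rule central_arrangementD)
  have finP: "finite (pts \<A>)" using fin by (rule finite_pts)
  define x where "x P = int (mult_at \<A> P) - 1" for P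
  define m where "m = int (mobius_sum \<A>)"
  define c where "c = int (card (pts \<A>))"
  define n where "n = int (card \<A>)"
  have x: "int (mult_at \<A> P - 1) = x P" if "P \<in> pts \<A>" for P
    using mult_at_ge_2[OF fin that] by (simp add: x_def)
  have S1: "(\<Sum>P\<in>pts \<A>. x P) = m"
    unfolding m_def mobius_sum_def of_nat_sum by (rule sum.cong[OF refl], rule x[symmetric])
  have "(\<Sum>P\<in>pts \<A>. mult_at \<A> P * (mult_at \<A> P - 1)) = card \<A> * (card \<A> - 1)"
  proof -
    have "(\<Sum>H\<in>\<A>. \<Sum>P\<in>restr \<A> H. mult_at \<A> P - 1) = (\<Sum>H\<in>\<A>. card \<A> - 1)"
      by (rule sum.cong[OF refl], rule sum_restr[OF cen])
    then show ?thesis unfolding sum_restr_swap[OF cen] by simp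
  qed
  from arg_cong[OF this, of int] have "(\<Sum>P\<in>pts \<A>. int (mult_at \<A> P) * int (mult_at \<A> P - 1)) = n * (n - 1)"
    using N(2) by (simp only: of_nat_sum of_nat_mult) (simp add: n_def of_nat_diff)
  moreover have "(\<Sum>P\<in>pts \<A>. (x P + 1) * x P) = (\<Sum>P\<in>pts \<A>. int (mult_at \<A> P) * int (mult_at \<A> P - 1))"
    by (intro sum.cong refl) (simp only: x, simp add: x_def)
  ultimately have S2: "(\<Sum>P\<in>pts \<A>. (x P + 1) * x P) = n * (n - 1)" by simp
  have "(\<Sum>P\<in>pts \<A>. mult_at \<A> P) = (\<Sum>H\<in>\<A>. card (restr \<A> H))"
    using sum_restr_swap[OF cen, of "\<lambda>_. 1"] by simp
  also have "\<dots> \<le> card \<A> * a" using restr sum_bounded_above[of \<A> "\<lambda>H. card (restr \<A> H)" a] by simp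
  finally have "int (\<Sum>P\<in>pts \<A>. mult_at \<A> P) \<le> int (card \<A> * a)" by (rule of_nat_mono)
  then have "(\<Sum>P\<in>pts \<A>. x P + 1) \<le> n * int a" by (simp add: x_def n_def)
  then have c: "m + c \<le> n * int a" by (simp add: sum.distrib S1 c_def)
  \<comment> \<open>The centre 2 is the value of x_P at a triple line, where equality will
    hold.\<close>
  have "(\<Sum>P\<in>pts \<A>. (x P - 2)\<^sup>2) = (\<Sum>P\<in>pts \<A>. (x P + 1) * x P - 5 * x P + 4)"
    by (intro sum.cong refl) (simp add: power2_eq_square algebra_simps)
  also have "\<dots> = n * (n - 1) - 5 * m + 4 * c"
    by (simp add: sum.distrib sum_subtractf S2 S1 c_def flip: sum_distrib_left)
  finally have var: "(\<Sum>P\<in>pts \<A>. (x P - 2)\<^sup>2) = n * (n - 1) - 5 * m + 4 * c" .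
  have var0: "0 \<le> (\<Sum>P\<in>pts \<A>. (x P - 2)\<^sup>2)" by (intro sum_nonneg) simp
  have n: "n = 1 + int a + int b" using N by (simp add: n_def)
  have m: "int a * int b + int a + int b \<le> m" using of_nat_mono[OF M, where ?'a = int] by (simp add: m_def)
  have c1: "1 \<le> c"
  proof -
    obtain H K where HK: "H \<in> \<A>" "K \<in> \<A>" "H \<noteq> K"
      using N(2) by (metis card_le_Suc0_iff_eq fin not_less_eq_eq numeral_2_eq_2)
    then have "pts \<A> \<noteq> {}" unfolding pts_iff ex_in_conv[symmetric] by blast
    then show ?thesis using finP by (simp add: c_def card_gt_0_iff Suc_le_eq flip: of_nat_Suc)
  qed
  have b: "int b + 1 \<le> int a * int a"
    using c c1 m by (simp add: n algebra_simps)
  \<comment> \<open>Four times \<open>m + c \<le> n a\<close> eliminates c from the variance; the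
    coefficient of m is then -9, so m may be replaced by its lower bound.\<close>
  have q: "0 \<le> n * (n - 1) + 4 * (n * int a) - 9 * (int a * int b + int a + int b)"
  proof -
    have "0 \<le> A + 4 * B - 9 * C" if "0 \<le> A - 5 * m + 4 * c" "m + c \<le> B" "C \<le> m" for A B C :: int
      using that by linarith
    from this[OF _ c m] show ?thesis using var0 unfolding var by blast
  qed
  \<comment> \<open>For a = 4 condition \<open>q\<close> says (b - 4)(b - 16) \<ge> 0, and
    \<open>b\<close> excludes b \<ge> 16. For smaller a no b \<ge> a meets both conditions, which a
    finite check confirms.\<close>
  have ab4: "a = 4 \<and> b = 4"
  proof -
    have "b < 16"
    proof -
      have "int a * int a \<le> 4 * 4" using ab(2) by (intro mult_mono) auto
      with b show ?thesis by linarith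
    qed
    then have bcases: "b \<in> {0,1,2,3,4,5,6,7,8,9,10,11,12,13,14,15}"
      by (simp only: insert_iff empty_iff) presburger
    have acases: "a \<in> {0,1,2,3,4}" using ab(2) by auto
    show ?thesis using acases bcases q b ab(1) unfolding n by (elim insertE emptyE; simp)
  qed
  then have n9: "n = 9" by (simp add: n)
  have m24: "m = 24" and c12: "c = 12"
  proof -
    have "0 \<le> 72 - 5 * m + 4 * c" using var0 unfolding var n9 by simp
    moreover have "m + c \<le> 36" "24 \<le> m" using c m ab4 unfolding n9 by simp_all
    ultimately show "m = 24" "c = 12" by linarith+
  qed
  have "(\<Sum>P\<in>pts \<A>. (x P - 2)\<^sup>2) = 0" unfolding var n9 m24 c12 by simp
  then have "\<forall>P\<in>pts \<A>. (x P - 2)\<^sup>2 = 0"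
    using sum_nonneg_eq_0_iff[OF finP, of "\<lambda>P. (x P - 2)\<^sup>2"] by simp
  then have "\<forall>P\<in>pts \<A>. mult_at \<A> P = 3" by (auto simp: x_def)
  then show ?thesis using ab4 m24 c12 by (simp add: m_def c_def)
qed

subsection \<open>Dual Hesse arrangements\<close>

lemma dim_inter_planes:
  assumes "linear_plane H" "linear_plane K" "H \<noteq> K"
  shows "vec.dim (H \<inter> K) = 1"
proof -
  obtain v where v: "v \<noteq> 0" "v \<in> H" "v \<in> K" using plane_inter_nonzero[OF assms] by blast
  have "H \<inter> K = vec.span {v}" using plane_inter_line[OF assms v(2,3,1)] by (simp add: vec.span_singleton)
  moreover have "vec.independent {v}" using v(1) by simp
  ultimately show ?thesis using vec.dim_span_eq_card_independent[of "{v}"] by simp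
qed

text \<open>The empty intersection has dimension 3 and a single plane dimension 2, so a line needs
  two of the planes, and any two of them already cut it out.\<close>

lemma L2_eq_pts:
  assumes cen: "central_arrangement \<A>"
  shows "L2 \<A> = pts \<A>"
proof
  have pl: "linear_plane H" if "H \<in> \<A>" for H using cen that by (rule central_arrangementD)
  show "pts \<A> \<subseteq> L2 \<A>"
  proof
    fix P assume "P \<in> pts \<A>"
    then obtain H K where HK: "H \<in> \<A>" "K \<in> \<A>" "H \<noteq> K" "P = H \<inter> K" unfolding pts_iff by blast
    then have "vec.dim P = 1" using dim_inter_planes pl by simp
    moreover have "{H, K} \<subseteq> \<A>" "P = \<Inter>{H, K}" using HK by auto
    ultimately show "P \<in> L2 \<A>" unfolding L2_def by blast
  qed
  show "L2 \<A> \<subseteq> pts \<A>"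
  proof
    fix X assume "X \<in> L2 \<A>"
    then obtain \<B> where B: "\<B> \<subseteq> \<A>" "X = \<Inter>\<B>" "vec.dim X = 1" unfolding L2_def by blast
    have "\<B> \<noteq> {}" using B(2,3) by (auto simp: vec.dim_UNIV card_cart_basis)
    then obtain H where H: "H \<in> \<B>" by blast
    have "\<B> \<noteq> {H}" using B pl[of H] H by (auto simp: linear_plane_def)
    then obtain K where K: "K \<in> \<B>" "K \<noteq> H" using H by blast
    have HK: "H \<in> \<A>" "K \<in> \<A>" using H K B by auto
    have "vec.subspace X" unfolding B(2)
      using B(1) pl by (intro vec.subspace_Inter) (auto intro: linear_plane_subspace)
    moreover have "vec.subspace (H \<inter> K)" using HK pl by (intro vec.subspace_inter linear_plane_subspace)
    moreover have "X \<subseteq> H \<inter> K" using B(2) H K by blast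
    moreover have "vec.dim (H \<inter> K) \<le> vec.dim X" using dim_inter_planes[of H K] HK K(2) pl B(3) by simp
    ultimately have "X = H \<inter> K" by (rule vec.subspace_dim_equal)
    then show "X \<in> pts \<A>" unfolding pts_iff using HK K(2) by blast
  qed
qed

lemma dual_Hesse_iff:
  assumes "central_arrangement \<A>"
  shows "dual_Hesse \<A> \<longleftrightarrow> card \<A> = 9 \<and> card (pts \<A>) = 12 \<and> (\<forall>P\<in>pts \<A>. mult_at \<A> P = 3)"
  by (simp add: dual_Hesse_def triple_line_def mult_at_def L2_eq_pts[OF assms])

lemma dual_Hesse_mobius_sum:
  "central_arrangement \<A> \<Longrightarrow> dual_Hesse \<A> \<Longrightarrow> mobius_sum \<A> = 24"
  by (simp add: dual_Hesse_iff mobius_sum_def)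

text \<open>The eight other planes are distributed in pairs over the triple lines on H.\<close>

lemma dual_Hesse_restr:
  assumes cen: "central_arrangement \<A>" and "dual_Hesse \<A>" and H: "H \<in> \<A>"
  shows "card (restr \<A> H) = 4"
proof -
  have "(\<Sum>P\<in>restr \<A> H. mult_at \<A> P - 1) = (\<Sum>P\<in>restr \<A> H. 2)"
    using assms dual_Hesse_iff[OF cen] restr_eq_pts[OF cen H] by (intro sum.cong) auto
  then show ?thesis using sum_restr[OF cen H] assms dual_Hesse_iff[OF cen] by simp
qed

text \<open>Adding to a dual Hesse arrangement a plane \<open>H\<close> with five intersection lines: one of
  these lies in a single old plane \<open>L\<close>, which has five intersection lines as well and whose
  triple lines become double when it is removed.\<close>

lemma dual_Hesse_addition:
  assumes cen: "central_arrangement \<A>" and H: "H \<in> \<A>" and DH: "dual_Hesse (\<A> - {H})"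
    and five: "card (restr \<A> H) = 5"
  shows "\<exists>L\<in>\<A>. card (restr \<A> L) = 5 \<and> \<not> dual_Hesse (\<A> - {L})"
proof -
  define \<B> where "\<B> = \<A> - {H}"
  have A: "\<A> = insert H \<B>" "H \<notin> \<B>" using H by (auto simp: \<B>_def)
  have cenB: "central_arrangement \<B>" using cen by (rule central_arrangement_subset) (auto simp: A)
  have finB: "finite \<B>" using cenB by (rule central_arrangementD)
  have pl: "linear_plane K" if "K \<in> \<A>" for K using cen that by (rule central_arrangementD)
  have DHB: "dual_Hesse \<B>" using DH by (simp add: \<B>_def)
  have card9: "card \<B> = 9" and three: "\<And>P. P \<in> pts \<B> \<Longrightarrow> mult_at \<B> P = 3"
    using DHB dual_Hesse_iff[OF cenB] by auto
  have mult: "mult_at \<A> P = mult_at \<B> P + (if P \<subseteq> H then 1 else 0)" for P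
    unfolding A(1) using finB A(2) by (rule mult_at_insert)
  \<comment> \<open>If every line on H lay in three old planes, there would be 15 old planes instead
    of 9.\<close>
  have "\<exists>P\<in>restr \<A> H. mult_at \<B> P \<noteq> 3"
  proof (rule ccontr)
    assume "\<not> (\<exists>P\<in>restr \<A> H. mult_at \<B> P \<noteq> 3)"
    then have "(\<Sum>P\<in>restr \<A> H. mult_at \<A> P - 1) = (\<Sum>P\<in>restr \<A> H. 3)"
      by (intro sum.cong refl) (auto simp: mult restr_def)
    then show False using sum_restr[OF cen H] five finB A(2) card9 by (simp add: A(1))
  qed
  then obtain P where P: "P \<in> restr \<A> H" "mult_at \<B> P \<noteq> 3" by blast
  then have Pn: "P \<notin> pts \<B>" using three by blast
  obtain L where L: "L \<in> \<B>" "P = H \<inter> L" using P(1) unfolding restr_def A(1) by blast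
  have "L \<noteq> H" using L A(2) by blast
  \<comment> \<open>The four old lines on L and the new line P make five.\<close>
  have "restr \<A> L = insert P (restr \<B> L)"
    using L \<open>L \<noteq> H\<close> by (auto simp: restr_def A(1))
  moreover have "P \<notin> restr \<B> L" using Pn L(1) unfolding pts_def by blast
  ultimately have cardL: "card (restr \<A> L) = 5"
    using dual_Hesse_restr[OF cenB DHB L(1)] finite_restr[OF finB] by simp
  have "restr \<B> L \<noteq> {}" using dual_Hesse_restr[OF cenB DHB L(1)] by auto
  then obtain Q where "Q \<in> restr \<B> L" by blast
  then obtain K where K: "K \<in> \<B>" "K \<noteq> L" "Q = L \<inter> K" unfolding restr_def by blast
  have Qpt: "Q \<in> pts \<B>" unfolding pts_iff using K L(1) by blast
  have "\<not> Q \<subseteq> H"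
  proof
    assume "Q \<subseteq> H"
    then have "L \<inter> K = L \<inter> H"
      using K L(1) \<open>L \<noteq> H\<close> pl by (intro plane_inter_subset_eq) (auto simp: A(1))
    then have "Q = P" using K(3) L(2) by (simp add: Int_commute)
    with Pn Qpt show False by simp
  qed
  then have multQ: "mult_at \<A> Q = 3" using mult three[OF Qpt] by simp
  have LA: "L \<in> \<A>" using L(1) by (simp add: A(1))
  have "\<A> = insert L (\<A> - {L})" using LA by blast
  then have "mult_at \<A> Q = mult_at (\<A> - {L}) Q + 1"
    using mult_at_insert[of "\<A> - {L}" L Q] finB K(3) by (simp add: A(1))
  then have two: "mult_at (\<A> - {L}) Q = 2" using multQ by simp
  have "Q \<in> pts (\<A> - {L})"
  proof -
    obtain S T where "{M \<in> \<A> - {L}. Q \<subseteq> M} = {S, T}" "S \<noteq> T"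
      using two unfolding mult_at_def card_2_iff by blast
    then have ST: "S \<in> \<A>" "T \<in> \<A>" "S \<noteq> L" "T \<noteq> L" "Q \<subseteq> S" "Q \<subseteq> T" "S \<noteq> T" by blast+
    have KA: "K \<in> \<A>" using K(1) by (simp add: A(1))
    obtain v where v: "v \<noteq> 0" "v \<in> L" "v \<in> K" using plane_inter_nonzero[of L K] pl LA KA K(2) by blast
    then have vST: "v \<in> S" "v \<in> T" using ST K(3) by blast+
    have "Q = range (\<lambda>t. t *s v)"
      unfolding K(3) using v K(2) by (intro plane_inter_line pl LA KA) auto
    also have "\<dots> = S \<inter> T"
      using v vST ST by (intro plane_inter_line[symmetric] pl) auto
    finally show ?thesis unfolding pts_iff using ST by blast
  qed
  then have "\<not> dual_Hesse (\<A> - {L})"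
    using two dual_Hesse_iff[OF central_arrangement_subset[OF cen, of "\<A> - {L}"]] by auto
  with cardL LA show ?thesis by blast
qed

subsection \<open>Classification\<close>

lemma inductively_free_insert:
  assumes fin: "finite \<A>" and H: "H \<in> \<A>" and free: "free_arrangement \<A>" and ind: "inductively_free (\<A> - {H})"
  shows "inductively_free \<A>"
proof -
  have c: "card \<A> = Suc (card (\<A> - {H}))" using fin H by (metis card.remove)
  obtain F where F: "F (card (\<A> - {H})) = \<A> - {H}"
    "\<forall>i\<in>{1..card (\<A> - {H})}. card (F i) = i \<and> free_arrangement (F i)"
    "\<forall>i\<in>{1..<card (\<A> - {H})}. F i \<subset> F (Suc i)"
    using ind unfolding inductively_free_def by blast
  define G where "G i = (if i = card \<A> then \<A> else F i)" for i
  have "card (G i) = i \<and> free_arrangement (G i)" if "i \<in> {1..card \<A>}" for i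
    using bspec[OF F(2), of i] that free c by (auto simp: G_def)
  moreover have "G i \<subset> G (Suc i)" if "i \<in> {1..<card \<A>}" for i
  proof (cases "Suc i = card \<A>")
    case True
    then have i: "i = card (\<A> - {H})" "i \<noteq> card \<A>" using c by linarith+
    have "G i = \<A> - {H}" unfolding G_def using i F(1) by metis
    moreover have "G (Suc i) = \<A>" using True by (simp add: G_def)
    ultimately show ?thesis using H by blast
  next
    case False
    then show ?thesis using bspec[OF F(3), of i] that c by (simp add: G_def)
  qed
  ultimately show ?thesis unfolding inductively_free_def by (intro exI[of _ G]) (simp add: G_def)
qed

text \<open>The equality for the Moebius sum is carried along because it identifies the exponents
  when a deletion ends in a dual Hesse arrangement. Deletion lowers an exponent, so the bound 4 on
  the minimum persists.\<close>

lemma free_pair_classification: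
  assumes "central_arrangement \<A>" "free_pair \<A> a b" "min a b \<le> 4"
  shows "mobius_sum \<A> = a * b + a + b \<and> (inductively_free \<A> \<or> dual_Hesse \<A>)"
  using assms
proof (induction "card \<A>" arbitrary: \<A> a b rule: less_induct)
  case less
  note cen = less.prems(1) and fp = less.prems(2) and min4 = less.prems(3)
  have fin: "finite \<A>" using cen by (rule central_arrangementD)
  have N: "card \<A> = 1 + a + b" by (rule free_pair_card[OF cen fp])
  have free: "free_arrangement \<A>" using free_pair_free[OF cen fp] unfolding free_arrangement_def by blast
  have delete: "\<exists>a' b'. free_pair (\<A> - {H}) a' b' \<and> min a' b' \<le> 4 \<and>
      a * b + a + b = a' * b' + a' + b' + card (restr \<A> H) \<and>
      mobius_sum (\<A> - {H}) = a' * b' + a' + b' \<and> mobius_sum \<A> = a * b + a + b \<and>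
      (inductively_free (\<A> - {H}) \<or> dual_Hesse (\<A> - {H}))"
    if H: "H \<in> \<A>" and gt: "\<not> card (restr \<A> H) \<le> min a b" for H
  proof -
    have cen': "central_arrangement (\<A> - {H})" using cen by (rule central_arrangement_subset) auto
    have lt: "card (\<A> - {H}) < card \<A>" by (rule card_Diff1_less[OF fin H])
    have "\<exists>a' b'. free_pair (\<A> - {H}) a' b' \<and> min a' b' \<le> 4 \<and>
      a * b + a + b = a' * b' + a' + b' + card (restr \<A> H)"
      using deletion[OF cen H fp] gt
    proof (elim disjE conjE)
      assume *: "1 \<le> a" "free_pair (\<A> - {H}) (a - 1) b" "card (restr \<A> H) = b + 1"
      then obtain a' where "a = Suc a'" by (cases a) auto
      with * show ?thesis using min4 by (intro exI[of _ a'] exI[of _ b]) auto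
    next
      assume *: "1 \<le> b" "free_pair (\<A> - {H}) a (b - 1)" "card (restr \<A> H) = a + 1"
      then obtain b' where "b = Suc b'" by (cases b) auto
      with * show ?thesis using min4 by (intro exI[of _ a] exI[of _ b']) auto
    qed simp
    then obtain a' b' where *: "free_pair (\<A> - {H}) a' b'" "min a' b' \<le> 4"
      "a * b + a + b = a' * b' + a' + b' + card (restr \<A> H)" by blast
    have IH: "mobius_sum (\<A> - {H}) = a' * b' + a' + b' \<and> (inductively_free (\<A> - {H}) \<or> dual_Hesse (\<A> - {H}))"
      by (rule less.hyps[OF lt cen' *(1,2)])
    have "mobius_sum \<A> = mobius_sum (\<A> - {H}) + card (restr \<A> H)"
      using mobius_sum_insert[of H "\<A> - {H}"] cen H by (simp add: insert_absorb)
    with IH * show ?thesis by metis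
  qed
  show ?case
  proof (cases "\<exists>H\<in>\<A>. \<not> card (restr \<A> H) \<le> min a b")
    case True
    then obtain H where H: "H \<in> \<A>" "\<not> card (restr \<A> H) \<le> min a b" by blast
    have cen': "central_arrangement (\<A> - {H})" using cen by (rule central_arrangement_subset) auto
    obtain a' b' where *: "free_pair (\<A> - {H}) a' b'" "a * b + a + b = a' * b' + a' + b' + card (restr \<A> H)"
      "mobius_sum (\<A> - {H}) = a' * b' + a' + b'" "mobius_sum \<A> = a * b + a + b"
      "inductively_free (\<A> - {H}) \<or> dual_Hesse (\<A> - {H})"
      using delete[OF H] by blast
    show ?thesis
    proof (cases "inductively_free (\<A> - {H})")
      case True
      then show ?thesis using inductively_free_insert[OF fin H(1) free] *(4) by blast
    next
      case False
      then have DH: "dual_Hesse (\<A> - {H})" using *(5) by blast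
      have sum8: "a' + b' = 8"
        using free_pair_card[OF cen' *(1)] DH dual_Hesse_iff[OF cen'] by simp
      \<comment> \<open>Together with a' + b' = 8 this gives a' b' = 16, so both exponents are
        4.\<close>
      have "a' * b' + a' + b' = 24" using dual_Hesse_mobius_sum[OF cen' DH] *(3) by simp
      then have "a' * (8 - a') = 16" "a' \<le> 8" using sum8 by (auto simp: add.assoc) (metis sum8 diff_add_inverse)
      moreover have "a' \<in> {0,1,2,3,4,5,6,7,8}" using \<open>a' \<le> 8\<close> by auto
      ultimately have "a' = 4" by auto
      then have ab': "a' = 4" "b' = 4" using sum8 by auto
      have ab9: "a + b = 9" using N DH dual_Hesse_iff[OF cen'] H(1) fin by simp
      have r: "a * b + a + b = 24 + card (restr \<A> H)" using *(2) ab' by simp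
      \<comment> \<open>With a + b = 9 and ab = 15 + n_H either case forces the exponents 4 and 5
        and n_H = 5.\<close>
      have "card (restr \<A> H) = a + 1 \<or> card (restr \<A> H) = b + 1"
        using deletion[OF cen H(1) fp] H(2) by auto
      moreover have "b = 9 - a" "a \<in> {0,1,2,3,4,5,6,7,8,9}" using ab9 by auto
      ultimately have five: "card (restr \<A> H) = 5 \<and> min a b = 4"
        using r by auto
      \<comment> \<open>As n_L = 5 exceeds min a b = 4, L can be deleted too, and the induction
        hypothesis for \<open>\<A> - {L}\<close> leaves only inductive freeness.\<close>
      obtain L where L: "L \<in> \<A>" "card (restr \<A> L) = 5" "\<not> dual_Hesse (\<A> - {L})"
        using dual_Hesse_addition[OF cen H(1) DH] five by blast
      then have "inductively_free (\<A> - {L})" using delete[of L] five by auto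
      then show ?thesis using inductively_free_insert[OF fin L(1) free] *(4) by blast
    qed
  next
    case False
    then have le: "card (restr \<A> H) \<le> min a b" if "H \<in> \<A>" for H using that by blast
    show ?thesis
    proof (cases "card \<A> \<ge> 2")
      case True
      have M: "a * b + a + b \<le> mobius_sum \<A>"
        using free_exponents_bounds[OF cen free_pair_free[OF cen fp]] by blast
      have "min a b = 4 \<and> max a b = 4 \<and> mobius_sum \<A> = 24 \<and> card (pts \<A>) = 12 \<and> (\<forall>P\<in>pts \<A>. mult_at \<A> P = 3)"
      proof (rule no_deletion_imp_dual_Hesse_lattice[OF cen _ True _ _ min4 le])
        show "card \<A> = 1 + min a b + max a b" using N by (simp add: min_def max_def)
        show "min a b * max a b + min a b + max a b \<le> mobius_sum \<A>"
          using M by (simp add: min_def max_def mult.commute)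
      qed auto
      moreover from this have "a = 4" "b = 4" by linarith+
      ultimately show ?thesis using N dual_Hesse_iff[OF cen] by simp
    next
      case False
      \<comment> \<open>The number of planes is 1 + a + b, so exactly one plane remains and the
        filtration has a single term.\<close>
      then have ab0: "a = 0" "b = 0" "card \<A> = 1" using N by auto
      then obtain H where A: "\<A> = {H}" using card_1_singletonE by blast
      have "pts \<A> = {}" by (auto simp: pts_iff A)
      then have "mobius_sum \<A> = 0" by (simp add: mobius_sum_def)
      moreover have "inductively_free \<A>"
        unfolding inductively_free_def using free ab0 by (intro exI[of _ "\<lambda>_. \<A>"]) auto
      ultimately show ?thesis using ab0 by simp
    qed
  qed
qed

theorem corollary1p4:
  fixes \<A> :: "(complex ^ 3) set set" and a b :: nat
  assumes "central_arrangement \<A>"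
    and "free_with_exponents \<A> 1 a b"
    and "min a b \<le> 4"
  shows "inductively_free \<A> \<or> dual_Hesse \<A>"
  using free_exponents_bounds[OF assms(1,2)] free_pair_classification[OF assms(1) _ assms(3)] by blast

end
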